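(* Let $S$ be a commutative inverse semigroup with set of idempotents $E$ such that $E$ satisfies condition $D_k$ for some $k\in\mathbb N$. Regard $\ell^1(S)$ as an $\ell^1(E)$-module with the actions $\delta_e\cdot\delta_s=\delta_s\cdot\delta_e=\delta_{se}$ ($s\in S,e\in E$). Then $\mathcal T_0=\begin{bmatrix}\ell^1(S)&\ell^1(S)\\&\ell^1(S)\end{bmatrix}$ is permanently weakly module amenable as a $\mathfrak T_0$-module, where $\mathfrak T_0=\left\{\begin{bmatrix}\alpha&\\&\alpha\end{bmatrix}:\alpha\in\ell^1(E)\right\}$.
   Context: A discrete semigroup $S$ is an inverse semigroup if for each $s\in S$ there is a unique $s^*\in S$ with $ss^*s=s$ and $s^*ss^*=s^*$. An idempotent is an $e\in S$ with $e=e^*=e^2$; the set $E$ of idempotents is a commutative subsemigroup, and $\ell^1(E)$ is a subalgebra of the convolution algebra $\ell^1(S)$. $E$ satisfies condition $D_k$ if for any $f_1,\dots,f_{k+1}\in E$ there exist $e\in E$ and $1\le i<j\le k+1$ with $f_ie=f_i$ and $f_je=f_j$. $\mathcal T_0$ is the algebra of matrices $\begin{bmatrix}a&m\\&b\end{bmatrix}$, $a,m,b\in\ell^1(S)$, with the usual $2\times2$ matrix operations (convolution products) and norm $\|a\|+\|m\|+\|b\|$; $\mathfrak T_0$ acts on it entrywise on both sides. Let $\mathfrak A$ be a Banach algebra and $\mathcal A$ a Banach algebra which is a Banach $\mathfrak A$-bimodule with $\alpha\cdot(ab)=(\alpha\cdot a)b$, $(ab)\cdot\alpha=a(b\cdot\alpha)$.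 A Banach $\mathcal A$-$\mathfrak A$-module is a Banach $\mathcal A$-bimodule and Banach $\mathfrak A$-bimodule $X$ with $\alpha\cdot(a\cdot x)=(\alpha\cdot a)\cdot x$, $(\alpha\cdot x)\cdot a=\alpha\cdot(x\cdot a)$, $x\cdot(a\cdot\alpha)=(x\cdot a)\cdot\alpha$, $(a\cdot x)\cdot\alpha=a\cdot(x\cdot\alpha)$, $a\cdot(\alpha\cdot x)=(a\cdot\alpha)\cdot x$, $x\cdot(\alpha\cdot a)=(x\cdot\alpha)\cdot a$; it is commutative if $\alpha\cdot x=x\cdot\alpha$. $X^{(n)}$ is the $n$-th dual with iterated dual actions ($\langle f\cdot a,x\rangle=\langle f,a\cdot x\rangle$, $\langle a\cdot f,x\rangle=\langle f,x\cdot a\rangle$, likewise for $\mathfrak A$). A module derivation $D:\mathcal A\to X$ is an additive map commuting with left and right $\mathfrak A$-actions (not necessarily $\mathbb C$-linear), bounded in the sense $\|D(a)\|\le M\|a\|$ for some $M>0$, with $D(ab)=D(a)\cdot b+a\cdot D(b)$; it is inner if $D(a)=a\cdot x-x\cdot a$ for some $x\in X$. $\mathcal A$ is $n$-weakly module amenable (as an $\mathfrak A$-module) if $(\mathcal A/J)^{(n)}$ is a commutative $\mathcal A$-$\mathfrak A$-module and each module derivation $\mathcal A\to(\mathcal A/J)^{(n)}$ is inner, where $J$ is the closed ideal of $\mathcal A$ generated by the elements $(a\cdot\alpha)b-a(\alpha\cdot b)$. It is permanently weakly module amenable if it is $n$-weakly module amenable for every $n\in\mathbb N$. These notions are applied with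 $\mathcal A=\mathcal T_0$, $\mathfrak A=\mathfrak T_0$. *)

theory Defs
  imports "HOL-Analysis.Analysis"
begin

section \<open>Complex Banach spaces and Banach algebras with explicit carriers\<close>

text \<open>
  Carriers are explicit because iterated duals and quotients of one given algebra are needed, and
  the scalars are complex (the library classes only provide real scalars).
\<close>

record 'x vspace =
  carrier :: "'x set"
  vzero :: 'x
  vadd :: "'x \<Rightarrow> 'x \<Rightarrow> 'x"
  vscale :: "complex \<Rightarrow> 'x \<Rightarrow> 'x"
  vnorm :: "'x \<Rightarrow> real"

definition vsub :: "('x, 'm) vspace_scheme \<Rightarrow> 'x \<Rightarrow> 'x \<Rightarrow> 'x" where
  "vsub X x y = vadd X x (vscale X (-1) y)"

text \<open>The value outside the carrier is irrelevant, but the library locale \<open>Metric_space\<close> requires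
  a nonnegative symmetric function on the whole type.\<close>

definition vdist :: "('x, 'm) vspace_scheme \<Rightarrow> 'x \<Rightarrow> 'x \<Rightarrow> real" where
  "vdist X x y = (if x \<in> carrier X \<and> y \<in> carrier X then vnorm X (vsub X x y) else 0)"

locale banach_space =
  fixes X :: "('x, 'm) vspace_scheme"
  assumes zero_closed: "vzero X \<in> carrier X"
    and add_closed: "\<lbrakk>x \<in> carrier X; y \<in> carrier X\<rbrakk> \<Longrightarrow> vadd X x y \<in> carrier X"
    and scale_closed: "x \<in> carrier X \<Longrightarrow> vscale X c x \<in> carrier X"
    and add_assoc: "\<lbrakk>x \<in> carrier X; y \<in> carrier X; z \<in> carrier X\<rbrakk>
      \<Longrightarrow> vadd X (vadd X x y) z = vadd X x (vadd X y z)"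
    and add_commute: "\<lbrakk>x \<in> carrier X; y \<in> carrier X\<rbrakk> \<Longrightarrow> vadd X x y = vadd X y x"
    and add_zero: "x \<in> carrier X \<Longrightarrow> vadd X x (vzero X) = x"
    and sub_self: "x \<in> carrier X \<Longrightarrow> vsub X x x = vzero X"
    and scale_add_right: "\<lbrakk>x \<in> carrier X; y \<in> carrier X\<rbrakk>
      \<Longrightarrow> vscale X c (vadd X x y) = vadd X (vscale X c x) (vscale X c y)"
    and scale_add_left: "x \<in> carrier X
      \<Longrightarrow> vscale X (c + d) x = vadd X (vscale X c x) (vscale X d x)"
    and scale_scale: "x \<in> carrier X \<Longrightarrow> vscale X c (vscale X d x) = vscale X (c * d) x"
    and scale_one: "x \<in> carrier X \<Longrightarrow> vscale X 1 x = x"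
    and norm_nonneg: "x \<in> carrier X \<Longrightarrow> 0 \<le> vnorm X x"
    and norm_eq_zero: "x \<in> carrier X \<Longrightarrow> vnorm X x = 0 \<longleftrightarrow> x = vzero X"
    and norm_triangle: "\<lbrakk>x \<in> carrier X; y \<in> carrier X\<rbrakk>
      \<Longrightarrow> vnorm X (vadd X x y) \<le> vnorm X x + vnorm X y"
    and norm_scale: "x \<in> carrier X \<Longrightarrow> vnorm X (vscale X c x) = cmod c * vnorm X x"
    and complete: "Metric_space.mcomplete (carrier X) (vdist X)"

definition linear_map ::
  "('x, 'm) vspace_scheme \<Rightarrow> ('y, 'k) vspace_scheme \<Rightarrow> ('x \<Rightarrow> 'y) \<Rightarrow> bool" where
  "linear_map X Y h \<longleftrightarrow>
     (\<forall>x\<in>carrier X. h x \<in> carrier Y) \<and>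
     (\<forall>x\<in>carrier X. \<forall>y\<in>carrier X. h (vadd X x y) = vadd Y (h x) (h y)) \<and>
     (\<forall>c. \<forall>x\<in>carrier X. h (vscale X c x) = vscale Y c (h x))"

definition bounded_bilinear_map ::
  "('x, 'm) vspace_scheme \<Rightarrow> ('y, 'k) vspace_scheme \<Rightarrow> ('z, 'l) vspace_scheme
    \<Rightarrow> ('x \<Rightarrow> 'y \<Rightarrow> 'z) \<Rightarrow> bool" where
  "bounded_bilinear_map X Y Z b \<longleftrightarrow>
     (\<forall>x\<in>carrier X. linear_map Y Z (\<lambda>y. b x y)) \<and>
     (\<forall>y\<in>carrier Y. linear_map X Z (\<lambda>x. b x y)) \<and>
     (\<exists>M. \<forall>x\<in>carrier X. \<forall>y\<in>carrier Y. vnorm Z (b x y) \<le> M * vnorm X x * vnorm Y y)"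

record 'a alg = "'a vspace" +
  amult :: "'a \<Rightarrow> 'a \<Rightarrow> 'a"

locale banach_algebra = banach_space A for A :: "('a, 'm) alg_scheme" +
  assumes mult_bilinear: "bounded_bilinear_map A A A (amult A)"
    and mult_assoc: "\<lbrakk>a \<in> carrier A; b \<in> carrier A; c \<in> carrier A\<rbrakk>
      \<Longrightarrow> amult A (amult A a b) c = amult A a (amult A b c)"
    and norm_mult: "\<lbrakk>a \<in> carrier A; b \<in> carrier A\<rbrakk>
      \<Longrightarrow> vnorm A (amult A a b) \<le> vnorm A a * vnorm A b"


section \<open>Banach modules\<close>

definition banach_bimodule ::
  "('b, 'm) alg_scheme \<Rightarrow> ('x, 'k) vspace_scheme \<Rightarrow> ('b \<Rightarrow> 'x \<Rightarrow> 'x) \<Rightarrow> ('x \<Rightarrow> 'b \<Rightarrow> 'x) \<Rightarrow> bool" where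
  "banach_bimodule B X l r \<longleftrightarrow>
     banach_algebra B \<and> banach_space X \<and>
     bounded_bilinear_map B X X l \<and> bounded_bilinear_map X B X r \<and>
     (\<forall>a\<in>carrier B. \<forall>b\<in>carrier B. \<forall>x\<in>carrier X.
        l (amult B a b) x = l a (l b x) \<and>
        r x (amult B a b) = r (r x a) b \<and>
        r (l a x) b = l a (r x b))"

text \<open>An algebra with elements in \<open>'a\<close> that is acted upon by an algebra with elements in \<open>'r\<close>.\<close>

record ('a, 'r) modalg = "'a alg" +
  aleft :: "'r \<Rightarrow> 'a \<Rightarrow> 'a"
  aright :: "'a \<Rightarrow> 'r \<Rightarrow> 'a"

definition banach_module_algebra :: "('r, 'k) alg_scheme \<Rightarrow> ('a, 'r, 'm) modalg_scheme \<Rightarrow> bool" where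
  "banach_module_algebra R A \<longleftrightarrow>
     banach_algebra A \<and> banach_bimodule R A (aleft A) (aright A) \<and>
     (\<forall>\<alpha>\<in>carrier R. \<forall>a\<in>carrier A. \<forall>b\<in>carrier A.
        aleft A \<alpha> (amult A a b) = amult A (aleft A \<alpha> a) b \<and>
        aright A (amult A a b) \<alpha> = amult A a (aright A b \<alpha>))"

text \<open>\<open>lact\<close>, \<open>ract\<close> are the actions of the algebra \<open>A\<close>; \<open>lscal\<close>, \<open>rscal\<close> those of \<open>R\<close>.\<close>

record ('x, 'a, 'r) bimod = "'x vspace" +
  lact :: "'a \<Rightarrow> 'x \<Rightarrow> 'x"
  ract :: "'x \<Rightarrow> 'a \<Rightarrow> 'x"
  lscal :: "'r \<Rightarrow> 'x \<Rightarrow> 'x"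
  rscal :: "'x \<Rightarrow> 'r \<Rightarrow> 'x"

definition banach_module ::
  "('r, 'k) alg_scheme \<Rightarrow> ('a, 'r, 'm) modalg_scheme \<Rightarrow> ('x, 'a, 'r) bimod \<Rightarrow> bool" where
  "banach_module R A X \<longleftrightarrow>
     banach_bimodule A X (lact X) (ract X) \<and> banach_bimodule R X (lscal X) (rscal X) \<and>
     (\<forall>\<alpha>\<in>carrier R. \<forall>a\<in>carrier A. \<forall>x\<in>carrier X.
        lscal X \<alpha> (lact X a x) = lact X (aleft A \<alpha> a) x \<and>
        ract X (lscal X \<alpha> x) a = lscal X \<alpha> (ract X x a) \<and>
        ract X x (aright A a \<alpha>) = rscal X (ract X x a) \<alpha> \<and>
        rscal X (lact X a x) \<alpha> = lact X a (rscal X x \<alpha>) \<and>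
        lact X a (lscal X \<alpha> x) = lact X (aright A a \<alpha>) x \<and>
        ract X x (aleft A \<alpha> a) = ract X (rscal X x \<alpha>) a)"

definition commutative_banach_module ::
  "('r, 'k) alg_scheme \<Rightarrow> ('a, 'r, 'm) modalg_scheme \<Rightarrow> ('x, 'a, 'r) bimod \<Rightarrow> bool" where
  "commutative_banach_module R A X \<longleftrightarrow>
     banach_module R A X \<and> (\<forall>\<alpha>\<in>carrier R. \<forall>x\<in>carrier X. lscal X \<alpha> x = rscal X x \<alpha>)"


section \<open>The quotient by the canonical closed ideal\<close>

definition closed_ideal :: "('a, 'm) alg_scheme \<Rightarrow> 'a set \<Rightarrow> bool" where
  "closed_ideal A I \<longleftrightarrow>
     I \<subseteq> carrier A \<and> vzero A \<in> I \<and>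
     (\<forall>x\<in>I. \<forall>y\<in>I. vadd A x y \<in> I) \<and> (\<forall>c. \<forall>x\<in>I. vscale A c x \<in> I) \<and>
     (\<forall>a\<in>carrier A. \<forall>x\<in>I. amult A a x \<in> I \<and> amult A x a \<in> I) \<and>
     closedin (Metric_space.mtopology (carrier A) (vdist A)) I"

definition module_ideal :: "('r, 'k) alg_scheme \<Rightarrow> ('a, 'r, 'm) modalg_scheme \<Rightarrow> 'a set" where
  "module_ideal R A = \<Inter>{I. closed_ideal A I \<and>
     (\<forall>\<alpha>\<in>carrier R. \<forall>a\<in>carrier A. \<forall>b\<in>carrier A.
        vsub A (amult A (aright A a \<alpha>) b) (amult A a (aleft A \<alpha> b)) \<in> I)}"

definition coset :: "('a, 'm) vspace_scheme \<Rightarrow> 'a set \<Rightarrow> 'a \<Rightarrow> 'a set" where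
  "coset A J a = vadd A a ` J"

text \<open>The operations are those induced on representatives; the norm is the quotient norm.\<close>

definition quotient_module :: "('a, 'r, 'm) modalg_scheme \<Rightarrow> 'a set \<Rightarrow> ('a set, 'a, 'r) bimod" where
  "quotient_module A J = \<lparr>
     carrier = coset A J ` carrier A,
     vzero = coset A J (vzero A),
     vadd = (\<lambda>C D. \<Union>x\<in>C. \<Union>y\<in>D. coset A J (vadd A x y)),
     vscale = (\<lambda>c C. \<Union>x\<in>C. coset A J (vscale A c x)),
     vnorm = (\<lambda>C. Inf (vnorm A ` C)),
     lact = (\<lambda>a C. \<Union>x\<in>C. coset A J (amult A a x)),
     ract = (\<lambda>C a. \<Union>x\<in>C. coset A J (amult A x a)),
     lscal = (\<lambda>\<alpha> C. \<Union>x\<in>C. coset A J (aleft A \<alpha> x)),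
     rscal = (\<lambda>C \<alpha>. \<Union>x\<in>C. coset A J (aright A x \<alpha>))\<rparr>"


section \<open>Iterated duals\<close>

definition bounded_functional :: "('x, 'm) vspace_scheme \<Rightarrow> ('x \<Rightarrow> complex) \<Rightarrow> bool" where
  "bounded_functional X f \<longleftrightarrow>
     (\<forall>x\<in>carrier X. \<forall>y\<in>carrier X. f (vadd X x y) = f x + f y) \<and>
     (\<forall>c. \<forall>x\<in>carrier X. f (vscale X c x) = c * f x) \<and>
     (\<exists>M. \<forall>x\<in>carrier X. cmod (f x) \<le> M * vnorm X x)"

text \<open>Functionals are normalised to vanish outside the carrier.\<close>

definition dual_module :: "('x, 'a, 'r) bimod \<Rightarrow> ('x \<Rightarrow> complex, 'a, 'r) bimod" where
  "dual_module X = \<lparr>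
     carrier = {f. bounded_functional X f \<and> (\<forall>x. x \<notin> carrier X \<longrightarrow> f x = 0)},
     vzero = (\<lambda>x. 0),
     vadd = (\<lambda>f g x. f x + g x),
     vscale = (\<lambda>c f x. c * f x),
     vnorm = (\<lambda>f. Sup {cmod (f x) |x. x \<in> carrier X \<and> vnorm X x \<le> 1}),
     lact = (\<lambda>a f x. if x \<in> carrier X then f (ract X x a) else 0),
     ract = (\<lambda>f a x. if x \<in> carrier X then f (lact X a x) else 0),
     lscal = (\<lambda>\<alpha> f x. if x \<in> carrier X then f (rscal X x \<alpha>) else 0),
     rscal = (\<lambda>f \<alpha> x. if x \<in> carrier X then f (lscal X \<alpha> x) else 0)\<rparr>"

definition module_isometry ::
  "('r, 'k) alg_scheme \<Rightarrow> ('a, 'r, 'm) modalg_scheme \<Rightarrow> ('x, 'a, 'r) bimod \<Rightarrow> ('y, 'a, 'r) bimod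
    \<Rightarrow> ('x \<Rightarrow> 'y) \<Rightarrow> bool" where
  "module_isometry R A X Y h \<longleftrightarrow>
     bij_betw h (carrier X) (carrier Y) \<and> linear_map X Y h \<and> h (vzero X) = vzero Y \<and>
     (\<forall>x\<in>carrier X. vnorm Y (h x) = vnorm X x) \<and>
     (\<forall>a\<in>carrier A. \<forall>x\<in>carrier X.
        h (lact X a x) = lact Y a (h x) \<and> h (ract X x a) = ract Y (h x) a) \<and>
     (\<forall>\<alpha>\<in>carrier R. \<forall>x\<in>carrier X.
        h (lscal X \<alpha> x) = lscal Y \<alpha> (h x) \<and> h (rscal X x \<alpha>) = rscal Y (h x) \<alpha>)"

text \<open>
  The type of \<open>dual_module\<close> grows with every iteration, so the \<open>n\<close>-th dual for a variable \<open>n\<close> is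
  expressed up to isometric module isomorphism inside one arbitrary type \<open>'u\<close>:
  \<open>nth_dual R A X n Y\<close> says that \<open>Y\<close> is a copy in \<open>'u\<close> of the \<open>n\<close>-th dual of \<open>X\<close>, obtained by
  dualising \<open>n\<close> times and transporting each dual back to \<open>'u\<close>. The lemmas \<open>nth_dual_0\<close> and
  \<open>nth_dual_step\<close> below show that copies exist for every \<open>n\<close> once \<open>'u\<close> is large enough.
\<close>

inductive nth_dual ::
  "('r, 'k) alg_scheme \<Rightarrow> ('a, 'r, 'm) modalg_scheme \<Rightarrow> ('x, 'a, 'r) bimod \<Rightarrow> nat
    \<Rightarrow> ('u, 'a, 'r) bimod \<Rightarrow> bool"
  for R A X where
  base: "module_isometry R A X Y h \<Longrightarrow> nth_dual R A X 0 Y"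
| step: "nth_dual R A X n Z \<Longrightarrow> module_isometry R A (dual_module Z) Y h
         \<Longrightarrow> nth_dual R A X (Suc n) Y"

definition copy_module :: "('x \<Rightarrow> 'y) \<Rightarrow> ('x, 'a, 'r) bimod \<Rightarrow> ('y, 'a, 'r) bimod" where
  "copy_module h X = \<lparr>
     carrier = h ` carrier X,
     vzero = h (vzero X),
     vadd = (\<lambda>x y. h (vadd X (inv h x) (inv h y))),
     vscale = (\<lambda>c x. h (vscale X c (inv h x))),
     vnorm = (\<lambda>x. vnorm X (inv h x)),
     lact = (\<lambda>a x. h (lact X a (inv h x))),
     ract = (\<lambda>x a. h (ract X (inv h x) a)),
     lscal = (\<lambda>\<alpha> x. h (lscal X \<alpha> (inv h x))),
     rscal = (\<lambda>x \<alpha>. h (rscal X (inv h x) \<alpha>))\<rparr>"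

lemma mem_dual: "f \<in> carrier (dual_module X) \<longleftrightarrow>
    bounded_functional X f \<and> (\<forall>x. x \<notin> carrier X \<longrightarrow> f x = 0)"
  by (simp add: dual_module_def)

lemma dual_copy_module:
  assumes h: "inj h" and g: "inj g"
  shows "module_isometry R A (dual_module (copy_module h Z)) (copy_module g (dual_module Z))
           (\<lambda>f. g (\<lambda>x. f (h x)))"
proof -
  let ?H = "copy_module h Z"
  have inv [simp]: "inv h (h x) = x" "inv g (g y) = y" for x y
    using h g by simp_all
  have mem [simp]: "h x \<in> h ` carrier Z \<longleftrightarrow> x \<in> carrier Z" for x
    using h by (auto dest: injD)
  have cH: "carrier ?H = h ` carrier Z"
    by (simp add: copy_module_def)
  have bf: "bounded_functional ?H f \<longleftrightarrow> bounded_functional Z (\<lambda>x. f (h x))" for f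
    by (simp add: bounded_functional_def copy_module_def)
  have inj: "inj_on (\<lambda>f. g (\<lambda>x. f (h x))) (carrier (dual_module ?H))"
  proof (rule inj_onI)
    fix f f'
    assume f: "f \<in> carrier (dual_module ?H)" and f': "f' \<in> carrier (dual_module ?H)"
      and eq: "g (\<lambda>x. f (h x)) = g (\<lambda>x. f' (h x))"
    have "f (h x) = f' (h x)" for x
      using eq g by (metis injD)
    moreover have "f y = 0 \<and> f' y = 0" if "y \<notin> range h" for y
      using f f' that unfolding mem_dual cH by blast
    ultimately show "f = f'"
      by (metis ext rangeE)
  qed
  have im: "(\<lambda>f. g (\<lambda>x. f (h x))) ` carrier (dual_module ?H) = g ` carrier (dual_module Z)"
  proof (intro equalityI subsetI)
    fix u assume "u \<in> (\<lambda>f. g (\<lambda>x. f (h x))) ` carrier (dual_module ?H)"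
    then show "u \<in> g ` carrier (dual_module Z)"
      by (auto simp: mem_dual bf cH)
  next
    fix u assume "u \<in> g ` carrier (dual_module Z)"
    then obtain f where f: "bounded_functional Z f" "\<forall>x. x \<notin> carrier Z \<longrightarrow> f x = 0" "u = g f"
      by (auto simp: mem_dual)
    define f' where "f' = (\<lambda>y. if y \<in> range h then f (inv h y) else 0)"
    have "(\<lambda>x. f' (h x)) = f"
      by (simp add: f'_def)
    moreover have "f' \<in> carrier (dual_module ?H)"
      unfolding mem_dual bf calculation using f by (auto simp: f'_def cH)
    ultimately show "u \<in> (\<lambda>f. g (\<lambda>x. f (h x))) ` carrier (dual_module ?H)"
      using f(3) by (metis (no_types, lifting) image_eqI)
  qed
  have sets: "{cmod (f x) |x. x \<in> carrier ?H \<and> vnorm ?H x \<le> 1}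
      = {cmod (f (h x)) |x. x \<in> carrier Z \<and> vnorm Z x \<le> 1}" for f
    by (auto simp: copy_module_def)
  have bij: "bij_betw (\<lambda>f. g (\<lambda>x. f (h x))) (carrier (dual_module ?H))
      (carrier (copy_module g (dual_module Z)))"
    using inj im by (simp add: bij_betw_def copy_module_def[of g])
  have norm: "vnorm (copy_module g (dual_module Z)) (g (\<lambda>x. f (h x))) = vnorm (dual_module ?H) f" for f
    unfolding copy_module_def[of g] using sets by (simp add: dual_module_def)
  have acts:
    "vzero (dual_module ?H) (h x) = vzero (dual_module Z) x"
    "vadd (dual_module ?H) f f' (h x) = vadd (dual_module Z) (\<lambda>x. f (h x)) (\<lambda>x. f' (h x)) x"
    "vscale (dual_module ?H) c f (h x) = vscale (dual_module Z) c (\<lambda>x. f (h x)) x"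
    "lact (dual_module ?H) a f (h x) = lact (dual_module Z) a (\<lambda>x. f (h x)) x"
    "ract (dual_module ?H) f a (h x) = ract (dual_module Z) (\<lambda>x. f (h x)) a x"
    "lscal (dual_module ?H) \<alpha> f (h x) = lscal (dual_module Z) \<alpha> (\<lambda>x. f (h x)) x"
    "rscal (dual_module ?H) f \<alpha> (h x) = rscal (dual_module Z) (\<lambda>x. f (h x)) \<alpha> x" for f f' c a \<alpha> x
    by (simp_all add: dual_module_def copy_module_def)
  show ?thesis
    unfolding module_isometry_def linear_map_def
    using bij_betwE[OF bij] by (auto simp: bij norm acts) (simp_all add: copy_module_def[of g])
qed

lemma module_isometry_trans:
  assumes "module_isometry R A X Y h" and "module_isometry R A Y Z g"
  shows "module_isometry R A X Z (g \<circ> h)"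
  using assms unfolding module_isometry_def linear_map_def
  by (auto intro: bij_betw_trans)

lemma copy_module_isometry:
  assumes "inj h"
  shows "module_isometry R A X (copy_module h X) h"
  using assms inj_on_subset[OF assms subset_UNIV, of "carrier X"]
  by (auto simp: module_isometry_def linear_map_def copy_module_def bij_betw_def)

lemma nth_dual_copy:
  assumes "nth_dual R A X n Y" and h: "inj h"
  shows "nth_dual R A X n (copy_module h Y)"
  using assms(1)
proof induction
  case (base Y g)
  show ?case
    by (rule nth_dual.base[OF module_isometry_trans[OF base copy_module_isometry[OF h]]])
next
  case (step n Z Y g)
  have "module_isometry R A (dual_module (copy_module h Z)) (copy_module id (dual_module Z))
          (\<lambda>f. id (\<lambda>x. f (h x)))"
    by (rule dual_copy_module[OF h inj_on_id])
  moreover have "copy_module id (dual_module Z) = dual_module Z"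
    by (simp add: copy_module_def)
  ultimately have "module_isometry R A (dual_module (copy_module h Z)) (dual_module Z)
          (\<lambda>f. id (\<lambda>x. f (h x)))"
    by simp
  from module_isometry_trans[OF this module_isometry_trans[OF step.hyps(2) copy_module_isometry[OF h]]]
  show ?case
    by (rule nth_dual.step[OF step.IH])
qed

lemma nth_dual_0: "nth_dual R A X 0 X"
  by (rule nth_dual.base[where h = id]) (auto simp: module_isometry_def linear_map_def)

lemma nth_dual_step:
  fixes Y :: "('u, 'a, 'r) bimod"
  assumes "nth_dual R A X n Y"
  shows "\<exists>Y' :: ('u + ('u \<Rightarrow> complex), 'a, 'r) bimod. nth_dual R A X (Suc n) Y'"
proof -
  have "nth_dual R A X n (copy_module Inl Y :: ('u + ('u \<Rightarrow> complex), 'a, 'r) bimod)"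
    by (rule nth_dual_copy[OF assms]) simp
  from nth_dual.step[OF this dual_copy_module[of Inl Inr]] show ?thesis
    by (auto simp: inj_def)
qed


section \<open>Module derivations and permanent weak module amenability\<close>

definition module_derivation ::
  "('r, 'k) alg_scheme \<Rightarrow> ('a, 'r, 'm) modalg_scheme \<Rightarrow> ('x, 'a, 'r) bimod \<Rightarrow> ('a \<Rightarrow> 'x) \<Rightarrow> bool" where
  "module_derivation R A X D \<longleftrightarrow>
     (\<forall>a\<in>carrier A. D a \<in> carrier X) \<and>
     (\<forall>a\<in>carrier A. \<forall>b\<in>carrier A. D (vadd A a b) = vadd X (D a) (D b)) \<and>
     (\<forall>\<alpha>\<in>carrier R. \<forall>a\<in>carrier A.
        D (aleft A \<alpha> a) = lscal X \<alpha> (D a) \<and> D (aright A a \<alpha>) = rscal X (D a) \<alpha>) \<and>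
     (\<exists>M>0. \<forall>a\<in>carrier A. vnorm X (D a) \<le> M * vnorm A a) \<and>
     (\<forall>a\<in>carrier A. \<forall>b\<in>carrier A.
        D (amult A a b) = vadd X (ract X (D a) b) (lact X a (D b)))"

definition inner_derivation ::
  "('a, 'm) alg_scheme \<Rightarrow> ('x, 'a, 'r) bimod \<Rightarrow> ('a \<Rightarrow> 'x) \<Rightarrow> bool" where
  "inner_derivation A X D \<longleftrightarrow>
     (\<exists>x\<in>carrier X. \<forall>a\<in>carrier A. D a = vsub X (lact X a x) (ract X x a))"

text \<open>
  The type argument is the type in which the copies of the iterated duals live; a theorem with a
  free type variable \<open>'u\<close> covers all of them. The standing assumptions on the pair of algebras are
  part of the notion.
\<close>

definition n_weakly_module_amenable ::
  "'u itself \<Rightarrow> nat \<Rightarrow> ('r, 'k) alg_scheme \<Rightarrow> ('a, 'r, 'm) modalg_scheme \<Rightarrow> bool" where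
  "n_weakly_module_amenable U n R A \<longleftrightarrow>
     banach_module_algebra R A \<and>
     (\<forall>Y :: ('u, 'a, 'r) bimod.
        nth_dual R A (quotient_module A (module_ideal R A)) n Y \<longrightarrow>
          commutative_banach_module R A Y \<and>
          (\<forall>D. module_derivation R A Y D \<longrightarrow> inner_derivation A Y D))"

definition permanently_weakly_module_amenable ::
  "'u itself \<Rightarrow> ('r, 'k) alg_scheme \<Rightarrow> ('a, 'r, 'm) modalg_scheme \<Rightarrow> bool" where
  "permanently_weakly_module_amenable U R A \<longleftrightarrow> (\<forall>n\<ge>1. n_weakly_module_amenable U n R A)"


section \<open>Inverse semigroups\<close>

definition inverse_semigroup :: "'s::semigroup_mult itself \<Rightarrow> bool" where
  "inverse_semigroup S \<longleftrightarrow> (\<forall>s::'s. \<exists>!t. s * t * s = s \<and> t * s * t = t)"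

definition star :: "'s::semigroup_mult \<Rightarrow> 's" where
  "star s = (THE t. s * t * s = s \<and> t * s * t = t)"

definition idempotents :: "'s::semigroup_mult set" where
  "idempotents = {e. e = star e \<and> e = e * e}"

definition condition_D :: "nat \<Rightarrow> 's::semigroup_mult set \<Rightarrow> bool" where
  "condition_D k E \<longleftrightarrow>
     (\<forall>f. (\<forall>i\<in>{1..k + 1}. f i \<in> E) \<longrightarrow>
        (\<exists>e\<in>E. \<exists>i j. 1 \<le> i \<and> i < j \<and> j \<le> k + 1 \<and> f i * e = f i \<and> f j * e = f j))"


section \<open>The convolution algebra and the triangular algebra\<close>

text \<open>For \<open>A \<subseteq> S\<close>, \<open>ell1 A\<close> is the copy of \<open>\<ell>\<^sup>1(A)\<close> in \<open>\<ell>\<^sup>1(S)\<close>: functions vanishing off \<open>A\<close>.\<close>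

definition ell1 :: "'s set \<Rightarrow> ('s \<Rightarrow> complex) set" where
  "ell1 A = {f. (\<lambda>s. norm (f s)) summable_on UNIV \<and> (\<forall>s. s \<notin> A \<longrightarrow> f s = 0)}"

definition ell1_norm :: "('s \<Rightarrow> complex) \<Rightarrow> real" where
  "ell1_norm f = (\<Sum>\<^sub>\<infinity>s. norm (f s))"

definition conv :: "('s::semigroup_mult \<Rightarrow> complex) \<Rightarrow> ('s \<Rightarrow> complex) \<Rightarrow> 's \<Rightarrow> complex" where
  "conv f g t = (\<Sum>\<^sub>\<infinity>(r, s) \<in> {(r, s). r * s = t}. f r * g s)"

definition delta :: "'s \<Rightarrow> 's \<Rightarrow> complex" where
  "delta s t = (if t = s then 1 else 0)"

text \<open>
  The actions of \<open>\<ell>\<^sup>1(E)\<close> on \<open>\<ell>\<^sup>1(S)\<close> are bounded and bilinear, hence given by their values on point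
  masses, which are recorded in \<open>E_act_delta\<close>; for commutative \<open>S\<close> both values are
  \<open>delta (s * e)\<close>.
\<close>

definition E_left :: "('s::semigroup_mult \<Rightarrow> complex) \<Rightarrow> ('s \<Rightarrow> complex) \<Rightarrow> 's \<Rightarrow> complex" where
  "E_left \<alpha> f = conv \<alpha> f"

definition E_right :: "('s::semigroup_mult \<Rightarrow> complex) \<Rightarrow> ('s \<Rightarrow> complex) \<Rightarrow> 's \<Rightarrow> complex" where
  "E_right f \<alpha> = conv f \<alpha>"

lemma conv_delta: "conv (delta r) (delta s) = delta (r * s)"
proof
  fix t
  have "conv (delta r) (delta s) t =
      (\<Sum>\<^sub>\<infinity>p \<in> {(r, s)} \<inter> {(r, s). r * s = t}. case p of (x, y) \<Rightarrow> delta r x * delta s y)"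
    unfolding conv_def by (rule infsum_cong_neutral) (auto simp: delta_def split: if_splits)
  then show "conv (delta r) (delta s) t = delta (r * s) t"
    by (auto simp: delta_def)
qed

lemma E_act_delta:
  fixes s e :: "'s::ab_semigroup_mult"
  shows "E_left (delta e) (delta s) = delta (s * e)" "E_right (delta s) (delta e) = delta (s * e)"
  by (simp_all add: E_left_def E_right_def conv_delta mult.commute)

text \<open>The triple \<open>(a, m, b)\<close> stands for the upper triangular matrix with diagonal \<open>a\<close>, \<open>b\<close> and
  off-diagonal entry \<open>m\<close>.\<close>

type_synonym 's tri = "('s \<Rightarrow> complex) \<times> ('s \<Rightarrow> complex) \<times> ('s \<Rightarrow> complex)"

definition tri_on :: "'s::semigroup_mult tri set \<Rightarrow> 's tri alg" where
  "tri_on C = \<lparr>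
     carrier = C,
     vzero = (\<lambda>s. 0, \<lambda>s. 0, \<lambda>s. 0),
     vadd = (\<lambda>(a, m, b) (a', m', b'). (\<lambda>s. a s + a' s, \<lambda>s. m s + m' s, \<lambda>s. b s + b' s)),
     vscale = (\<lambda>c (a, m, b). (\<lambda>s. c * a s, \<lambda>s. c * m s, \<lambda>s. c * b s)),
     vnorm = (\<lambda>(a, m, b). ell1_norm a + ell1_norm m + ell1_norm b),
     amult = (\<lambda>(a, m, b) (a', m', b').
       (conv a a', \<lambda>s. conv a m' s + conv m b' s, conv b b'))\<rparr>"

definition frak_T0 :: "'s::semigroup_mult tri alg" where
  "frak_T0 = tri_on {(\<alpha>, \<lambda>s. 0, \<alpha>) |\<alpha>. \<alpha> \<in> ell1 idempotents}"

definition T0 :: "('s::semigroup_mult tri, 's tri) modalg" where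
  "T0 = alg.extend (tri_on (ell1 UNIV \<times> ell1 UNIV \<times> ell1 UNIV)) \<lparr>
     aleft = (\<lambda>(\<alpha>, _, _) (a, m, b). (E_left \<alpha> a, E_left \<alpha> m, E_left \<alpha> b)),
     aright = (\<lambda>(a, m, b) (\<alpha>, _, _). (E_right a \<alpha>, E_right m \<alpha>, E_right b \<alpha>))\<rparr>"

end

theory Submission
  imports Defs
begin

text \<open>
  The two actions of \<open>\<TT>\<^sub>0\<close> on \<open>\<T>\<^sub>0\<close> agree, so the ideal \<open>J\<close> is zero and the modules in question are the
  iterated duals of \<open>\<T>\<^sub>0\<close> itself. Each of them is, as an \<open>\<ell>\<^sup>1(S)\<close>-module, a symmetric module
  repeated three times, and a derivation \<open>D\<close> is determined by the nine components of its values at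
  \<open>\<delta>\<^sub>s\<close> placed in one of the three matrix positions. By the Leibniz rule each component is of one of
  two kinds. A component that is itself a derivation of \<open>S\<close> into a symmetric module vanishes, because
  \<open>s \<mapsto> s\<^sup>* D(s)\<close> turns powers into multiples and is bounded. A component with
  \<open>f(s t) = s f(t)\<close> has the form \<open>f(s) = s x\<close>: condition \<open>D\<^sub>k\<close> makes the idempotents a finite union
  of down-closures of directed sets, and \<open>x\<close> is assembled from pointwise cluster points of \<open>f\<close> along
  these directed sets. The remaining Leibniz identities say that the elements \<open>x\<close> fit together to
  an element implementing \<open>D\<close>. Homogeneity of \<open>D\<close> over the complex numbers follows from
  the module property, so density of the finitely supported functions finishes the argument.
\<close>

section \<open>Normed spaces with explicit carriers\<close>

text \<open>The obstacle is the missing identity: \<open>S\<close> need not have one, so the matrix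
  units need not lie in \<open>T0\<close> and a derivation cannot be evaluated at them. The
  idempotent \<open>s * star s\<close> is a local unit for \<open>delta s\<close>, which is enough
  to separate the nine components; condition \<open>D_k\<close> supplies the passage from local
  solutions to one functional. That passage takes pointwise limits of functionals, so derivations
  are studied on the dual of a module \<open>Z\<close>, their values being tested on vectors of
  \<open>Z\<close>. This is where n >= 1 enters. The n-th dual for variable n is given only through
  copies inside a type. Everything used about it is therefore collected in one property,
  \<open>matrix_coords\<close>, that survives isometric copies and dualising. Dualising transposes
  the actions and exchanges left and right, and doing so twice restores the original shape; hence
  two shapes occur, and the Leibniz identities are solved once for each parity. That every dual is a
  commutative Banach module is part of the claim, which accounts for the completeness and transport
  lemmas.\<close>

locale normed_vspace =
  fixes X :: "('x, 'm) vspace_scheme"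
  assumes zero_closed: "vzero X \<in> carrier X"
    and add_closed: "\<lbrakk>x \<in> carrier X; y \<in> carrier X\<rbrakk> \<Longrightarrow> vadd X x y \<in> carrier X"
    and scale_closed: "x \<in> carrier X \<Longrightarrow> vscale X c x \<in> carrier X"
    and add_assoc: "\<lbrakk>x \<in> carrier X; y \<in> carrier X; z \<in> carrier X\<rbrakk>
      \<Longrightarrow> vadd X (vadd X x y) z = vadd X x (vadd X y z)"
    and add_commute: "\<lbrakk>x \<in> carrier X; y \<in> carrier X\<rbrakk> \<Longrightarrow> vadd X x y = vadd X y x"
    and add_zero: "x \<in> carrier X \<Longrightarrow> vadd X x (vzero X) = x"
    and sub_self: "x \<in> carrier X \<Longrightarrow> vsub X x x = vzero X"
    and scale_add_right: "\<lbrakk>x \<in> carrier X; y \<in> carrier X\<rbrakk>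
      \<Longrightarrow> vscale X c (vadd X x y) = vadd X (vscale X c x) (vscale X c y)"
    and scale_add_left: "x \<in> carrier X
      \<Longrightarrow> vscale X (c + d) x = vadd X (vscale X c x) (vscale X d x)"
    and scale_scale: "x \<in> carrier X \<Longrightarrow> vscale X c (vscale X d x) = vscale X (c * d) x"
    and scale_one: "x \<in> carrier X \<Longrightarrow> vscale X 1 x = x"
    and norm_nonneg: "x \<in> carrier X \<Longrightarrow> 0 \<le> vnorm X x"
    and norm_eq_zero: "x \<in> carrier X \<Longrightarrow> vnorm X x = 0 \<longleftrightarrow> x = vzero X"
    and norm_triangle: "\<lbrakk>x \<in> carrier X; y \<in> carrier X\<rbrakk>
      \<Longrightarrow> vnorm X (vadd X x y) \<le> vnorm X x + vnorm X y"
    and norm_scale: "x \<in> carrier X \<Longrightarrow> vnorm X (vscale X c x) = cmod c * vnorm X x"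
begin

lemma zero_add: "x \<in> carrier X \<Longrightarrow> vadd X (vzero X) x = x"
  using add_commute add_zero zero_closed by metis

lemma norm_zero: "vnorm X (vzero X) = 0"
  using norm_eq_zero zero_closed by blast

lemma scale_zero: "x \<in> carrier X \<Longrightarrow> vscale X 0 x = vzero X"
  using scale_add_left[of x 1 "-1"] scale_one[of x] sub_self[of x] by (simp add: vsub_def)

lemma sub_closed: "\<lbrakk>x \<in> carrier X; y \<in> carrier X\<rbrakk> \<Longrightarrow> vsub X x y \<in> carrier X"
  by (simp add: vsub_def add_closed scale_closed)

lemma neg_add: "x \<in> carrier X \<Longrightarrow> vadd X (vscale X (-1) x) x = vzero X"
  using sub_self add_commute scale_closed unfolding vsub_def by metis

lemma sub_split:
  assumes "x \<in> carrier X" "y \<in> carrier X" "z \<in> carrier X"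
  shows "vsub X x z = vadd X (vsub X x y) (vsub X y z)"
proof -
  have "vadd X (vsub X x y) (vsub X y z)
      = vadd X x (vadd X (vadd X (vscale X (-1) y) y) (vscale X (-1) z))"
    using assms by (simp add: vsub_def add_assoc scale_closed add_closed)
  then show ?thesis
    using assms by (simp add: neg_add zero_add scale_closed vsub_def)
qed

lemma neg_sub:
  assumes "x \<in> carrier X" "y \<in> carrier X"
  shows "vscale X (-1) (vsub X x y) = vsub X y x"
  using assms by (simp add: vsub_def scale_add_right scale_scale scale_closed scale_one add_commute)

lemma norm_sub_commute:
  assumes "x \<in> carrier X" "y \<in> carrier X"
  shows "vnorm X (vsub X x y) = vnorm X (vsub X y x)"
  using norm_scale[OF sub_closed[OF assms], of "-1"] neg_sub[OF assms] by simp

lemma norm_sub_zero: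
  assumes "x \<in> carrier X" "y \<in> carrier X" "vnorm X (vsub X x y) = 0"
  shows "x = y"
proof -
  have "vsub X x y = vzero X"
    using assms norm_eq_zero sub_closed by blast
  then have "vadd X (vadd X x (vscale X (-1) y)) y = y"
    using assms zero_add by (simp add: vsub_def)
  then show ?thesis
    using assms by (simp add: add_assoc scale_closed neg_add add_zero)
qed

lemma metric: "Metric_space (carrier X) (vdist X)"
proof
  show "0 \<le> vdist X x y" for x y
    by (simp add: vdist_def norm_nonneg sub_closed)
  show "vdist X x y = vdist X y x" for x y
    by (simp add: vdist_def norm_sub_commute)
  show "vdist X x y = 0 \<longleftrightarrow> x = y" if "x \<in> carrier X" "y \<in> carrier X" for x y
    using that norm_sub_zero by (auto simp: vdist_def sub_self norm_zero)
  show "vdist X x z \<le> vdist X x y + vdist X y z"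
    if "x \<in> carrier X" "y \<in> carrier X" "z \<in> carrier X" for x y z
    using that norm_triangle[OF sub_closed sub_closed, of x y y z] sub_split[of x y z]
    by (simp add: vdist_def)
qed

text \<open>Completeness in terms of the norm: \<open>vdist\<close> tests membership of both
  arguments, and this form keeps those tests out of every Cauchy argument.\<close>

definition cauchy_complete :: bool where
  "cauchy_complete \<longleftrightarrow> (\<forall>\<sigma>. range \<sigma> \<subseteq> carrier X \<longrightarrow>
     (\<forall>e>0. \<exists>N::nat. \<forall>m\<ge>N. \<forall>n\<ge>N. vnorm X (vsub X (\<sigma> m) (\<sigma> n)) < e) \<longrightarrow>
     (\<exists>l\<in>carrier X. \<forall>e>0. \<exists>N. \<forall>n\<ge>N. vnorm X (vsub X (\<sigma> n) l) < e))"

lemma mcomplete_iff: "Metric_space.mcomplete (carrier X) (vdist X) \<longleftrightarrow> cauchy_complete"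
proof -
  interpret M: Metric_space "carrier X" "vdist X"
    by (rule metric)
  have 1: "M.MCauchy \<sigma> \<longleftrightarrow> range \<sigma> \<subseteq> carrier X \<and>
      (\<forall>e>0. \<exists>N. \<forall>m\<ge>N. \<forall>n\<ge>N. vnorm X (vsub X (\<sigma> m) (\<sigma> n)) < e)" for \<sigma>
  proof (cases "range \<sigma> \<subseteq> carrier X")
    case True
    then have "\<sigma> n \<in> carrier X" for n by auto
    with True show ?thesis
      unfolding M.MCauchy_def vdist_def by simp
  qed (simp add: M.MCauchy_def)
  have 2: "limitin M.mtopology \<sigma> l sequentially \<longleftrightarrow>
      l \<in> carrier X \<and> (\<forall>e>0. \<exists>N. \<forall>n\<ge>N. vnorm X (vsub X (\<sigma> n) l) < e)"
    if "range \<sigma> \<subseteq> carrier X" for \<sigma> l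
  proof -
    have "\<sigma> n \<in> carrier X" for n using that by auto
    then show ?thesis
      unfolding M.limit_metric_sequentially vdist_def by (cases "l \<in> carrier X") simp_all
  qed
  show ?thesis
    unfolding M.mcomplete_def cauchy_complete_def 1 by (simp add: 2 imp_conjL Bex_def cong: imp_cong conj_cong)
qed

text \<open>Metric topologies are T1. This makes the zero ideal one of the closed ideals intersected
  in \<open>module_ideal\<close>.\<close>

lemma closedin_zero: "closedin (Metric_space.mtopology (carrier X) (vdist X)) {vzero X}"
proof -
  interpret M: Metric_space "carrier X" "vdist X"
    by (rule metric)
  show ?thesis
    using M.t1_space_mtopology zero_closed by (simp add: t1_space_closedin_singleton)
qed

end

lemma normed_vspace_if_banach: "banach_space X \<Longrightarrow> normed_vspace X"
  by (intro normed_vspace.intro;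
      rule banach_space.zero_closed banach_space.add_closed banach_space.scale_closed
        banach_space.add_assoc banach_space.add_commute banach_space.add_zero
        banach_space.sub_self banach_space.scale_add_right banach_space.scale_add_left
        banach_space.scale_scale banach_space.scale_one banach_space.norm_nonneg
        banach_space.norm_eq_zero banach_space.norm_triangle banach_space.norm_scale;
      assumption)

text \<open>Separates completeness from the other axioms, so that for copies and duals the normed
  structure can be established first and then used while proving completeness.\<close>

lemma banach_space_iff:
  "banach_space X \<longleftrightarrow> normed_vspace X \<and> normed_vspace.cauchy_complete X"
proof
  assume *: "banach_space X"
  then interpret normed_vspace X by (rule normed_vspace_if_banach)
  show "normed_vspace X \<and> cauchy_complete"
    using * banach_space.complete mcomplete_iff normed_vspace_axioms by blast
next
  assume "normed_vspace X \<and> normed_vspace.cauchy_complete X"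
  then interpret normed_vspace X by simp
  have c: "Metric_space.mcomplete (carrier X) (vdist X)"
    using \<open>normed_vspace X \<and> _\<close> mcomplete_iff by blast
  show "banach_space X"
    by (intro banach_space.intro; (rule c zero_closed add_closed scale_closed add_assoc add_commute add_zero sub_self scale_add_right
        scale_add_left scale_scale scale_one norm_nonneg norm_eq_zero norm_triangle norm_scale); assumption?)
qed

lemma linear_mapD:
  assumes "linear_map X Y h"
  shows "x \<in> carrier X \<Longrightarrow> h x \<in> carrier Y"
    and "\<lbrakk>x \<in> carrier X; y \<in> carrier X\<rbrakk> \<Longrightarrow> h (vadd X x y) = vadd Y (h x) (h y)"
    and "x \<in> carrier X \<Longrightarrow> h (vscale X c x) = vscale Y c (h x)"
  using assms by (auto simp: linear_map_def)

lemma linear_map_zero: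
  assumes "linear_map X Y h" "normed_vspace X" "normed_vspace Y"
  shows "h (vzero X) = vzero Y"
proof -
  interpret X: normed_vspace X by fact
  interpret Y: normed_vspace Y by fact
  show ?thesis
    using linear_mapD[OF assms(1)] X.scale_zero[of "vzero X"] X.zero_closed Y.scale_zero by metis
qed

lemma bounded_bilinear_mapD:
  assumes "bounded_bilinear_map X Y Z b"
  shows "x \<in> carrier X \<Longrightarrow> linear_map Y Z (b x)"
    and "y \<in> carrier Y \<Longrightarrow> linear_map X Z (\<lambda>x. b x y)"
    and "\<lbrakk>x \<in> carrier X; y \<in> carrier Y\<rbrakk> \<Longrightarrow> b x y \<in> carrier Z"
  using assms by (auto simp: bounded_bilinear_map_def linear_map_def)

text \<open>The constant in the definition may be negative when a space is trivial. Its absolute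
  value works as well, and chained estimates need a nonnegative factor.\<close>

lemma bounded_bilinear_map_bound:
  assumes "bounded_bilinear_map X Y Z b" "normed_vspace X" "normed_vspace Y"
  obtains M where "M \<ge> 0"
    "\<And>x y. \<lbrakk>x \<in> carrier X; y \<in> carrier Y\<rbrakk> \<Longrightarrow> vnorm Z (b x y) \<le> M * vnorm X x * vnorm Y y"
proof -
  interpret X: normed_vspace X by fact
  interpret Y: normed_vspace Y by fact
  obtain M where M: "\<forall>x\<in>carrier X. \<forall>y\<in>carrier Y. vnorm Z (b x y) \<le> M * vnorm X x * vnorm Y y"
    using assms(1) by (auto simp: bounded_bilinear_map_def)
  have "vnorm Z (b x y) \<le> \<bar>M\<bar> * vnorm X x * vnorm Y y" if "x \<in> carrier X" "y \<in> carrier Y" for x y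
  proof -
    have "M * vnorm X x * vnorm Y y \<le> \<bar>M\<bar> * vnorm X x * vnorm Y y"
      using X.norm_nonneg Y.norm_nonneg that by (intro mult_right_mono) auto
    with M that show ?thesis by force
  qed
  then show thesis using that[of "\<bar>M\<bar>"] by simp
qed

section \<open>Transport along module isometries\<close>

lemma module_isometryD:
  assumes "module_isometry R A X Y h"
  shows "bij_betw h (carrier X) (carrier Y)" "linear_map X Y h" "h (vzero X) = vzero Y"
    "x \<in> carrier X \<Longrightarrow> vnorm Y (h x) = vnorm X x"
    "\<lbrakk>a \<in> carrier A; x \<in> carrier X\<rbrakk> \<Longrightarrow> h (lact X a x) = lact Y a (h x)"
    "\<lbrakk>a \<in> carrier A; x \<in> carrier X\<rbrakk> \<Longrightarrow> h (ract X x a) = ract Y (h x) a"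
    "\<lbrakk>\<alpha> \<in> carrier R; x \<in> carrier X\<rbrakk> \<Longrightarrow> h (lscal X \<alpha> x) = lscal Y \<alpha> (h x)"
    "\<lbrakk>\<alpha> \<in> carrier R; x \<in> carrier X\<rbrakk> \<Longrightarrow> h (rscal X x \<alpha>) = rscal Y (h x) \<alpha>"
  using assms by (auto simp: module_isometry_def)

lemma banach_space_isometry:
  assumes bij: "bij_betw h (carrier X) (carrier Y)" and lin: "linear_map X Y h"
    and zero: "h (vzero X) = vzero Y"
    and norm: "\<And>x. x \<in> carrier X \<Longrightarrow> vnorm Y (h x) = vnorm X x"
    and X: "banach_space X"
  shows "banach_space Y"
proof -
  interpret X: normed_vspace X using X by (rule normed_vspace_if_banach)
  have im: "carrier Y = h ` carrier X" using bij by (simp add: bij_betw_def)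
  have inj: "\<lbrakk>h x = h y; x \<in> carrier X; y \<in> carrier X\<rbrakk> \<Longrightarrow> x = y" for x y
    using bij by (auto simp: bij_betw_def dest: inj_onD)
  note L = linear_mapD[OF lin]
  have Ladd: "vadd Y (h x) (h y) = h (vadd X x y)" if "x \<in> carrier X" "y \<in> carrier X" for x y
    using L that by simp
  have Lsc: "vscale Y c (h x) = h (vscale X c x)" if "x \<in> carrier X" for c x
    using L that by simp
  have Lsub: "vsub Y (h x) (h y) = h (vsub X x y)" if "x \<in> carrier X" "y \<in> carrier X" for x y
    using that by (simp add: vsub_def Ladd Lsc X.scale_closed)
  have inj0: "h x = h (vzero X) \<longleftrightarrow> x = vzero X" if "x \<in> carrier X" for x
    using inj that X.zero_closed by blast
  note S = Ladd Lsc Lsub norm X.zero_closed X.scale_closed X.add_closed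
  \<comment> \<open>Every element of \<open>Y\<close> is written as \<open>h x\<close>, and
    \<open>S\<close> pulls all operations inside \<open>h\<close>; each axiom is then the image of
    the same axiom on \<open>X\<close>.\<close>
  interpret Y: normed_vspace Y
  proof (unfold_locales, unfold im zero[symmetric], goal_cases)
    case 1 show ?case using X.zero_closed by (rule imageI)
  next
    case (2 x y) then show ?case by (auto simp: S)
  next
    case (3 x c) then show ?case by (auto simp: S)
  next
    case (4 x y z) then show ?case using X.add_assoc by (auto simp: S)
  next
    case (5 x y) then show ?case using X.add_commute by (auto simp: S)
  next
    case (6 x) then show ?case using X.add_zero by (auto simp: S)
  next
    case (7 x) then show ?case using X.sub_self by (auto simp: S)
  next
    case (8 x y c) then show ?case using X.scale_add_right by (auto simp: S)
  next
    case (9 x c d) then show ?case using X.scale_add_left by (auto simp: S)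
  next
    case (10 x c d) then show ?case using X.scale_scale by (auto simp: S)
  next
    case (11 x) then show ?case using X.scale_one by (auto simp: S)
  next
    case (12 x) then show ?case using X.norm_nonneg by (auto simp: S)
  next
    case (13 x) then show ?case using X.norm_eq_zero by (auto simp: S inj0)
  next
    case (14 x y) then show ?case using X.norm_triangle by (auto simp: S)
  next
    case (15 x c) then show ?case using X.norm_scale by (auto simp: S)
  qed
  have "Y.cauchy_complete"
    unfolding Y.cauchy_complete_def
  proof (intro allI impI)
    fix \<sigma> :: "nat \<Rightarrow> _"
    assume r: "range \<sigma> \<subseteq> carrier Y"
      and c: "\<forall>e>0. \<exists>N. \<forall>m\<ge>N. \<forall>n\<ge>N. vnorm Y (vsub Y (\<sigma> m) (\<sigma> n)) < e"
    have "\<forall>n. \<exists>x. x \<in> carrier X \<and> \<sigma> n = h x"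
      using r im by blast
    then obtain \<tau> where t: "\<And>n. \<tau> n \<in> carrier X" "\<And>n. \<sigma> n = h (\<tau> n)" by metis
    have "\<forall>e>0. \<exists>N. \<forall>m\<ge>N. \<forall>n\<ge>N. vnorm X (vsub X (\<tau> m) (\<tau> n)) < e"
      using c by (simp add: t Lsub norm X.sub_closed)
    then obtain l where l: "l \<in> carrier X" "\<forall>e>0. \<exists>N. \<forall>n\<ge>N. vnorm X (vsub X (\<tau> n) l) < e"
      using X t(1) unfolding banach_space_iff X.cauchy_complete_def by blast
    show "\<exists>l\<in>carrier Y. \<forall>e>0. \<exists>N. \<forall>n\<ge>N. vnorm Y (vsub Y (\<sigma> n) l) < e"
      using l by (intro bexI[of _ "h l"]) (auto simp: t Lsub norm X.sub_closed im)
  qed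
  with Y.normed_vspace_axioms show ?thesis by (simp add: banach_space_iff)
qed

text \<open>The actions are arbitrary maps here, so that one proof serves those of \<open>A\<close>
  and those of \<open>R\<close>.\<close>

lemma banach_bimodule_isometry:
  assumes bij: "bij_betw h (carrier X) (carrier Y)" and lin: "linear_map X Y h"
    and zero: "h (vzero X) = vzero Y"
    and norm: "\<And>x. x \<in> carrier X \<Longrightarrow> vnorm Y (h x) = vnorm X x"
    and X: "banach_bimodule B X l r"
    and l: "\<And>b x. \<lbrakk>b \<in> carrier B; x \<in> carrier X\<rbrakk> \<Longrightarrow> l' b (h x) = h (l b x)"
    and r: "\<And>b x. \<lbrakk>b \<in> carrier B; x \<in> carrier X\<rbrakk> \<Longrightarrow> r' (h x) b = h (r x b)"
  shows "banach_bimodule B Y l' r'"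
proof -
  have im: "carrier Y = h ` carrier X" using bij by (simp add: bij_betw_def)
  have bX: "banach_space X" and bB: "banach_algebra B"
    and bl: "bounded_bilinear_map B X X l" and br: "bounded_bilinear_map X B X r"
    and ax: "\<And>a b x. \<lbrakk>a \<in> carrier B; b \<in> carrier B; x \<in> carrier X\<rbrakk> \<Longrightarrow>
        l (amult B a b) x = l a (l b x) \<and> r x (amult B a b) = r (r x a) b \<and> r (l a x) b = l a (r x b)"
    using X by (simp_all add: banach_bimodule_def)
  have bY: "banach_space Y" by (rule banach_space_isometry[OF bij lin zero norm bX])
  interpret X: normed_vspace X using bX by (rule normed_vspace_if_banach)
  interpret B: banach_algebra B by (rule bB)
  have cB: "amult B a b \<in> carrier B" if "a \<in> carrier B" "b \<in> carrier B" for a b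
    using B.mult_bilinear that by (rule bounded_bilinear_mapD(3))
  note L = linear_mapD(2,3)[OF lin, symmetric]
  note cl = bounded_bilinear_mapD(3)[OF bl] bounded_bilinear_mapD(3)[OF br]
  note lin_l = linear_mapD(2,3)[OF bounded_bilinear_mapD(1)[OF bl]]
    linear_mapD(2,3)[OF bounded_bilinear_mapD(2)[OF bl]]
  note lin_r = linear_mapD(2,3)[OF bounded_bilinear_mapD(1)[OF br]]
    linear_mapD(2,3)[OF bounded_bilinear_mapD(2)[OF br]]
  note bas = X.add_closed X.scale_closed B.add_closed B.scale_closed
  have "bounded_bilinear_map B Y Y l'"
    unfolding bounded_bilinear_map_def linear_map_def im ball_simps
  proof (intro conjI ballI allI)
    show "\<exists>M. \<forall>b\<in>carrier B. \<forall>x\<in>carrier X. vnorm Y (l' b (h x)) \<le> M * vnorm B b * vnorm Y (h x)"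
      using bl by (simp add: l cl norm bounded_bilinear_map_def)
  qed (simp_all add: l L cl bas lin_l)
  moreover have "bounded_bilinear_map Y B Y r'"
    unfolding bounded_bilinear_map_def linear_map_def im ball_simps
  proof (intro conjI ballI allI)
    show "\<exists>M. \<forall>x\<in>carrier X. \<forall>b\<in>carrier B. vnorm Y (r' (h x) b) \<le> M * vnorm Y (h x) * vnorm B b"
      using br by (simp add: r cl norm bounded_bilinear_map_def)
  qed (simp_all add: r L cl bas lin_r)
  moreover have "\<forall>a\<in>carrier B. \<forall>b\<in>carrier B. \<forall>y\<in>carrier Y.
      l' (amult B a b) y = l' a (l' b y) \<and> r' y (amult B a b) = r' (r' y a) b \<and> r' (l' a y) b = l' a (r' y b)"
    unfolding im by (simp add: l r cl cB ax)
  ultimately show ?thesis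
    using bY bB by (simp add: banach_bimodule_def)
qed

lemma banach_module_closed:
  assumes "banach_module R A X" "x \<in> carrier X"
  shows "a \<in> carrier A \<Longrightarrow> lact X a x \<in> carrier X" "a \<in> carrier A \<Longrightarrow> ract X x a \<in> carrier X"
    "\<alpha> \<in> carrier R \<Longrightarrow> lscal X \<alpha> x \<in> carrier X" "\<alpha> \<in> carrier R \<Longrightarrow> rscal X x \<alpha> \<in> carrier X"
  using assms by (auto simp: banach_module_def banach_bimodule_def intro: bounded_bilinear_mapD(3))

lemma banach_module_isometry:
  assumes iso: "module_isometry R A X Y h" and X: "banach_module R A X"
    and act: "banach_bimodule R A (aleft A) (aright A)"
  shows "banach_module R A Y"
proof -
  note I = module_isometryD[OF iso]
  have im: "carrier Y = h ` carrier X" using I(1) by (simp add: bij_betw_def)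
  note E = I(5)[symmetric] I(6)[symmetric] I(7)[symmetric] I(8)[symmetric]
  have 1: "banach_bimodule A Y (lact Y) (ract Y)"
    by (rule banach_bimodule_isometry[OF I(1-3) I(4)]) (use X in \<open>simp_all add: E banach_module_def\<close>)
  have 2: "banach_bimodule R Y (lscal Y) (rscal Y)"
    by (rule banach_bimodule_isometry[OF I(1-3) I(4)]) (use X in \<open>simp_all add: E banach_module_def\<close>)
  have cA: "aleft A \<alpha> a \<in> carrier A" "aright A a \<alpha> \<in> carrier A"
    if "\<alpha> \<in> carrier R" "a \<in> carrier A" for \<alpha> a
    using that act unfolding banach_bimodule_def by (blast dest: bounded_bilinear_mapD(3))+
  have ax: "lscal X \<alpha> (lact X a x) = lact X (aleft A \<alpha> a) x \<and>
        ract X (lscal X \<alpha> x) a = lscal X \<alpha> (ract X x a) \<and>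
        ract X x (aright A a \<alpha>) = rscal X (ract X x a) \<alpha> \<and>
        rscal X (lact X a x) \<alpha> = lact X a (rscal X x \<alpha>) \<and>
        lact X a (lscal X \<alpha> x) = lact X (aright A a \<alpha>) x \<and>
        ract X x (aleft A \<alpha> a) = ract X (rscal X x \<alpha>) a"
    if "\<alpha> \<in> carrier R" "a \<in> carrier A" "x \<in> carrier X" for \<alpha> a x
    using X that unfolding banach_module_def by blast
  show ?thesis
    using 1 2 unfolding banach_module_def im
    by (simp add: E banach_module_closed[OF X] cA ax)
qed

lemma commutative_banach_module_isometry:
  assumes iso: "module_isometry R A X Y h" and X: "commutative_banach_module R A X"
    and act: "banach_bimodule R A (aleft A) (aright A)"
  shows "commutative_banach_module R A Y"
proof -
  note I = module_isometryD[OF iso]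
  have im: "carrier Y = h ` carrier X" using I(1) by (simp add: bij_betw_def)
  show ?thesis
    using banach_module_isometry[OF iso _ act] X
    unfolding commutative_banach_module_def im by (simp add: I(7,8)[symmetric])
qed

section \<open>Dual modules\<close>

lemma dual_module_simps [simp]:
  "vzero (dual_module X) = (\<lambda>x. 0)"
  "vadd (dual_module X) = (\<lambda>f g x. f x + g x)"
  "vscale (dual_module X) = (\<lambda>c f x. c * f x)"
  "vsub (dual_module X) f g = (\<lambda>x. f x - g x)"
  "lact (dual_module X) a f x = (if x \<in> carrier X then f (ract X x a) else 0)"
  "ract (dual_module X) f a x = (if x \<in> carrier X then f (lact X a x) else 0)"
  "lscal (dual_module X) \<alpha> f x = (if x \<in> carrier X then f (rscal X x \<alpha>) else 0)"
  "rscal (dual_module X) f \<alpha> x = (if x \<in> carrier X then f (lscal X \<alpha> x) else 0)"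
  by (simp_all add: dual_module_def vsub_def)

lemma bounded_functionalD:
  assumes "bounded_functional X f"
  shows "\<lbrakk>x \<in> carrier X; y \<in> carrier X\<rbrakk> \<Longrightarrow> f (vadd X x y) = f x + f y"
    and "x \<in> carrier X \<Longrightarrow> f (vscale X c x) = c * f x"
  using assms by (auto simp: bounded_functional_def)

lemma bounded_functionalI:
  assumes "\<And>x y. \<lbrakk>x \<in> carrier X; y \<in> carrier X\<rbrakk> \<Longrightarrow> f (vadd X x y) = f x + f y"
    and "\<And>c x. x \<in> carrier X \<Longrightarrow> f (vscale X c x) = c * f x"
    and "\<And>x. x \<in> carrier X \<Longrightarrow> cmod (f x) \<le> M * vnorm X x"
  shows "bounded_functional X f"
  unfolding bounded_functional_def using assms by blast

section \<open>Norm and completeness of the dual space\<close>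

context normed_vspace
begin

lemma functional_zero:
  assumes "bounded_functional X f" shows "f (vzero X) = 0"
  using bounded_functionalD(2)[OF assms zero_closed, of 0] scale_zero[OF zero_closed] by simp

lemma functional_bound:
  assumes "bounded_functional X f"
  obtains M where "M \<ge> 0" "\<And>x. x \<in> carrier X \<Longrightarrow> cmod (f x) \<le> M * vnorm X x"
proof -
  obtain M where M: "\<forall>x\<in>carrier X. cmod (f x) \<le> M * vnorm X x"
    using assms by (auto simp: bounded_functional_def)
  have "cmod (f x) \<le> \<bar>M\<bar> * vnorm X x" if "x \<in> carrier X" for x
  proof -
    have "M * vnorm X x \<le> \<bar>M\<bar> * vnorm X x"
      using norm_nonneg that by (intro mult_right_mono) auto
    with M that show ?thesis by force
  qed
  then show thesis using that[of "\<bar>M\<bar>"] by simp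
qed

end

locale normed_bimod = normed_vspace X for X :: "('x, 'a, 'r) bimod"
begin

abbreviation "D \<equiv> dual_module X"

lemma dual_functional: "f \<in> carrier D \<Longrightarrow> bounded_functional X f"
  by (simp add: mem_dual)

lemma dual_norm_def: "vnorm D f = Sup {cmod (f x) |x. x \<in> carrier X \<and> vnorm X x \<le> 1}"
  by (simp add: dual_module_def)

lemma dual_norm_le:
  assumes "M \<ge> 0" "\<And>x. x \<in> carrier X \<Longrightarrow> cmod (f x) \<le> M * vnorm X x"
  shows "vnorm D f \<le> M"
  unfolding dual_norm_def
proof (rule cSup_least)
  show "{cmod (f x) |x. x \<in> carrier X \<and> vnorm X x \<le> 1} \<noteq> {}"
    using zero_closed norm_zero by force
  fix r assume "r \<in> {cmod (f x) |x. x \<in> carrier X \<and> vnorm X x \<le> 1}"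
  then obtain x where x: "x \<in> carrier X" "vnorm X x \<le> 1" "r = cmod (f x)" by blast
  have "r \<le> M * vnorm X x" using assms(2) x by simp
  also have "\<dots> \<le> M * 1" using x assms(1) by (intro mult_left_mono)
  finally show "r \<le> M" by simp
qed

lemma dual_bound:
  assumes f: "f \<in> carrier D" and x: "x \<in> carrier X"
  shows "cmod (f x) \<le> vnorm D f * vnorm X x"
proof (cases "x = vzero X")
  case True
  then show ?thesis using functional_zero[OF dual_functional[OF f]] by (simp add: norm_zero)
next
  case False
  then have pos: "vnorm X x > 0"
    using norm_eq_zero[OF x] norm_nonneg[OF x] by simp
  obtain M where M: "M \<ge> 0" "\<And>x. x \<in> carrier X \<Longrightarrow> cmod (f x) \<le> M * vnorm X x"
    using functional_bound[OF dual_functional[OF f]] by blast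
  have bdd: "bdd_above {cmod (f x) |x. x \<in> carrier X \<and> vnorm X x \<le> 1}"
  proof (rule bdd_aboveI)
    fix r assume "r \<in> {cmod (f x) |x. x \<in> carrier X \<and> vnorm X x \<le> 1}"
    then obtain x where x: "x \<in> carrier X" "vnorm X x \<le> 1" "r = cmod (f x)" by blast
    have "r \<le> M * vnorm X x" using M(2) x by simp
    also have "\<dots> \<le> M * 1" using x M(1) by (intro mult_left_mono)
    finally show "r \<le> M" by simp
  qed
  define y where "y = vscale X (of_real (1 / vnorm X x)) x"
  have y: "y \<in> carrier X" "vnorm X y = 1"
    using x pos by (simp_all add: y_def scale_closed norm_scale norm_divide)
  have "cmod (f y) \<le> vnorm D f"
    unfolding dual_norm_def by (rule cSup_upper[OF _ bdd]) (use y in auto)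
  moreover have "cmod (f y) = cmod (f x) / vnorm X x"
    using pos by (simp add: y_def bounded_functionalD(2)[OF dual_functional[OF f] x] norm_mult norm_divide)
  ultimately show ?thesis using pos by (simp add: field_simps)
qed

text \<open>A negative norm would, by \<open>dual_bound\<close>, force \<open>f\<close> to vanish,
  and the zero functional has norm 0.\<close>

lemma dual_norm_nonneg: "f \<in> carrier D \<Longrightarrow> 0 \<le> vnorm D f"
proof (rule ccontr)
  assume f: "f \<in> carrier D" and "\<not> 0 \<le> vnorm D f"
  then have neg: "vnorm D f < 0" by simp
  have "f x = 0" if "x \<in> carrier X" for x
  proof -
    have "vnorm D f * vnorm X x \<le> 0"
      using neg norm_nonneg[OF that] by (simp add: mult_nonpos_nonneg)
    then show ?thesis using dual_bound[OF f that] norm_ge_zero[of "f x"] by (metis norm_le_zero_iff order_trans)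
  qed
  then have "f = (\<lambda>x. 0)" using f by (auto simp: mem_dual)
  then have "{cmod (f x) |x. x \<in> carrier X \<and> vnorm X x \<le> 1} = {0}"
    using zero_closed norm_zero by auto
  then have "vnorm D f = 0" by (simp add: dual_norm_def)
  with neg show False by simp
qed

lemma functional_restrict_mem:
  assumes "bounded_functional X f"
  shows "(\<lambda>x. if x \<in> carrier X then f x else 0) \<in> carrier D"
  using assms unfolding mem_dual bounded_functional_def by (simp add: add_closed scale_closed)

lemma bounded_functional_add:
  assumes "bounded_functional X f" "bounded_functional X g"
  shows "bounded_functional X (\<lambda>x. f x + g x)"
proof -
  obtain M where M: "M \<ge> 0" "\<And>x. x \<in> carrier X \<Longrightarrow> cmod (f x) \<le> M * vnorm X x"
    using functional_bound[OF assms(1)] by blast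
  obtain N where N: "N \<ge> 0" "\<And>x. x \<in> carrier X \<Longrightarrow> cmod (g x) \<le> N * vnorm X x"
    using functional_bound[OF assms(2)] by blast
  have "cmod (f x + g x) \<le> (M + N) * vnorm X x" if "x \<in> carrier X" for x
    using norm_triangle_ineq[of "f x" "g x"] M(2)[OF that] N(2)[OF that] by (simp add: algebra_simps)
  then show ?thesis
    by (rule bounded_functionalI[rotated 2])
      (simp_all add: bounded_functionalD[OF assms(1)] bounded_functionalD[OF assms(2)] algebra_simps)
qed

lemma bounded_functional_scale:
  assumes "bounded_functional X f"
  shows "bounded_functional X (\<lambda>x. c * f x)"
proof -
  obtain M where M: "M \<ge> 0" "\<And>x. x \<in> carrier X \<Longrightarrow> cmod (f x) \<le> M * vnorm X x"
    using functional_bound[OF assms(1)] by blast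
  have "cmod (c * f x) \<le> (cmod c * M) * vnorm X x" if "x \<in> carrier X" for x
    using mult_left_mono[OF M(2)[OF that], of "cmod c"] by (simp add: norm_mult algebra_simps)
  then show ?thesis
    by (rule bounded_functionalI[rotated 2]) (simp_all add: bounded_functionalD[OF assms] algebra_simps)
qed

lemma bounded_functional_comp:
  assumes f: "bounded_functional X f" and h: "linear_map X X h"
    and b: "\<And>x. x \<in> carrier X \<Longrightarrow> vnorm X (h x) \<le> N * vnorm X x"
  shows "bounded_functional X (\<lambda>x. f (h x))"
proof -
  obtain M where M: "M \<ge> 0" "\<And>x. x \<in> carrier X \<Longrightarrow> cmod (f x) \<le> M * vnorm X x"
    using functional_bound[OF f] by blast
  have "cmod (f (h x)) \<le> (M * N) * vnorm X x" if "x \<in> carrier X" for x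
    using order_trans[OF M(2)[OF linear_mapD(1)[OF h that]] mult_left_mono[OF b[OF that] M(1)]]
    by (simp add: algebra_simps)
  then show ?thesis
    unfolding bounded_functional_def
    by (auto simp: linear_mapD[OF h] bounded_functionalD[OF f])
qed

lemma normed_vspace_dual: "normed_vspace D"
proof (unfold_locales, goal_cases)
  case 1 show ?case by (auto simp: mem_dual bounded_functional_def intro!: exI[of _ 0])
next
  case (2 f g) then show ?case using bounded_functional_add by (simp add: mem_dual)
next
  case (3 f c) then show ?case using bounded_functional_scale by (simp add: mem_dual)
next
  case (12 f) then show ?case by (rule dual_norm_nonneg)
next
  case (13 f)
  show ?case
  proof
    assume "vnorm D f = 0"
    then have "f x = 0" if "x \<in> carrier X" for x
      using dual_bound[OF 13 that] by simp
    then show "f = vzero D" using 13 by (auto simp: mem_dual)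
  next
    assume "f = vzero D"
    then show "vnorm D f = 0"
      using dual_norm_le[of 0 f] dual_norm_nonneg[OF 13] by simp
  qed
next
  case (14 f g)
  show ?case
  proof (rule dual_norm_le)
    show "cmod (vadd D f g x) \<le> (vnorm D f + vnorm D g) * vnorm X x" if "x \<in> carrier X" for x
      using norm_triangle_ineq[of "f x" "g x"] dual_bound[OF 14(1) that] dual_bound[OF 14(2) that]
      by (simp add: algebra_simps)
  qed (use 14 dual_norm_nonneg in simp)
next
  case (15 f c)
  have le: "vnorm D (\<lambda>x. c * f x) \<le> cmod c * vnorm D f" if "f \<in> carrier D" for c f
  proof (rule dual_norm_le)
    show "cmod (c * f x) \<le> cmod c * vnorm D f * vnorm X x" if "x \<in> carrier X" for x
      using mult_left_mono[OF dual_bound[OF \<open>f \<in> carrier D\<close> that], of "cmod c"]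
      by (simp add: norm_mult algebra_simps)
  qed (use that dual_norm_nonneg in simp)
  show ?case
  proof (cases "c = 0")
    case True
    then show ?thesis using le[OF 15, of 0] dual_norm_nonneg[of "\<lambda>x. 0"] bounded_functional_scale[of f 0] 15
      by (simp add: mem_dual)
  next
    case False
    have m: "(\<lambda>x. c * f x) \<in> carrier D" using bounded_functional_scale 15 by (simp add: mem_dual)
    \<comment> \<open>The reverse inequality is \<open>le\<close> for the inverse scalar, applied to
      the scaled functional.\<close>
    have "vnorm D f \<le> cmod (inverse c) * vnorm D (\<lambda>x. c * f x)"
      using le[OF m, of "inverse c"] False by (simp add: mult.assoc[symmetric])
    then have "cmod c * vnorm D f \<le> cmod c * (cmod (inverse c) * vnorm D (\<lambda>x. c * f x))"
      by (rule mult_left_mono) simp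
    also have "\<dots> = vnorm D (\<lambda>x. c * f x)"
      using False by (simp add: norm_inverse mult.assoc[symmetric])
    finally have "cmod c * vnorm D f \<le> vnorm D (\<lambda>x. c * f x)" .
    with le[OF 15, of c] show ?thesis by simp
  qed
qed (auto simp: algebra_simps)

lemma banach_space_dual: "banach_space D"
proof -
  interpret D: normed_vspace D by (rule normed_vspace_dual)
  have "D.cauchy_complete"
    unfolding D.cauchy_complete_def
  proof (intro allI impI)
    fix \<sigma> :: "nat \<Rightarrow> 'x \<Rightarrow> complex"
    assume r: "range \<sigma> \<subseteq> carrier D"
      and c: "\<forall>e>0. \<exists>N. \<forall>m\<ge>N. \<forall>n\<ge>N. vnorm D (vsub D (\<sigma> m) (\<sigma> n)) < e"
    have s: "\<sigma> n \<in> carrier D" for n using r by auto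
    have d: "cmod (\<sigma> m x - \<sigma> n x) \<le> vnorm D (vsub D (\<sigma> m) (\<sigma> n)) * vnorm X x" if "x \<in> carrier X" for m n x
      using dual_bound[OF D.sub_closed[OF s s] that, of m n] by simp
    have "convergent (\<lambda>n. \<sigma> n x)" if x: "x \<in> carrier X" for x
    proof (rule Cauchy_convergent, rule metric_CauchyI)
      fix e :: real assume "e > 0"
      \<comment> \<open>The summand 1 covers vectors of norm 0.\<close>
      define e' where "e' = e / (vnorm X x + 1)"
      have p: "vnorm X x \<ge> 0" using norm_nonneg x by blast
      have "e' > 0" using \<open>e > 0\<close> p by (simp add: e'_def)
      then obtain N where N: "\<forall>m\<ge>N. \<forall>n\<ge>N. vnorm D (vsub D (\<sigma> m) (\<sigma> n)) < e'" using c by blast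
      have "dist (\<sigma> m x) (\<sigma> n x) < e" if "m \<ge> N" "n \<ge> N" for m n
      proof -
        have "cmod (\<sigma> m x - \<sigma> n x) \<le> e' * vnorm X x"
          using order_trans[OF d[OF x] mult_right_mono[OF less_imp_le p]] N that by blast
        also have "\<dots> < e' * (vnorm X x + 1)" using \<open>e' > 0\<close> by simp
        also have "\<dots> = e" using p by (simp add: e'_def)
        finally show ?thesis by (simp add: dist_norm)
      qed
      then show "\<exists>N. \<forall>m\<ge>N. \<forall>n\<ge>N. dist (\<sigma> m x) (\<sigma> n x) < e" by blast
    qed
    then have lim: "(\<lambda>n. \<sigma> n x) \<longlonglongrightarrow> lim (\<lambda>n. \<sigma> n x)" if "x \<in> carrier X" for x
      using that by (simp add: convergent_LIMSEQ_iff)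
    define l where "l x = (if x \<in> carrier X then lim (\<lambda>n. \<sigma> n x) else 0)" for x
    have l: "(\<lambda>n. \<sigma> n x) \<longlonglongrightarrow> l x" if "x \<in> carrier X" for x
      using lim that by (simp add: l_def)
    \<comment> \<open>Letting m tend to infinity in the Cauchy estimate gives a bound that is
      uniform over the unit ball. Boundedness of \<open>l\<close> and convergence in norm both
      follow from it.\<close>
    have conv: "cmod (\<sigma> n x - l x) \<le> e * vnorm X x"
      if N: "\<forall>m\<ge>N. \<forall>n\<ge>N. vnorm D (vsub D (\<sigma> m) (\<sigma> n)) < e" and n: "n \<ge> N" and x: "x \<in> carrier X" for e N n x
    proof (rule tendsto_upperbound)
      show "(\<lambda>m. cmod (\<sigma> n x - \<sigma> m x)) \<longlonglongrightarrow> cmod (\<sigma> n x - l x)"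
        by (intro tendsto_intros l x)
      have "cmod (\<sigma> n x - \<sigma> m x) \<le> e * vnorm X x" if "m \<ge> N" for m
        using order_trans[OF d[OF x] mult_right_mono[OF less_imp_le norm_nonneg[OF x]]] N n that by blast
      then show "\<forall>\<^sub>F m in sequentially. cmod (\<sigma> n x - \<sigma> m x) \<le> e * vnorm X x"
        by (auto simp: eventually_sequentially)
    qed simp
    have S: "bounded_functional X (\<sigma> n)" for n using s by (simp add: mem_dual)
    obtain N where N: "\<forall>m\<ge>N. \<forall>n\<ge>N. vnorm D (vsub D (\<sigma> m) (\<sigma> n)) < 1"
      using c zero_less_one by blast
    have bound: "cmod (l x) \<le> (1 + vnorm D (\<sigma> N)) * vnorm X x" if "x \<in> carrier X" for x
      using conv[OF N order_refl that] dual_bound[OF s that, of N]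
        norm_triangle_ineq2[of "l x" "\<sigma> N x"] by (simp add: norm_minus_commute algebra_simps)
    have "bounded_functional X l"
      unfolding bounded_functional_def
    proof (intro conjI ballI allI)
      show "l (vadd X x y) = l x + l y" if "x \<in> carrier X" "y \<in> carrier X" for x y
        using l[OF add_closed[OF that]] tendsto_add[OF l[OF that(1)] l[OF that(2)]]
        by (simp add: bounded_functionalD(1)[OF S that] LIMSEQ_unique)
      show "l (vscale X c x) = c * l x" if "x \<in> carrier X" for c x
        using l[OF scale_closed[OF that, of c]] tendsto_mult_left[OF l[OF that], of c]
        by (simp add: bounded_functionalD(2)[OF S that] LIMSEQ_unique)
    qed (use bound in blast)
    then have lm: "l \<in> carrier D" by (simp add: mem_dual l_def)
    show "\<exists>l\<in>carrier D. \<forall>e>0. \<exists>N. \<forall>n\<ge>N. vnorm D (vsub D (\<sigma> n) l) < e"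
    proof (intro bexI[OF _ lm] allI impI)
      fix e :: real assume "e > 0"
      then obtain N where N: "\<forall>m\<ge>N. \<forall>n\<ge>N. vnorm D (vsub D (\<sigma> m) (\<sigma> n)) < e / 2"
        using c half_gt_zero by blast
      have "vnorm D (vsub D (\<sigma> n) l) < e" if "n \<ge> N" for n
      proof -
        have "vnorm D (vsub D (\<sigma> n) l) \<le> e / 2"
          by (rule dual_norm_le) (use \<open>e > 0\<close> conv[OF N that] in auto)
        then show ?thesis using \<open>e > 0\<close> by simp
      qed
      then show "\<exists>N. \<forall>n\<ge>N. vnorm D (vsub D (\<sigma> n) l) < e" by blast
    qed
  qed
  with D.normed_vspace_axioms show ?thesis by (simp add: banach_space_iff)
qed

text \<open>Transposing exchanges sides: the transpose of a left action has to serve as a right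
  action and vice versa. The two conclusions are the same map with its arguments in either
  order.\<close>

lemma transpose_bilinear:
  assumes b: "bounded_bilinear_map B X X b" and B: "normed_vspace B"
  shows "bounded_bilinear_map B D D (\<lambda>a f x. if x \<in> carrier X then f (b a x) else 0)"
    and "bounded_bilinear_map D B D (\<lambda>f a x. if x \<in> carrier X then f (b a x) else 0)"
proof -
  interpret B: normed_vspace B by (rule B)
  obtain M where M: "M \<ge> 0" "\<And>a x. \<lbrakk>a \<in> carrier B; x \<in> carrier X\<rbrakk> \<Longrightarrow> vnorm X (b a x) \<le> M * vnorm B a * vnorm X x"
    using bounded_bilinear_map_bound[OF b B normed_vspace_axioms] by blast
  note cl = bounded_bilinear_mapD(3)[OF b]
  let ?t = "\<lambda>a f x. if x \<in> carrier X then f (b a x) else 0"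
  have mem: "?t a f \<in> carrier D" if "a \<in> carrier B" "f \<in> carrier D" for a f
  proof (rule functional_restrict_mem, rule bounded_functional_comp)
    show "bounded_functional X f" using that by (simp add: mem_dual)
    show "linear_map X X (b a)" using bounded_bilinear_mapD(1)[OF b that(1)] .
    show "vnorm X (b a x) \<le> M * vnorm B a * vnorm X x" if "x \<in> carrier X" for x
      using M(2) \<open>a \<in> carrier B\<close> that by blast
  qed
  have norm: "vnorm D (?t a f) \<le> M * vnorm B a * vnorm D f" if "a \<in> carrier B" "f \<in> carrier D" for a f
  proof (rule dual_norm_le)
    fix x assume x: "x \<in> carrier X"
    have "cmod (f (b a x)) \<le> vnorm D f * vnorm X (b a x)"
      using dual_bound[OF that(2) cl[OF that(1) x]] .
    also have "\<dots> \<le> vnorm D f * (M * vnorm B a * vnorm X x)"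
      using M(2)[OF that(1) x] dual_norm_nonneg[OF that(2)] by (rule mult_left_mono)
    finally show "cmod (?t a f x) \<le> M * vnorm B a * vnorm D f * vnorm X x"
      using x by (simp add: algebra_simps)
  qed (use M(1) that B.norm_nonneg dual_norm_nonneg in simp)
  have lin: "linear_map B D (\<lambda>a. ?t a f)" if "f \<in> carrier D" for f
    using that unfolding linear_map_def
    by (auto simp: mem linear_mapD[OF bounded_bilinear_mapD(2)[OF b]] cl fun_eq_iff
        bounded_functionalD[OF dual_functional[OF that]])
  have lin2: "linear_map D D (?t a)" if "a \<in> carrier B" for a
    using that unfolding linear_map_def by (auto simp: mem fun_eq_iff)
  show "bounded_bilinear_map B D D ?t"
    unfolding bounded_bilinear_map_def using lin lin2 norm by blast
  show "bounded_bilinear_map D B D (\<lambda>f a. ?t a f)"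
    unfolding bounded_bilinear_map_def using lin lin2 norm
    by (intro conjI ballI exI[of _ M]) (simp_all add: algebra_simps)
qed

lemma bounded_bilinear_flip:
  "bounded_bilinear_map X B X r \<Longrightarrow> bounded_bilinear_map B X X (\<lambda>b x. r x b)"
  unfolding bounded_bilinear_map_def
  by (elim conjE exE, intro conjI ballI, blast, blast, rule_tac x = M in exI) (simp add: mult_ac)

lemma banach_bimodule_dual:
  assumes X: "banach_bimodule B X l r"
  shows "banach_bimodule B D (\<lambda>b f x. if x \<in> carrier X then f (r x b) else 0)
           (\<lambda>f b x. if x \<in> carrier X then f (l b x) else 0)"
proof -
  have bB: "banach_algebra B" and bl: "bounded_bilinear_map B X X l" and br: "bounded_bilinear_map X B X r"
    and ax: "\<And>a b x. \<lbrakk>a \<in> carrier B; b \<in> carrier B; x \<in> carrier X\<rbrakk> \<Longrightarrow>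
        l (amult B a b) x = l a (l b x) \<and> r x (amult B a b) = r (r x a) b \<and> r (l a x) b = l a (r x b)"
    using X by (simp_all add: banach_bimodule_def)
  have nB: "normed_vspace B"
    using bB by (simp add: banach_algebra_def normed_vspace_if_banach)
  note cl = bounded_bilinear_mapD(3)[OF bl] bounded_bilinear_mapD(3)[OF br]
  show ?thesis
    unfolding banach_bimodule_def
    using bB banach_space_dual transpose_bilinear(1)[OF bounded_bilinear_flip[OF br] nB]
      transpose_bilinear(2)[OF bl nB]
    by (auto simp: ax cl fun_eq_iff)
qed

end

lemma normed_bimod_if_banach_module: "banach_module R A X \<Longrightarrow> normed_bimod X"
  unfolding normed_bimod_def banach_module_def banach_bimodule_def using normed_vspace_if_banach by blast

lemma banach_module_dual:
  assumes X: "banach_module R A X" and act: "banach_bimodule R A (aleft A) (aright A)"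
  shows "banach_module R A (dual_module X)"
proof -
  interpret normed_bimod X using X by (rule normed_bimod_if_banach_module)
  have 1: "banach_bimodule A D (lact D) (ract D)"
    using banach_bimodule_dual[of A "lact X" "ract X"] X
    by (simp add: banach_module_def dual_module_def)
  have 2: "banach_bimodule R D (lscal D) (rscal D)"
    using banach_bimodule_dual[of R "lscal X" "rscal X"] X
    by (simp add: banach_module_def dual_module_def)
  have cA: "aleft A \<alpha> a \<in> carrier A" "aright A a \<alpha> \<in> carrier A"
    if "\<alpha> \<in> carrier R" "a \<in> carrier A" for \<alpha> a
    using that act unfolding banach_bimodule_def by (blast dest: bounded_bilinear_mapD(3))+
  have ax: "lscal X \<alpha> (lact X a x) = lact X (aleft A \<alpha> a) x"
        "ract X (lscal X \<alpha> x) a = lscal X \<alpha> (ract X x a)"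
        "ract X x (aright A a \<alpha>) = rscal X (ract X x a) \<alpha>"
        "rscal X (lact X a x) \<alpha> = lact X a (rscal X x \<alpha>)"
        "lact X a (lscal X \<alpha> x) = lact X (aright A a \<alpha>) x"
        "ract X x (aleft A \<alpha> a) = ract X (rscal X x \<alpha>) a"
    if "\<alpha> \<in> carrier R" "a \<in> carrier A" "x \<in> carrier X" for \<alpha> a x
    using X that unfolding banach_module_def by simp_all
  show ?thesis
    using 1 2 unfolding banach_module_def
    by (auto simp: fun_eq_iff banach_module_closed[OF X] ax)
qed

lemma commutative_banach_module_dual:
  assumes X: "commutative_banach_module R A X" and act: "banach_bimodule R A (aleft A) (aright A)"
  shows "commutative_banach_module R A (dual_module X)"
  using X banach_module_dual[OF _ act] unfolding commutative_banach_module_def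
  by (auto simp: fun_eq_iff)

section \<open>Commutative inverse semigroups\<close>

lemma star_inverse:
  assumes "inverse_semigroup TYPE('s::semigroup_mult)"
  shows "s * star s * s = s" "star s * s * star s = (star s :: 's)"
  using theI'[of "\<lambda>t. s * t * s = s \<and> t * s * t = t"] assms
  unfolding inverse_semigroup_def star_def by auto

lemma star_unique:
  assumes "inverse_semigroup TYPE('s::semigroup_mult)" "s * t * s = s" "t * s * t = (t :: 's)"
  shows "star s = t"
  using assms star_inverse[OF assms(1), of s] unfolding inverse_semigroup_def by blast

text \<open>If \<open>e * e = e\<close>, then \<open>e\<close> satisfies both equations that
  determine \<open>star e\<close>, so \<open>e = star e\<close> follows from uniqueness.\<close>

lemma idempotents_iff:
  assumes "inverse_semigroup TYPE('s::semigroup_mult)"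
  shows "(e::'s) \<in> idempotents \<longleftrightarrow> e * e = e"
  using star_unique[OF assms, of e e] unfolding idempotents_def by (auto simp: mult.assoc)

lemma idempotents_mult:
  assumes "inverse_semigroup TYPE('s::ab_semigroup_mult)" "e \<in> idempotents" "f \<in> idempotents"
  shows "e * f \<in> (idempotents :: 's set)"
proof -
  have "(e * f) * (e * f) = (e * e) * (f * f)" by (simp add: ac_simps)
  then show ?thesis using assms by (simp add: idempotents_iff[OF assms(1)])
qed

lemma mult_star_idempotent:
  assumes "inverse_semigroup TYPE('s::ab_semigroup_mult)"
  shows "(s::'s) * star s \<in> idempotents"
  using star_inverse[OF assms, of s] by (simp add: idempotents_iff[OF assms] mult.assoc[symmetric])

lemma star_mult_self:
  assumes "inverse_semigroup TYPE('s::ab_semigroup_mult)"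
  shows "(s * star s) * s = (s::'s)" "s * (s * star s) = s" "(s * star s) * star s = star s"
  using star_inverse[OF assms, of s] by (simp_all add: ac_simps)

text \<open>A derivation into a symmetric module is a logarithm: \<open>s \<mapsto> f s (star s \<cdot> z)\<close> turns powers into
  multiples, so boundedness forces it to vanish.\<close>

lemma bounded_derivation_zero:
  fixes act :: "'s::ab_semigroup_mult \<Rightarrow> 'z \<Rightarrow> 'z" and f :: "'s \<Rightarrow> 'z \<Rightarrow> complex"
  assumes inv: "inverse_semigroup TYPE('s)"
    and closed: "\<And>s z. z \<in> Z \<Longrightarrow> act s z \<in> Z"
    and act: "\<And>s t z. z \<in> Z \<Longrightarrow> act s (act t z) = act (s * t) z"
    and der: "\<And>s t z. z \<in> Z \<Longrightarrow> f (s * t) z = f s (act t z) + f t (act s z)"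
    and bound: "\<And>s t z. z \<in> Z \<Longrightarrow> cmod (f s (act t z)) \<le> K z"
    and z: "z \<in> Z"
  shows "f s z = 0"
proof -
  define e where "e = s * star s"
  have e: "e * e = e" "e * s = s" "e * star s = star s" "star s * e = star s"
    using star_mult_self[OF inv, of s] mult_star_idempotent[OF inv, of s]
    unfolding idempotents_iff[OF inv] e_def by (simp_all add: ac_simps)
  \<comment> \<open>Here \<open>t\<close> and \<open>t'\<close> stand for the powers of
    \<open>s\<close> and of \<open>star s\<close> with exponent n + 1; the existential form does
    without powers in a semigroup that may lack an identity.\<close>
  have log: "\<exists>t t'. t * t' = e \<and> (\<forall>z\<in>Z. f t (act t' z) = of_nat (Suc n) * f s (act (star s) z))" for n
  proof (induction n)
    case 0 show ?case by (rule exI[of _ s], rule exI[of _ "star s"]) (simp add: e_def)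
  next
    case (Suc n)
    then obtain t t' where t: "t * t' = e"
      "\<And>z. z \<in> Z \<Longrightarrow> f t (act t' z) = of_nat (Suc n) * f s (act (star s) z)" by blast
    have 1: "(t * s) * (t' * star s) = e"
      using t(1) e(1) by (metis e_def mult.assoc mult.commute)
    have 2: "f (t * s) (act (t' * star s) z) = of_nat (Suc (Suc n)) * f s (act (star s) z)" if "z \<in> Z" for z
    proof -
      have "f (t * s) (act (t' * star s) z) = f t (act s (act (t' * star s) z)) + f s (act t (act (t' * star s) z))"
        using der closed that by blast
      also have "act s (act (t' * star s) z) = act t' (act e z)"
        using that by (simp add: act e_def ac_simps)
      also have "act t (act (t' * star s) z) = act (star s) z"
        using that t(1) e(3) by (simp add: act mult.assoc[symmetric])
      also have "f t (act t' (act e z)) = of_nat (Suc n) * f s (act (star s) z)"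
        using t(2)[OF closed[OF that, of e]] act[OF that, of "star s" e] e(4) by simp
      finally show ?thesis by (simp add: algebra_simps)
    qed
    show ?case using 1 2 by blast
  qed
  have log0: "f s (act (star s) z) = 0" if z: "z \<in> Z" for z
  proof (rule ccontr)
    \<comment> \<open>The values in \<open>log\<close> grow linearly in n, while
      \<open>bound\<close> caps all of them by the same \<open>K z\<close>, uniformly in both
      semigroup arguments.\<close>
    assume "f s (act (star s) z) \<noteq> 0"
    then obtain n :: nat where n: "K z < of_nat n * cmod (f s (act (star s) z))"
      using reals_Archimedean3[of "cmod (f s (act (star s) z))"] by auto
    obtain t t' where "f t (act t' z) = of_nat (Suc n) * f s (act (star s) z)"
      using log[of n] z by blast
    then have "real (Suc n) * cmod (f s (act (star s) z)) = cmod (f t (act t' z))"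
      by (simp add: norm_mult del: of_nat_Suc)
    also have "\<dots> \<le> K z" using bound z by blast
    finally have "real n * cmod (f s (act (star s) z)) + cmod (f s (act (star s) z)) \<le> K z"
      by (simp add: algebra_simps)
    with n norm_ge_zero[of "f s (act (star s) z)"] show False by linarith
  qed
  \<comment> \<open>A derivation kills idempotents: at \<open>act e z\<close> the Leibniz rule reads
    v = v + v, and at \<open>z\<close> it expresses \<open>f e z\<close> as twice that
    value.\<close>
  have fe: "f e z = 0" if z: "z \<in> Z" for z
  proof -
    have "f e (act e z) = f e (act e (act e z)) + f e (act e (act e z))"
      using der[OF closed[OF z], of e e e] e(1) by simp
    then have "f e (act e z) = 0" using z by (simp add: act e(1))
    then show ?thesis using der[OF z, of e e] e(1) by simp
  qed
  \<comment> \<open>Writing \<open>s\<close> as \<open>s * e\<close> replaces \<open>z\<close> by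
    \<open>act e z\<close>, which has the form that \<open>log0\<close> covers.\<close>
  have "f s z = f s (act e z) + f e (act s z)"
    using der[OF z, of s e] e(2) by (simp add: mult.commute)
  also have "act e z = act (star s) (act s z)"
    using z by (simp add: act e_def mult.commute)
  finally show ?thesis using log0 fe closed z by simp
qed

section \<open>Multipliers under condition \<open>D\<^sub>k\<close>\<close>

text \<open>In the natural order of idempotents, where \<open>i\<close> lies below \<open>g\<close>
  iff \<open>i * g = i\<close>, this is the set of idempotents above \<open>i\<close>.\<close>

definition upper :: "'s::semigroup_mult \<Rightarrow> 's set" where
  "upper i = {g \<in> idempotents. i * g = i}"

text \<open>Condition \<open>D_k\<close> bounds by \<open>k\<close> the size of a set of idempotents
  no two of which have a common upper bound, so such a set \<open>I\<close> of maximal size exists.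
  It cannot be enlarged by a further element, which gives the cover; nor can some \<open>i\<close>
  in it be traded for two elements above \<open>i\<close> without a common upper bound, which makes
  each \<open>upper i\<close> directed.\<close>

lemma condition_D_directed_cover:
  fixes E :: "'s::ab_semigroup_mult set"
  assumes inv: "inverse_semigroup TYPE('s)" and D: "condition_D k (idempotents :: 's set)"
  obtains I :: "'s set" where "finite I" "I \<subseteq> idempotents"
    "\<And>i g h. \<lbrakk>i \<in> I; g \<in> upper i; h \<in> upper i\<rbrakk> \<Longrightarrow> \<exists>u\<in>upper i. g * u = g \<and> h * u = h"
    "\<And>e. e \<in> idempotents \<Longrightarrow> \<exists>i\<in>I. \<exists>g\<in>upper i. e * g = e"
proof -
  define indep where "indep I \<longleftrightarrow> finite I \<and> I \<subseteq> (idempotents :: 's set) \<and>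
    (\<forall>i\<in>I. \<forall>j\<in>I. i \<noteq> j \<longrightarrow> \<not> (\<exists>e\<in>idempotents. i * e = i \<and> j * e = j))" for I
  have card: "card I \<le> k" if "indep I" for I
  proof (rule ccontr)
    assume "\<not> card I \<le> k"
    then have "card {1..k + 1} \<le> card I" by simp
    moreover have "finite I" using that by (simp add: indep_def)
    ultimately obtain f where f: "f ` {1..k + 1} \<subseteq> I" "inj_on f {1..k + 1}"
      using card_le_inj[of "{1..k + 1}" I] by auto
    have "\<forall>i\<in>{1..k + 1}. f i \<in> idempotents" using f(1) that by (auto simp: indep_def)
    then obtain e i j where e: "e \<in> idempotents" "1 \<le> i" "i < j" "j \<le> k + 1" "f i * e = f i" "f j * e = f j"
      using D unfolding condition_D_def by blast
    have "f i \<noteq> f j" using f(2) e(2-4) by (auto dest: inj_onD)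
    moreover have "f i \<in> I" "f j \<in> I" using f(1) e(2-4) by auto
    ultimately show False using that e unfolding indep_def by blast
  qed
  have "indep {}" by (simp add: indep_def)
  \<comment> \<open>The bound in this rule is strict, hence \<open>Suc k\<close>.\<close>
  then have "\<exists>I. indep I \<and> (\<forall>I'. indep I' \<longrightarrow> card I' \<le> card I)"
    by (rule ex_has_greatest_nat[where b = "Suc k"]) (use card in \<open>simp add: less_Suc_eq_le\<close>)
  then obtain I where I: "indep I" and max: "\<And>I'. indep I' \<Longrightarrow> card I' \<le> card I"
    by (elim exE conjE) simp
  have idem: "i * i = i" if "i \<in> idempotents" for i :: 's
    using that idempotents_iff[OF inv] by blast
  have cover: "\<exists>i\<in>I. \<exists>g\<in>upper i. e * g = e" if e: "e \<in> idempotents" for e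
  proof (cases "e \<in> I")
    case True
    then show ?thesis using e idem[OF e] by (auto simp: upper_def intro!: bexI[of _ e])
  next
    case False
    have "\<exists>j\<in>I. \<exists>g\<in>idempotents. j * g = j \<and> e * g = e"
    proof (rule ccontr)
      assume no: "\<not> ?thesis"
      have "indep (insert e I)"
        unfolding indep_def
      proof (intro conjI ballI impI)
        show "finite (insert e I)" "insert e I \<subseteq> idempotents" using I e by (auto simp: indep_def)
        fix a b assume "a \<in> insert e I" "b \<in> insert e I" "a \<noteq> b"
        then consider "a = e" "b \<in> I" | "b = e" "a \<in> I" | "a \<in> I" "b \<in> I" by blast
        then show "\<not> (\<exists>g\<in>idempotents. a * g = a \<and> b * g = b)"
        proof cases
          case 3
          then show ?thesis using I \<open>a \<noteq> b\<close> unfolding indep_def by blast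
        qed (use no in blast)+
      qed
      moreover have "finite I" using I by (simp add: indep_def)
      ultimately show False using max[of "insert e I"] False by simp
    qed
    then show ?thesis by (auto simp: upper_def)
  qed
  have dir: "\<exists>u\<in>upper i. g * u = g \<and> h * u = h" if i: "i \<in> I" and g: "g \<in> upper i" and h: "h \<in> upper i" for i g h
  proof (rule ccontr)
    assume no: "\<not> ?thesis"
    have ge: "g \<in> idempotents" "i * g = i" and he: "h \<in> idempotents" "i * h = i"
      using g h by (auto simp: upper_def)
    have up: "i * u = i" if "x * u = x" "i * x = i" for x u
      using that by (metis mult.assoc)
    have no': "\<not> (\<exists>u\<in>idempotents. g * u = g \<and> h * u = h)"
      using no up[of g] ge(2) by (auto simp: upper_def)
    have nog: "\<not> (\<exists>u\<in>idempotents. x * u = x \<and> y * u = y)" if "y \<in> I" "y \<noteq> i" "i * x = i" for x y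
      using I i that up unfolding indep_def by blast
    have ne: "g \<noteq> h" using no' ge(1) idem by blast
    have gI: "x \<notin> I - {i}" if "i * x = i" "x \<in> idempotents" for x
      using nog[of x x] that idem by blast
    \<comment> \<open>An upper bound of an element above \<open>i\<close> is also one of
      \<open>i\<close>, so \<open>g\<close> and \<open>h\<close> inherit independence from the rest
      of \<open>I\<close>. For the same reason neither of them already lies in
      \<open>I - {i}\<close>, and the size grows by one.\<close>
    let ?I = "insert g (insert h (I - {i}))"
    have "indep ?I"
      unfolding indep_def
    proof (intro conjI ballI impI)
      show "finite ?I" "?I \<subseteq> idempotents" using I ge he by (auto simp: indep_def)
      fix a b assume ab: "a \<in> ?I" "b \<in> ?I" "a \<noteq> b"
      show "\<not> (\<exists>e\<in>idempotents. a * e = a \<and> b * e = b)"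
      proof (cases "a \<in> I - {i} \<and> b \<in> I - {i}")
        case True then show ?thesis using I ab(3) unfolding indep_def by blast
      next
        case False
        then show ?thesis
          using ab no' nog[of a b] nog[of b a] ge he by blast
      qed
    qed
    then have "card ?I \<le> card I" by (rule max)
    moreover have "card ?I = card I + 1"
    proof -
      have "finite I" using I by (simp add: indep_def)
      moreover have "g \<notin> insert h (I - {i})" "h \<notin> I - {i}" using gI ge he ne by auto
      ultimately have "card ?I = Suc (Suc (card (I - {i})))" by simp
      also have "Suc (card (I - {i})) = card I"
        using \<open>finite I\<close> i by (metis card_Suc_Diff1)
      finally show ?thesis by simp
    qed
    ultimately show False by simp
  qed
  show thesis using that[of I] I cover dir by (auto simp: indep_def)
qed

text \<open>Banach-Alaoglu in pointwise form: by Tychonoff the product of the discs of radius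
  \<open>K z\<close> is compact, so the image of \<open>N\<close> has a cluster point. The finer
  filter is returned as well, because linearity and all identities of the limit are read off as
  ordinary limits along it.\<close>

lemma pointwise_cluster_point:
  fixes h :: "'i \<Rightarrow> 'z \<Rightarrow> complex"
  assumes N: "N \<noteq> bot" and bound: "\<And>i z. cmod (h i z) \<le> K z"
  obtains N' x where "N' \<le> N" "N' \<noteq> bot" "\<And>z. ((\<lambda>i. h i z) \<longlongrightarrow> x z) N'"
proof -
  have "compactin (product_topology (\<lambda>z::'z. euclidean) UNIV) (PiE UNIV (\<lambda>z. cball (0::complex) (K z)))"
    by (simp add: compactin_PiE)
  then have "compact (PiE UNIV (\<lambda>z. cball (0::complex) (K z)))"
    by (simp add: euclidean_product_topology)
  moreover have "eventually (\<lambda>x. x \<in> PiE UNIV (\<lambda>z. cball (0::complex) (K z))) (filtermap h N)"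
    using bound by (simp add: eventually_filtermap PiE_def)
  moreover have "filtermap h N \<noteq> bot" using N by (simp add: filtermap_bot_iff)
  ultimately obtain x where x: "inf (nhds x) (filtermap h N) \<noteq> bot"
    unfolding compact_filter by blast
  \<comment> \<open>Generated by \<open>N\<close> and the preimages of the neighbourhoods of
    \<open>x\<close>; along it \<open>h\<close> converges to \<open>x\<close> in the product
    topology.\<close>
  define N' where "N' = inf (filtercomap h (nhds x)) N"
  have "N' \<noteq> bot"
  proof
    assume "N' = bot"
    then have "eventually (\<lambda>_. False) N'" by simp
    then obtain P Q where P: "eventually P (nhds x)" "eventually Q N" "\<And>i. P (h i) \<Longrightarrow> Q i \<Longrightarrow> False"
      unfolding N'_def eventually_inf eventually_filtercomap by metis
    have "eventually (\<lambda>y. \<not> P y) (filtermap h N)"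
      unfolding eventually_filtermap using P(2) by eventually_elim (use P(3) in blast)
    then have "eventually (\<lambda>_. False) (inf (nhds x) (filtermap h N))"
      using P(1) unfolding eventually_inf by blast
    with x show False by (simp add: trivial_limit_def)
  qed
  moreover have "((\<lambda>i. h i z) \<longlongrightarrow> x z) N'" for z
  proof -
    have "filterlim h (nhds x) N'"
      unfolding N'_def by (rule filterlim_mono[OF filterlim_filtercomap order_refl inf_le1])
    then show ?thesis
      using continuous_on_tendsto_compose[of UNIV "\<lambda>y :: 'z \<Rightarrow> complex. y z" h x N'] by simp
  qed
  ultimately show thesis using that[of N' x] by (simp add: N'_def)
qed

text \<open>With an identity in \<open>S\<close> one would take for \<open>x\<close> the value of
  \<open>f\<close> at it. Its substitute is a limit of \<open>f g\<close> along growing idempotents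
  \<open>g\<close>: once \<open>g\<close> lies above \<open>e\<close>, the value
  \<open>f g (act e z)\<close> equals \<open>f e z\<close>. Such a limit settles the idempotents
  below one directed set; the finitely many directed sets are handled one after another, each time
  correcting the functional found so far.\<close>

lemma multiplier_inner:
  fixes act :: "'s::ab_semigroup_mult \<Rightarrow> 'z \<Rightarrow> 'z" and f :: "'s \<Rightarrow> 'z \<Rightarrow> complex"
    and Z :: "('z, 'm) vspace_scheme"
  assumes inv: "inverse_semigroup TYPE('s)" and D: "condition_D k (idempotents :: 's set)"
    and Z: "normed_vspace Z"
    and lin: "\<And>s. linear_map Z Z (act s)"
    and act: "\<And>s t z. z \<in> carrier Z \<Longrightarrow> act s (act t z) = act (s * t) z"
    and act_bound: "\<And>s z. z \<in> carrier Z \<Longrightarrow> vnorm Z (act s z) \<le> C * vnorm Z z"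
    and f: "\<And>s. bounded_functional Z (f s)"
    and f_bound: "\<And>s z. z \<in> carrier Z \<Longrightarrow> cmod (f s z) \<le> M * vnorm Z z"
    and mult: "\<And>s t z. z \<in> carrier Z \<Longrightarrow> f (s * t) z = f t (act s z)"
  obtains x where "bounded_functional Z x" "\<And>s z. z \<in> carrier Z \<Longrightarrow> f s z = x (act s z)"
proof -
  interpret Z: normed_vspace Z by (rule Z)
  note closed = linear_mapD(1)[OF lin]
  have idem: "i * i = i" if "i \<in> idempotents" for i :: 's
    using that idempotents_iff[OF inv] by blast
  obtain I :: "'s set" where I: "finite I" "I \<subseteq> idempotents"
    and dir: "\<And>i g h. \<lbrakk>i \<in> I; g \<in> upper i; h \<in> upper i\<rbrakk> \<Longrightarrow> \<exists>u\<in>upper i. g * u = g \<and> h * u = h"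
    and cover: "\<And>e. e \<in> idempotents \<Longrightarrow> \<exists>i\<in>I. \<exists>g\<in>upper i. e * g = e"
    using condition_D_directed_cover[OF inv D] by blast
  have "\<exists>x. bounded_functional Z x \<and>
      (\<forall>i\<in>J. \<forall>g\<in>upper i. \<forall>e. e * g = e \<longrightarrow> (\<forall>z\<in>carrier Z. f e z = x (act e z)))" if "finite J" "J \<subseteq> I" for J
    using that
  proof (induction J rule: finite_induct)
    case empty
    have "bounded_functional Z (\<lambda>z. 0)" by (rule bounded_functionalI[where M = 0]) simp_all
    then show ?case by auto
  next
    case (insert i J)
    then obtain x where x: "bounded_functional Z x"
      "\<And>j g e z. \<lbrakk>j \<in> J; g \<in> upper j; e * g = e; z \<in> carrier Z\<rbrakk> \<Longrightarrow> f e z = x (act e z)" by blast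
    obtain L where L: "L \<ge> 0" "\<And>z. z \<in> carrier Z \<Longrightarrow> cmod (x z) \<le> L * vnorm Z z"
      using Z.functional_bound[OF x(1)] by blast
    \<comment> \<open>The defect of the solution found for \<open>J\<close>. It is cut off outside
      the carrier because the compactness lemma wants a bound at every point; \<open>K\<close> adds
      the bound \<open>M\<close> of \<open>f\<close> and the bound \<open>L * C\<close> of
      \<open>x\<close> after the action.\<close>
    define d where "d s z = (if z \<in> carrier Z then f s z - x (act s z) else 0)" for s z
    define K where "K = M + L * C"
    have bd: "cmod (d s z) \<le> (if z \<in> carrier Z then K * vnorm Z z else 0)" for s z
    proof (cases "z \<in> carrier Z")
      case True
      have "cmod (x (act s z)) \<le> L * vnorm Z (act s z)" using L(2) closed True by blast
      also have "\<dots> \<le> L * (C * vnorm Z z)" using act_bound[OF True] L(1) by (intro mult_left_mono)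
      finally have "cmod (x (act s z)) \<le> L * (C * vnorm Z z)" .
      with f_bound[OF True, of s] norm_triangle_ineq4[of "f s z" "x (act s z)"] True show ?thesis
        by (simp add: d_def K_def algebra_simps)
    qed (simp add: d_def)
    have dm: "d s (act t z) = d (s * t) z" if "z \<in> carrier Z" for s t z
      using that mult[OF that, of t s] closed[OF that] by (simp add: d_def act mult.commute)
    \<comment> \<open>The filter of tails of the directed set \<open>upper i\<close>.\<close>
    define N where "N = (INF h\<in>upper i. principal {g \<in> upper i. h * g = h})"
    have iu: "i \<in> upper i" using insert.prems I idem by (auto simp: upper_def)
    have evN: "eventually P N \<longleftrightarrow> (\<exists>h\<in>upper i. \<forall>g\<in>upper i. h * g = h \<longrightarrow> P g)" for P
      unfolding N_def
    proof (subst eventually_INF_base)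
      show "upper i \<noteq> {}" using iu by blast
      fix a b assume ab: "a \<in> upper i" "b \<in> upper i"
      then obtain u where u: "u \<in> upper i" "a * u = a" "b * u = b" using dir insert.prems by blast
      have "{g \<in> upper i. u * g = u} \<subseteq> {g \<in> upper i. a * g = a} \<inter> {g \<in> upper i. b * g = b}"
        using u(2,3) by (auto, (metis mult.assoc)+)
      then show "\<exists>x\<in>upper i. principal {g \<in> upper i. x * g = x}
          \<le> inf (principal {g \<in> upper i. a * g = a}) (principal {g \<in> upper i. b * g = b})"
        using u(1) by (intro bexI[of _ u]) simp_all
    qed (auto simp: eventually_principal)
    have "N \<noteq> bot"
    proof
      assume "N = bot"
      then have "eventually (\<lambda>_. False) N" by simp
      then show False unfolding evN using idem by (auto simp: upper_def)
    qed
    then obtain N' y where N': "N' \<le> N" "N' \<noteq> bot" "\<And>z. ((\<lambda>g. d g z) \<longlongrightarrow> y z) N'"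
      using pointwise_cluster_point[of N d, OF _ bd] by blast
    have ev: "eventually P N'" if "h \<in> upper i" "\<And>g. \<lbrakk>g \<in> upper i; h * g = h\<rbrakk> \<Longrightarrow> P g" for P h
      using that N'(1) evN by (meson filter_leD)
    have y: "bounded_functional Z y"
    proof (rule bounded_functionalI)
      fix u v assume uv: "u \<in> carrier Z" "v \<in> carrier Z"
      have "d g (vadd Z u v) = d g u + d g v" for g
        using uv closed by (simp add: d_def Z.add_closed bounded_functionalD[OF f] bounded_functionalD[OF x(1)]
            linear_mapD[OF lin])
      then show "y (vadd Z u v) = y u + y v"
        using tendsto_unique[OF N'(2) N'(3)[of "vadd Z u v"]] tendsto_add[OF N'(3) N'(3), of u v] by simp
    next
      fix c u assume u: "u \<in> carrier Z"
      have "d g (vscale Z c u) = c * d g u" for g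
        using u closed by (simp add: d_def Z.scale_closed bounded_functionalD[OF f] bounded_functionalD[OF x(1)]
            linear_mapD[OF lin] algebra_simps)
      then show "y (vscale Z c u) = c * y u"
        using tendsto_unique[OF N'(2) N'(3)[of "vscale Z c u"]] tendsto_mult_left[OF N'(3), of c u] by simp
    next
      fix z assume "z \<in> carrier Z"
      then show "cmod (y z) \<le> K * vnorm Z z"
        using tendsto_upperbound[OF tendsto_norm[OF N'(3)] _ N'(2), of z] bd[of _ z] by simp
    qed
    \<comment> \<open>Along \<open>N'\<close> eventually \<open>g * u = g\<close>, hence
      \<open>u * e = e\<close>, and the net is constant from there on.\<close>
    have ye: "y (act e z) = d e z" if g: "g \<in> upper i" "e * g = e" and z: "z \<in> carrier Z" for g e z
    proof (rule tendsto_unique[OF N'(2) N'(3)])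
      have "eventually (\<lambda>u. d u (act e z) = d e z) N'"
      proof (rule ev[OF g(1)])
        fix u assume "u \<in> upper i" "g * u = g"
        then have "u * e = e" using g(2) by (metis mult.assoc mult.commute)
        then show "d u (act e z) = d e z" using dm[OF z] by simp
      qed
      then show "((\<lambda>u. d u (act e z)) \<longlongrightarrow> d e z) N'" by (rule tendsto_eventually)
    qed
    \<comment> \<open>The correction does not disturb what is settled: with \<open>e\<close> every
      multiple \<open>u * e\<close> stays below \<open>g\<close>, where the defect is already
      0.\<close>
    have yj: "y (act e z) = 0" if g: "j \<in> J" "g \<in> upper j" "e * g = e" and z: "z \<in> carrier Z" for j g e z
    proof (rule tendsto_unique[OF N'(2) N'(3)])
      have "d u (act e z) = 0" for u
      proof -
        have "(u * e) * g = u * e" using g(3) by (simp add: mult.assoc)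
        then have "d (u * e) z = 0" using x(2)[OF g(1,2) _ z] z by (simp add: d_def)
        then show ?thesis using dm[OF z] by simp
      qed
      then show "((\<lambda>u. d u (act e z)) \<longlongrightarrow> 0) N'" by simp
    qed
    have "bounded_functional Z (\<lambda>z. x z + y z)"
    proof -
      obtain L' where L': "L' \<ge> 0" "\<And>z. z \<in> carrier Z \<Longrightarrow> cmod (y z) \<le> L' * vnorm Z z"
        using Z.functional_bound[OF y] by blast
      show ?thesis
      proof (rule bounded_functionalI)
        show "cmod (x z + y z) \<le> (L + L') * vnorm Z z" if "z \<in> carrier Z" for z
          using norm_triangle_ineq[of "x z" "y z"] L(2)[OF that] L'(2)[OF that] by (simp add: algebra_simps)
      qed (simp_all add: bounded_functionalD[OF x(1)] bounded_functionalD[OF y] algebra_simps)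
    qed
    moreover have "f e z = x (act e z) + y (act e z)"
      if "j \<in> insert i J" "g \<in> upper j" "e * g = e" "z \<in> carrier Z" for j g e z
    proof (cases "j = i")
      case True
      then show ?thesis using ye[of g e z] that by (simp add: d_def)
    next
      case False
      then have "j \<in> J" using that by simp
      then show ?thesis using yj[of j g e z] x(2)[of j g e z] that by simp
    qed
    ultimately show ?case by (intro exI[of _ "\<lambda>z. x z + y z"]) blast
  qed
  from this[OF I(1) order_refl] obtain x where x: "bounded_functional Z x"
    "\<And>i g e z. \<lbrakk>i \<in> I; g \<in> upper i; e * g = e; z \<in> carrier Z\<rbrakk> \<Longrightarrow> f e z = x (act e z)" by blast
  have "f s z = x (act s z)" if z: "z \<in> carrier Z" for s z
  proof -
    \<comment> \<open>The passage from idempotents to all of \<open>S\<close>: since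
      \<open>s = s * e\<close>, the value \<open>f s z\<close> is \<open>f e\<close> at
      \<open>act s z\<close>.\<close>
    define e where "e = s * star s"
    have e: "e \<in> idempotents" "s * e = s" "e * s = s"
      using mult_star_idempotent[OF inv] star_mult_self[OF inv] by (simp_all add: e_def)
    obtain i g where "i \<in> I" "g \<in> upper i" "e * g = e" using cover[OF e(1)] by blast
    then have "f e (act s z) = x (act e (act s z))" using x(2) closed[OF z] by blast
    then show ?thesis using mult[OF z, of s e] z by (simp add: e act)
  qed
  with x(1) show thesis by (rule that)
qed

section \<open>The convolution algebra\<close>

lemma ell1_UNIV_iff: "f \<in> ell1 UNIV \<longleftrightarrow> (\<lambda>s. norm (f s)) summable_on UNIV"
  by (simp add: ell1_def)

lemma ell1_subset: "f \<in> ell1 A \<Longrightarrow> f \<in> ell1 UNIV"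
  by (simp add: ell1_def)

lemma ell1_zero [simp]: "(\<lambda>s. 0) \<in> ell1 A"
  by (simp add: ell1_def)

lemma ell1_norm_zero [simp]: "ell1_norm (\<lambda>s. 0) = 0"
  by (simp add: ell1_norm_def)

lemma ell1_norm_nonneg [simp]: "0 \<le> ell1_norm f"
  by (simp add: ell1_norm_def infsum_nonneg)

lemma ell1_comparison:
  assumes "g \<in> ell1 UNIV" "\<And>s. cmod (f s) \<le> cmod (g s)"
  shows "f \<in> ell1 UNIV"
  unfolding ell1_UNIV_iff
  by (rule Infinite_Sum.abs_summable_on_comparison_test[of g]) (use assms in \<open>simp_all add: ell1_UNIV_iff\<close>)

lemma ell1_add:
  assumes "f \<in> ell1 A" "g \<in> ell1 A"
  shows "(\<lambda>s. f s + g s) \<in> ell1 A" "ell1_norm (\<lambda>s. f s + g s) \<le> ell1_norm f + ell1_norm g"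
proof -
  have s: "(\<lambda>s. cmod (f s) + cmod (g s)) summable_on UNIV"
    using assms by (auto simp: ell1_def intro: summable_on_add)
  then have "(\<lambda>s. cmod (f s + g s)) summable_on UNIV"
    by (rule Infinite_Sum.abs_summable_on_comparison_test') (simp add: norm_triangle_ineq)
  then show 1: "(\<lambda>s. f s + g s) \<in> ell1 A"
    using assms by (auto simp: ell1_def)
  have "ell1_norm (\<lambda>s. f s + g s) \<le> (\<Sum>\<^sub>\<infinity>s. cmod (f s) + cmod (g s))"
    unfolding ell1_norm_def by (rule infsum_mono) (use 1 s in \<open>simp_all add: ell1_def norm_triangle_ineq\<close>)
  also have "\<dots> = ell1_norm f + ell1_norm g"
    unfolding ell1_norm_def by (rule infsum_add) (use assms in \<open>simp_all add: ell1_def\<close>)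
  finally show "ell1_norm (\<lambda>s. f s + g s) \<le> ell1_norm f + ell1_norm g" .
qed

lemma ell1_norm_scale: "ell1_norm (\<lambda>s. c * f s) = cmod c * ell1_norm f"
  by (simp add: ell1_norm_def norm_mult infsum_cmult_right')

lemma ell1_scale: "f \<in> ell1 A \<Longrightarrow> (\<lambda>s. c * f s) \<in> ell1 A"
  by (simp add: ell1_def norm_mult summable_on_cmult_right)

lemma ell1_diff: "\<lbrakk>f \<in> ell1 A; g \<in> ell1 A\<rbrakk> \<Longrightarrow> (\<lambda>s. f s - g s) \<in> ell1 A"
  using ell1_add(1)[OF _ ell1_scale[where c = "-1"], of f A g] by simp

lemma ell1_pointwise:
  assumes "f \<in> ell1 UNIV" shows "cmod (f s) \<le> ell1_norm f"
proof -
  have "sum (\<lambda>s. cmod (f s)) {s} \<le> infsum (\<lambda>s. cmod (f s)) UNIV"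
    by (rule finite_sum_le_infsum) (use assms in \<open>simp_all add: ell1_def\<close>)
  then show ?thesis by (simp add: ell1_norm_def)
qed

lemma ell1_norm_eq_zero:
  assumes "f \<in> ell1 UNIV" shows "ell1_norm f = 0 \<longleftrightarrow> f = (\<lambda>s. 0)"
proof
  assume "ell1_norm f = 0"
  then have "f s = 0" for s using ell1_pointwise[OF assms, of s] by simp
  then show "f = (\<lambda>s. 0)" by blast
qed simp

lemma delta_ell1: "delta s \<in> ell1 UNIV" and delta_norm: "ell1_norm (delta s) = 1"
proof -
  have "((\<lambda>t. cmod (delta s t)) has_sum 1) UNIV"
    by (rule has_sum_finite_neutralI[of "{s}"]) (auto simp: delta_def)
  then show "delta s \<in> ell1 UNIV" "ell1_norm (delta s) = 1"
    by (auto simp: ell1_def ell1_norm_def summable_on_def infsumI)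
qed

text \<open>Pointwise convergence is part of the conclusion because the carriers of matrices are
  later cut out by pointwise conditions.\<close>

lemma ell1_complete:
  fixes \<sigma> :: "nat \<Rightarrow> 's \<Rightarrow> complex"
  assumes s: "\<And>n. \<sigma> n \<in> ell1 UNIV"
    and c: "\<And>e. e > 0 \<Longrightarrow> \<exists>N. \<forall>m\<ge>N. \<forall>n\<ge>N. ell1_norm (\<lambda>s. \<sigma> m s - \<sigma> n s) < e"
  obtains l where "l \<in> ell1 UNIV" "\<And>s. (\<lambda>n. \<sigma> n s) \<longlonglongrightarrow> l s"
    "\<And>e. e > 0 \<Longrightarrow> \<exists>N. \<forall>n\<ge>N. ell1_norm (\<lambda>s. \<sigma> n s - l s) < e"
proof -
  have "Cauchy (\<lambda>n. \<sigma> n x)" for x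
  proof (rule metric_CauchyI)
    fix e :: real assume "e > 0"
    then obtain N where N: "\<forall>m\<ge>N. \<forall>n\<ge>N. ell1_norm (\<lambda>s. \<sigma> m s - \<sigma> n s) < e" using c by blast
    have "dist (\<sigma> m x) (\<sigma> n x) < e" if "m \<ge> N" "n \<ge> N" for m n
      using ell1_pointwise[OF ell1_diff[OF s[of m] s[of n]], of x] N that
      by (fastforce simp: dist_norm)
    then show "\<exists>N. \<forall>m\<ge>N. \<forall>n\<ge>N. dist (\<sigma> m x) (\<sigma> n x) < e" by blast
  qed
  then have l: "(\<lambda>n. \<sigma> n s) \<longlonglongrightarrow> lim (\<lambda>n. \<sigma> n s)" for s
    by (simp add: Cauchy_convergent_iff convergent_LIMSEQ_iff)
  define l where "l s = lim (\<lambda>n. \<sigma> n s)" for s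
  have l: "(\<lambda>n. \<sigma> n s) \<longlonglongrightarrow> l s" for s using l by (simp add: l_def)
  \<comment> \<open>Finite partial sums pass to the pointwise limit; taking all finite sets then
    yields summability and the norm bound at once.\<close>
  have fin: "(\<Sum>s\<in>F. cmod (\<sigma> n s - l s)) \<le> e"
    if N: "\<forall>m\<ge>N. \<forall>n\<ge>N. ell1_norm (\<lambda>s. \<sigma> m s - \<sigma> n s) < e" and n: "n \<ge> N" and F: "finite F" for N n e F
  proof (rule tendsto_upperbound)
    show "(\<lambda>m. \<Sum>s\<in>F. cmod (\<sigma> n s - \<sigma> m s)) \<longlonglongrightarrow> (\<Sum>s\<in>F. cmod (\<sigma> n s - l s))"
      by (intro tendsto_intros l)
    have "(\<Sum>s\<in>F. cmod (\<sigma> n s - \<sigma> m s)) \<le> e" if "m \<ge> N" for m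
    proof -
      have "(\<Sum>s\<in>F. cmod (\<sigma> n s - \<sigma> m s)) \<le> ell1_norm (\<lambda>s. \<sigma> n s - \<sigma> m s)"
        unfolding ell1_norm_def
        by (rule finite_sum_le_infsum) (use F ell1_diff[OF s[of n] s[of m]] in \<open>simp_all add: ell1_def\<close>)
      also have "\<dots> \<le> e" using N n that by (simp add: less_imp_le)
      finally show ?thesis .
    qed
    then show "\<forall>\<^sub>F m in sequentially. (\<Sum>s\<in>F. cmod (\<sigma> n s - \<sigma> m s)) \<le> e"
      by (auto simp: eventually_sequentially)
  qed simp
  have diff: "(\<lambda>s. \<sigma> n s - l s) \<in> ell1 UNIV \<and> ell1_norm (\<lambda>s. \<sigma> n s - l s) \<le> e"
    if N: "\<forall>m\<ge>N. \<forall>n\<ge>N. ell1_norm (\<lambda>s. \<sigma> m s - \<sigma> n s) < e" and n: "n \<ge> N" for N n e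
  proof -
    have sm: "(\<lambda>s. cmod (\<sigma> n s - l s)) summable_on UNIV"
      by (rule nonneg_bdd_above_summable_on) (use fin[OF N n] in \<open>auto simp: bdd_above_def\<close>)
    moreover have "infsum (\<lambda>s. cmod (\<sigma> n s - l s)) UNIV \<le> e"
      by (rule infsum_le_finite_sums[OF sm]) (use fin[OF N n] in auto)
    ultimately show ?thesis by (simp add: ell1_UNIV_iff ell1_norm_def)
  qed
  obtain N where N: "\<forall>m\<ge>N. \<forall>n\<ge>N. ell1_norm (\<lambda>s. \<sigma> m s - \<sigma> n s) < 1"
    using c[OF zero_less_one] by blast
  have "l \<in> ell1 UNIV"
    using ell1_diff[OF s[of N] conjunct1[OF diff[OF N order_refl]]] by simp
  moreover have "\<exists>N. \<forall>n\<ge>N. ell1_norm (\<lambda>s. \<sigma> n s - l s) < e" if e: "e > 0" for e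
  proof -
    obtain N where N: "\<forall>m\<ge>N. \<forall>n\<ge>N. ell1_norm (\<lambda>s. \<sigma> m s - \<sigma> n s) < e / 2"
      using c[OF half_gt_zero[OF e]] by blast
    have "ell1_norm (\<lambda>s. \<sigma> n s - l s) < e" if "n \<ge> N" for n
      using diff[OF N that] e by simp
    then show ?thesis by blast
  qed
  ultimately show thesis using that l by blast
qed

text \<open>A density argument for maps not known to be complex-linear: besides the bound only
  additivity is assumed, so vanishing is demanded at every multiple of a point mass. Finitely
  supported functions are sums of these, and the remainder has small norm.\<close>

lemma additive_zero_on_ell1:
  fixes G :: "('s \<Rightarrow> complex) \<Rightarrow> complex"
  assumes add: "\<And>f g. \<lbrakk>f \<in> ell1 UNIV; g \<in> ell1 UNIV\<rbrakk> \<Longrightarrow> G (\<lambda>s. f s + g s) = G f + G g"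
    and bound: "\<And>f. f \<in> ell1 UNIV \<Longrightarrow> cmod (G f) \<le> K * ell1_norm f"
    and delta: "\<And>c s. G (\<lambda>t. c * delta s t) = 0"
    and f: "f \<in> ell1 UNIV"
  shows "G f = 0"
proof -
  let ?r = "\<lambda>F s. if s \<in> F then f s else 0"
  have r: "?r F \<in> ell1 UNIV" for F by (rule ell1_comparison[OF f]) simp
  have G0: "G (?r F) = 0" if "finite F" for F
    using that
  proof (induction F rule: finite_induct)
    case empty
    then show ?case using add[OF ell1_zero ell1_zero] by simp
  next
    case (insert x F)
    have "?r (insert x F) = (\<lambda>s. ?r F s + f x * delta x s)"
      using insert.hyps by (auto simp: delta_def)
    then show ?case
      using add[OF r ell1_scale[OF delta_ell1], of F "f x" x] insert.IH delta by simp
  qed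
  have le: "cmod (G f) \<le> \<bar>K\<bar> * e" if e: "e > 0" for e
  proof -
    obtain F where F: "finite F" "dist (sum (\<lambda>s. cmod (f s)) F) (infsum (\<lambda>s. cmod (f s)) UNIV) \<le> e"
      using infsum_finite_approximation[of "\<lambda>s. cmod (f s)" UNIV e] f e by (auto simp: ell1_def)
    have "ell1_norm (?r (- F)) = infsum (\<lambda>s. cmod (f s)) (UNIV - F)"
      unfolding ell1_norm_def by (rule infsum_cong_neutral) auto
    also have "\<dots> = infsum (\<lambda>s. cmod (f s)) UNIV - infsum (\<lambda>s. cmod (f s)) F"
      by (rule infsum_Diff) (use f F(1) in \<open>auto simp: ell1_def\<close>)
    also have "\<dots> \<le> e" using F by (simp add: dist_real_def)
    finally have e': "ell1_norm (?r (- F)) \<le> e" .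
    have "f = (\<lambda>s. ?r F s + ?r (- F) s)" by auto
    then have "G f = G (?r F) + G (?r (- F))" using add[OF r r, of F "- F"] by simp
    then have "cmod (G f) \<le> K * ell1_norm (?r (- F))" using G0[OF F(1)] bound[OF r, of "- F"] by simp
    also have "\<dots> \<le> \<bar>K\<bar> * ell1_norm (?r (- F))" by (intro mult_right_mono) simp_all
    also have "\<dots> \<le> \<bar>K\<bar> * e" using e' by (intro mult_left_mono) simp_all
    finally show ?thesis .
  qed
  have "cmod (G f) \<le> 0 + e" if "e > 0" for e
  proof -
    \<comment> \<open>The summand 1 covers \<open>K = 0\<close>.\<close>
    have "\<bar>K\<bar> * (e / (\<bar>K\<bar> + 1)) \<le> e" using that by (simp add: field_simps)
    then show ?thesis using le[of "e / (\<bar>K\<bar> + 1)"] that by simp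
  qed
  then have "cmod (G f) \<le> 0" by (rule field_le_epsilon)
  then show ?thesis by simp
qed

section \<open>Convolution\<close>

lemma product_summable:
  assumes "f \<in> ell1 UNIV" "g \<in> ell1 UNIV"
  shows "((\<lambda>(r, s). cmod (f r) * cmod (g s)) has_sum (ell1_norm f * ell1_norm g)) UNIV"
proof -
  have f: "((\<lambda>s. cmod (f s)) has_sum ell1_norm f) UNIV" and g: "((\<lambda>s. cmod (g s)) has_sum ell1_norm g) UNIV"
    using assms by (simp_all add: ell1_def ell1_norm_def)
  have 1: "((\<lambda>s. (\<lambda>(r, s). cmod (f r) * cmod (g s)) (r, s)) has_sum (cmod (f r) * ell1_norm g)) UNIV" for r
    using has_sum_cmult_right[OF g] by simp
  have 2: "((\<lambda>r. cmod (f r) * ell1_norm g) has_sum (ell1_norm f * ell1_norm g)) UNIV"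
    using has_sum_cmult_left[OF f] .
  have "(\<lambda>(r, s). cmod (f r) * cmod (g s)) summable_on (SIGMA r:UNIV. UNIV)"
    by (rule summable_on_SigmaI[OF 1 has_sum_imp_summable[OF 2]]) auto
  from has_sum_SigmaI[OF 1 2 this] show ?thesis by simp
qed

lemma product_summable_fibre:
  assumes "f \<in> ell1 UNIV" "g \<in> ell1 UNIV"
  shows "(\<lambda>(r, s). cmod (f r) * cmod (g s)) summable_on A" "(\<lambda>(r, s). f r * g s) summable_on A"
proof -
  show 1: "(\<lambda>(r, s). cmod (f r) * cmod (g s)) summable_on A"
    using has_sum_imp_summable[OF product_summable[OF assms]] by (rule summable_on_subset_banach) simp
  then have "(\<lambda>p. cmod (case p of (r, s) \<Rightarrow> f r * g s)) summable_on A"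
    by (simp add: case_prod_beta' norm_mult)
  then show "(\<lambda>(r, s). f r * g s) summable_on A" by (rule abs_summable_summable)
qed

lemma conv_ell1:
  assumes "f \<in> ell1 UNIV" "g \<in> ell1 UNIV"
  shows "conv f g \<in> ell1 UNIV" "ell1_norm (conv f g) \<le> ell1_norm f * ell1_norm g"
proof -
  let ?h = "\<lambda>(r, s). cmod (f r) * cmod (g s)"
  let ?B = "\<lambda>t. {(r, s). r * s = t}"
  \<comment> \<open>The pairs are partitioned into the fibres of the multiplication, which are the
    index sets of \<open>conv\<close>.\<close>
  have bij: "bij_betw (\<lambda>p. (fst p * snd p, p)) UNIV (Sigma UNIV ?B)"
    by (rule bij_betwI[where g = snd]) auto
  have h: "((\<lambda>(t, p). ?h p) has_sum (ell1_norm f * ell1_norm g)) (Sigma UNIV ?B)"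
    unfolding has_sum_reindex_bij_betw[OF bij, symmetric] using product_summable[OF assms] by simp
  have s: "(\<lambda>t. infsum ?h (?B t)) summable_on UNIV"
    using summable_on_Sigma_banach[OF has_sum_imp_summable[OF h]] by simp
  have tot: "(\<Sum>\<^sub>\<infinity>t. infsum ?h (?B t)) = ell1_norm f * ell1_norm g"
    using infsum_Sigma'_banach[OF has_sum_imp_summable[OF h]] infsumI[OF h] by simp
  have le: "cmod (conv f g t) \<le> infsum ?h (?B t)" for t
  proof -
    have "(\<lambda>p. cmod (case p of (r, s) \<Rightarrow> f r * g s)) summable_on ?B t"
      using product_summable_fibre(1)[OF assms] by (simp add: case_prod_beta' norm_mult)
    from norm_infsum_bound[OF this] show ?thesis
      by (simp add: conv_def case_prod_beta' norm_mult)
  qed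
  show 1: "conv f g \<in> ell1 UNIV"
    unfolding ell1_UNIV_iff by (rule Infinite_Sum.abs_summable_on_comparison_test'[OF s]) (rule le)
  show "ell1_norm (conv f g) \<le> ell1_norm f * ell1_norm g"
    unfolding tot[symmetric] ell1_norm_def[of "conv f g"]
    by (rule infsum_mono) (use 1 s le in \<open>simp_all add: ell1_def\<close>)
qed

lemma conv_zero [simp]: "conv (\<lambda>s. 0) g = (\<lambda>s. 0)" "conv f (\<lambda>s. 0) = (\<lambda>s. 0)"
  by (simp_all add: conv_def fun_eq_iff case_prod_beta')

lemma conv_add_left:
  assumes "f \<in> ell1 UNIV" "f' \<in> ell1 UNIV" "g \<in> ell1 UNIV"
  shows "conv (\<lambda>s. f s + f' s) g = (\<lambda>t. conv f g t + conv f' g t)"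
proof
  fix t
  have "(\<Sum>\<^sub>\<infinity>(r, s)\<in>{(r, s). r * s = t}. (f r + f' r) * g s)
      = (\<Sum>\<^sub>\<infinity>p\<in>{(r, s). r * s = t}. (case p of (r, s) \<Rightarrow> f r * g s) + (case p of (r, s) \<Rightarrow> f' r * g s))"
    by (rule infsum_cong) (auto simp: algebra_simps)
  also have "\<dots> = conv f g t + conv f' g t"
    unfolding conv_def by (rule infsum_add) (rule product_summable_fibre(2)[OF _ assms(3)], fact)+
  finally show "conv (\<lambda>s. f s + f' s) g t = conv f g t + conv f' g t" by (simp add: conv_def)
qed

lemma conv_scale_left: "conv (\<lambda>s. c * f s) g = (\<lambda>t. c * conv f g t)"
  by (simp add: conv_def fun_eq_iff case_prod_beta' mult.assoc infsum_cmult_right')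

lemma conv_commute:
  fixes f :: "'s::ab_semigroup_mult \<Rightarrow> complex"
  shows "conv f g = conv g f"
  unfolding conv_def fun_eq_iff
  by (intro allI infsum_reindex_bij_witness[of _ prod.swap prod.swap]) (auto simp: ac_simps)

lemma conv_add_right:
  fixes f :: "'s::ab_semigroup_mult \<Rightarrow> complex"
  assumes "f \<in> ell1 UNIV" "g \<in> ell1 UNIV" "g' \<in> ell1 UNIV"
  shows "conv f (\<lambda>s. g s + g' s) = (\<lambda>t. conv f g t + conv f g' t)"
  using conv_add_left[OF assms(2,3,1)] by (simp add: conv_commute[of f])

lemma conv_scale_right:
  fixes f :: "'s::ab_semigroup_mult \<Rightarrow> complex"
  shows "conv f (\<lambda>s. c * g s) = (\<lambda>t. c * conv f g t)"
  using conv_scale_left[of c g f] by (simp add: conv_commute[of f])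

text \<open>Instead of rearranging a triple sum, the two bracketings are compared by density in one
  argument after another, starting from point masses, where the claim is associativity in
  \<open>S\<close>. The factor 2 in \<open>b\<close> counts one bound per bracketing.\<close>

lemma conv_assoc:
  fixes f :: "'s::ab_semigroup_mult \<Rightarrow> complex"
  assumes f: "f \<in> ell1 UNIV" and g: "g \<in> ell1 UNIV" and h: "h \<in> ell1 UNIV"
  shows "conv (conv f g) h = conv f (conv g h)"
proof -
  have b: "cmod (conv (conv f g) h t - conv f (conv g h) t) \<le> 2 * (ell1_norm f * ell1_norm g * ell1_norm h)"
    if "f \<in> ell1 UNIV" "g \<in> ell1 UNIV" "h \<in> ell1 UNIV" for f g h :: "'s \<Rightarrow> complex" and t
  proof -
    note fg = conv_ell1[OF that(1,2)] and gh = conv_ell1[OF that(2,3)]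
    have "cmod (conv (conv f g) h t) \<le> ell1_norm (conv f g) * ell1_norm h"
      using ell1_pointwise[OF conv_ell1(1)[OF fg(1) that(3)], of t] conv_ell1(2)[OF fg(1) that(3)] by simp
    also have "\<dots> \<le> ell1_norm f * ell1_norm g * ell1_norm h"
      using fg(2) by (intro mult_right_mono) simp_all
    finally have 1: "cmod (conv (conv f g) h t) \<le> ell1_norm f * ell1_norm g * ell1_norm h" .
    have "cmod (conv f (conv g h) t) \<le> ell1_norm f * ell1_norm (conv g h)"
      using ell1_pointwise[OF conv_ell1(1)[OF that(1) gh(1)], of t] conv_ell1(2)[OF that(1) gh(1)] by simp
    also have "\<dots> \<le> ell1_norm f * (ell1_norm g * ell1_norm h)"
      using gh(2) by (intro mult_left_mono) simp_all
    finally have 2: "cmod (conv f (conv g h) t) \<le> ell1_norm f * ell1_norm g * ell1_norm h" by (simp add: mult.assoc)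
    show ?thesis using norm_triangle_ineq4[of "conv (conv f g) h t" "conv f (conv g h) t"] 1 2 by linarith
  qed
  note lin = conv_add_left conv_add_right conv_scale_left conv_scale_right conv_ell1(1)
  have 1: "conv (conv (delta r) (delta s)) h t - conv (delta r) (conv (delta s) h) t = 0"
    if h: "h \<in> ell1 UNIV" for r s :: 's and h t
  proof (rule additive_zero_on_ell1[where K = 2 and f = h and G = "\<lambda>h. conv (conv (delta r) (delta s)) h t - conv (delta r) (conv (delta s) h) t", OF _ _ _ h])
    fix f :: "'s \<Rightarrow> complex" assume "f \<in> ell1 UNIV"
    from b[OF delta_ell1 delta_ell1 this, of r s t]
    show "cmod (conv (conv (delta r) (delta s)) f t - conv (delta r) (conv (delta s) f) t) \<le> 2 * ell1_norm f"
      by (simp add: delta_norm)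
  qed (simp_all add: lin delta_ell1 conv_delta mult.assoc)
  have 2: "conv (conv (delta r) g) h t - conv (delta r) (conv g h) t = 0"
    if g: "g \<in> ell1 UNIV" and h: "h \<in> ell1 UNIV" for r :: 's and g h t
  proof (rule additive_zero_on_ell1[where K = "2 * ell1_norm h" and f = g and G = "\<lambda>g. conv (conv (delta r) g) h t - conv (delta r) (conv g h) t", OF _ _ _ g])
    fix f :: "'s \<Rightarrow> complex" assume "f \<in> ell1 UNIV"
    from b[OF delta_ell1 this h, of r t]
    show "cmod (conv (conv (delta r) f) h t - conv (delta r) (conv f h) t) \<le> 2 * ell1_norm h * ell1_norm f"
      by (simp add: delta_norm mult_ac)
  next
    fix c and s :: 's
    show "conv (conv (delta r) (\<lambda>t. c * delta s t)) h t - conv (delta r) (conv (\<lambda>t. c * delta s t) h) t = 0"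
      using 1[OF h, of r s t] by (simp add: lin)
  qed (simp_all add: lin delta_ell1 h)
  have 3: "conv (conv f g) h t - conv f (conv g h) t = 0" for t
  proof (rule additive_zero_on_ell1[where K = "2 * ell1_norm g * ell1_norm h" and f = f and G = "\<lambda>f. conv (conv f g) h t - conv f (conv g h) t", OF _ _ _ f])
    fix f :: "'s \<Rightarrow> complex" assume "f \<in> ell1 UNIV"
    from b[OF this g h, of t]
    show "cmod (conv (conv f g) h t - conv f (conv g h) t) \<le> 2 * ell1_norm g * ell1_norm h * ell1_norm f"
      by (simp add: mult_ac)
  next
    fix c and s :: 's
    show "conv (conv (\<lambda>t. c * delta s t) g) h t - conv (\<lambda>t. c * delta s t) (conv g h) t = 0"
      using 2[OF g h, of s t] by (simp add: lin)
  qed (simp_all add: lin delta_ell1 g h)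
  show ?thesis using 3 by (auto simp: fun_eq_iff)
qed

section \<open>The triangular algebra\<close>

text \<open>Covers \<open>T0\<close>, \<open>frak_T0\<close> and the regular module at once. The
  assumption \<open>limit_mem\<close> is the form of closedness that is easy to check for
  \<open>frak_T0\<close>: equal diagonal entries, zero corner and support in the idempotents are all
  pointwise conditions.\<close>

locale tri_space =
  fixes X :: "('s::semigroup_mult tri, 'm) vspace_scheme"
  assumes vzero: "vzero X = (\<lambda>s. 0, \<lambda>s. 0, \<lambda>s. 0)"
    and vadd: "vadd X (a, m, b) (a', m', b') = (\<lambda>s. a s + a' s, \<lambda>s. m s + m' s, \<lambda>s. b s + b' s)"
    and vscale: "vscale X c (a, m, b) = (\<lambda>s. c * a s, \<lambda>s. c * m s, \<lambda>s. c * b s)"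
    and vnorm: "vnorm X (a, m, b) = ell1_norm a + ell1_norm m + ell1_norm b"
    and carrier_ell1: "carrier X \<subseteq> ell1 UNIV \<times> ell1 UNIV \<times> ell1 UNIV"
    and zero_mem: "(\<lambda>s. 0, \<lambda>s. 0, \<lambda>s. 0) \<in> carrier X"
    and add_mem: "\<lbrakk>x \<in> carrier X; y \<in> carrier X\<rbrakk> \<Longrightarrow> vadd X x y \<in> carrier X"
    and scale_mem: "x \<in> carrier X \<Longrightarrow> vscale X c x \<in> carrier X"
    and limit_mem: "\<lbrakk>\<And>n::nat. (\<alpha> n, \<mu> n, \<beta> n) \<in> carrier X; a \<in> ell1 UNIV; m \<in> ell1 UNIV; b \<in> ell1 UNIV;
        \<And>s. (\<lambda>n. \<alpha> n s) \<longlonglongrightarrow> a s; \<And>s. (\<lambda>n. \<mu> n s) \<longlonglongrightarrow> m s; \<And>s. (\<lambda>n. \<beta> n s) \<longlonglongrightarrow> b s\<rbrakk>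
        \<Longrightarrow> (a, m, b) \<in> carrier X"
begin

lemma vsub: "vsub X (a, m, b) (a', m', b') = (\<lambda>s. a s - a' s, \<lambda>s. m s - m' s, \<lambda>s. b s - b' s)"
  by (simp add: vsub_def vadd vscale)

lemma mem_ell1: "(a, m, b) \<in> carrier X \<Longrightarrow> a \<in> ell1 UNIV \<and> m \<in> ell1 UNIV \<and> b \<in> ell1 UNIV"
  using carrier_ell1 by auto

lemma normed: "normed_vspace X"
proof (unfold_locales, goal_cases)
  case 1 show ?case using zero_mem by (simp add: vzero)
next
  case (2 x y) then show ?case by (rule add_mem)
next
  case (3 x c) then show ?case by (rule scale_mem)
next
  case (4 x y z) show ?case by (cases x; cases y; cases z) (simp add: vadd add.assoc)
next
  case (5 x y) show ?case by (cases x; cases y) (simp add: vadd add.commute)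
next
  case (6 x) show ?case by (cases x) (simp add: vadd vzero)
next
  case (7 x) show ?case by (cases x) (simp add: vsub vzero)
next
  case (8 x y c) show ?case by (cases x; cases y) (simp add: vadd vscale distrib_left)
next
  case (9 x c d) show ?case by (cases x) (simp add: vadd vscale distrib_right)
next
  case (10 x c d) show ?case by (cases x) (simp add: vscale mult.assoc)
next
  case (11 x) show ?case by (cases x) (simp add: vscale)
next
  case (12 x) show ?case by (cases x) (simp add: vnorm)
next
  case (13 x)
  obtain a m b where x: "x = (a, m, b)" by (cases x)
  have e: "a \<in> ell1 UNIV" "m \<in> ell1 UNIV" "b \<in> ell1 UNIV" using mem_ell1 13 x by auto
  have "ell1_norm a + ell1_norm m + ell1_norm b = 0 \<longleftrightarrow> ell1_norm a = 0 \<and> ell1_norm m = 0 \<and> ell1_norm b = 0"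
    using ell1_norm_nonneg[of a] ell1_norm_nonneg[of m] ell1_norm_nonneg[of b] by linarith
  then show ?case by (simp add: x vnorm vzero ell1_norm_eq_zero e)
next
  case (14 x y)
  obtain a m b a' m' b' where x: "x = (a, m, b)" and y: "y = (a', m', b')" by (cases x; cases y)
  have e: "a \<in> ell1 UNIV" "m \<in> ell1 UNIV" "b \<in> ell1 UNIV" "a' \<in> ell1 UNIV" "m' \<in> ell1 UNIV" "b' \<in> ell1 UNIV"
    using mem_ell1 14 x y by auto
  show ?case
    using ell1_add(2)[OF e(1,4)] ell1_add(2)[OF e(2,5)] ell1_add(2)[OF e(3,6)] by (simp add: x y vadd vnorm)
next
  case (15 x c) show ?case by (cases x) (simp add: vscale vnorm ell1_norm_scale distrib_left)
qed

lemma banach: "banach_space X"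
proof -
  interpret normed_vspace X by (rule normed)
  have "cauchy_complete"
    unfolding cauchy_complete_def
  proof (intro allI impI)
    fix \<sigma> :: "nat \<Rightarrow> 's tri"
    assume r: "range \<sigma> \<subseteq> carrier X"
      and c: "\<forall>e>0. \<exists>N. \<forall>m\<ge>N. \<forall>n\<ge>N. vnorm X (vsub X (\<sigma> m) (\<sigma> n)) < e"
    define \<alpha> \<mu> \<beta> where "\<alpha> n = fst (\<sigma> n)" and "\<mu> n = fst (snd (\<sigma> n))" and "\<beta> n = snd (snd (\<sigma> n))" for n
    have s: "\<sigma> n = (\<alpha> n, \<mu> n, \<beta> n)" for n by (simp add: \<alpha>_def \<mu>_def \<beta>_def)
    have mem: "(\<alpha> n, \<mu> n, \<beta> n) \<in> carrier X" for n using r s by (metis range_subsetD)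
    have e: "\<alpha> n \<in> ell1 UNIV" "\<mu> n \<in> ell1 UNIV" "\<beta> n \<in> ell1 UNIV" for n using mem_ell1[OF mem] by auto
    have c3: "\<exists>N. \<forall>m\<ge>N. \<forall>n\<ge>N. ell1_norm (\<lambda>s. \<alpha> m s - \<alpha> n s) < e \<and>
        ell1_norm (\<lambda>s. \<mu> m s - \<mu> n s) < e \<and> ell1_norm (\<lambda>s. \<beta> m s - \<beta> n s) < e" if e: "e > 0" for e
    proof -
      obtain N where N: "\<forall>m\<ge>N. \<forall>n\<ge>N. vnorm X (vsub X (\<sigma> m) (\<sigma> n)) < e" using c e by blast
      have "ell1_norm (\<lambda>s. \<alpha> m s - \<alpha> n s) < e \<and>
        ell1_norm (\<lambda>s. \<mu> m s - \<mu> n s) < e \<and> ell1_norm (\<lambda>s. \<beta> m s - \<beta> n s) < e" if "m \<ge> N" "n \<ge> N" for m n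
      proof -
        have "ell1_norm (\<lambda>s. \<alpha> m s - \<alpha> n s) + ell1_norm (\<lambda>s. \<mu> m s - \<mu> n s) + ell1_norm (\<lambda>s. \<beta> m s - \<beta> n s) < e"
          using N that by (simp add: s vsub vnorm)
        then show ?thesis
          using ell1_norm_nonneg[of "\<lambda>s. \<alpha> m s - \<alpha> n s"] ell1_norm_nonneg[of "\<lambda>s. \<mu> m s - \<mu> n s"]
            ell1_norm_nonneg[of "\<lambda>s. \<beta> m s - \<beta> n s"] by linarith
      qed
      then show ?thesis by blast
    qed
    obtain a where a: "a \<in> ell1 UNIV" "\<And>s. (\<lambda>n. \<alpha> n s) \<longlonglongrightarrow> a s"
      "\<And>e. e > 0 \<Longrightarrow> \<exists>N. \<forall>n\<ge>N. ell1_norm (\<lambda>s. \<alpha> n s - a s) < e"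
      by (rule ell1_complete[of \<alpha>, OF e(1)]) (use c3 in meson)+
    obtain m where m: "m \<in> ell1 UNIV" "\<And>s. (\<lambda>n. \<mu> n s) \<longlonglongrightarrow> m s"
      "\<And>e. e > 0 \<Longrightarrow> \<exists>N. \<forall>n\<ge>N. ell1_norm (\<lambda>s. \<mu> n s - m s) < e"
      by (rule ell1_complete[of \<mu>, OF e(2)]) (use c3 in meson)+
    obtain b where b: "b \<in> ell1 UNIV" "\<And>s. (\<lambda>n. \<beta> n s) \<longlonglongrightarrow> b s"
      "\<And>e. e > 0 \<Longrightarrow> \<exists>N. \<forall>n\<ge>N. ell1_norm (\<lambda>s. \<beta> n s - b s) < e"
      by (rule ell1_complete[of \<beta>, OF e(3)]) (use c3 in meson)+
    have "(a, m, b) \<in> carrier X" by (rule limit_mem[OF mem a(1) m(1) b(1) a(2) m(2) b(2)])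
    moreover have "\<exists>N. \<forall>n\<ge>N. vnorm X (vsub X (\<sigma> n) (a, m, b)) < e" if e: "e > 0" for e
    proof -
      have e3: "e / 3 > 0" using e by simp
      obtain N1 where 1: "\<forall>n\<ge>N1. ell1_norm (\<lambda>s. \<alpha> n s - a s) < e / 3" using a(3)[OF e3] by blast
      obtain N2 where 2: "\<forall>n\<ge>N2. ell1_norm (\<lambda>s. \<mu> n s - m s) < e / 3" using m(3)[OF e3] by blast
      obtain N3 where 3: "\<forall>n\<ge>N3. ell1_norm (\<lambda>s. \<beta> n s - b s) < e / 3" using b(3)[OF e3] by blast
      have "vnorm X (vsub X (\<sigma> n) (a, m, b)) < e" if "n \<ge> max N1 (max N2 N3)" for n
      proof -
        have "ell1_norm (\<lambda>s. \<alpha> n s - a s) < e / 3" "ell1_norm (\<lambda>s. \<mu> n s - m s) < e / 3"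
          "ell1_norm (\<lambda>s. \<beta> n s - b s) < e / 3" using 1 2 3 that by simp_all
        then show ?thesis by (simp add: s vsub vnorm)
      qed
      then show ?thesis by blast
    qed
    ultimately show "\<exists>l\<in>carrier X. \<forall>e>0. \<exists>N. \<forall>n\<ge>N. vnorm X (vsub X (\<sigma> n) l) < e" by blast
  qed
  with normed show ?thesis by (simp add: banach_space_iff)
qed

end

section \<open>The concrete matrix algebras\<close>

lemma tri_on_simps [simp]:
  "carrier (tri_on C) = C"
  "vzero (tri_on C) = (\<lambda>s. 0, \<lambda>s. 0, \<lambda>s. 0)"
  "vadd (tri_on C) (a, m, b) (a', m', b') = (\<lambda>s. a s + a' s, \<lambda>s. m s + m' s, \<lambda>s. b s + b' s)"
  "vscale (tri_on C) c (a, m, b) = (\<lambda>s. c * a s, \<lambda>s. c * m s, \<lambda>s. c * b s)"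
  "vnorm (tri_on C) (a, m, b) = ell1_norm a + ell1_norm m + ell1_norm b"
  "amult (tri_on C) (a, m, b) (a', m', b') = (conv a a', \<lambda>s. conv a m' s + conv m b' s, conv b b')"
  by (simp_all add: tri_on_def)

lemma T0_simps [simp]:
  "carrier T0 = ell1 UNIV \<times> ell1 UNIV \<times> ell1 UNIV"
  "vzero T0 = (\<lambda>s. 0, \<lambda>s. 0, \<lambda>s. 0)"
  "vadd T0 (a, m, b) (a', m', b') = (\<lambda>s. a s + a' s, \<lambda>s. m s + m' s, \<lambda>s. b s + b' s)"
  "vscale T0 c (a, m, b) = (\<lambda>s. c * a s, \<lambda>s. c * m s, \<lambda>s. c * b s)"
  "vnorm T0 (a, m, b) = ell1_norm a + ell1_norm m + ell1_norm b"
  "amult T0 (a, m, b) (a', m', b') = (conv a a', \<lambda>s. conv a m' s + conv m b' s, conv b b')"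
  "aleft T0 (\<alpha>, \<mu>, \<beta>) (a, m, b) = (conv \<alpha> a, conv \<alpha> m, conv \<alpha> b)"
  "aright T0 (a, m, b) (\<alpha>, \<mu>, \<beta>) = (conv a \<alpha>, conv m \<alpha>, conv b \<alpha>)"
  by (simp_all add: T0_def alg.extend_def tri_on_def E_left_def E_right_def)

lemma carrier_frak_T0: "carrier frak_T0 = {(\<alpha>, \<lambda>s. 0, \<alpha>) |\<alpha>. \<alpha> \<in> ell1 idempotents}"
  by (simp add: frak_T0_def)

lemma frak_T0_cases:
  assumes "x \<in> carrier frak_T0"
  obtains \<alpha> where "x = (\<alpha>, \<lambda>s. 0, \<alpha>)" "\<alpha> \<in> ell1 idempotents" "\<alpha> \<in> ell1 UNIV"
  using assms ell1_subset by (auto simp: carrier_frak_T0)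

lemma frak_T0_memI: "\<alpha> \<in> ell1 idempotents \<Longrightarrow> (\<alpha>, \<lambda>s. 0, \<alpha>) \<in> carrier frak_T0"
  by (auto simp: carrier_frak_T0)

lemma frak_T0_simps [simp]:
  "vzero frak_T0 = (\<lambda>s. 0, \<lambda>s. 0, \<lambda>s. 0)"
  "vadd frak_T0 (a, m, b) (a', m', b') = (\<lambda>s. a s + a' s, \<lambda>s. m s + m' s, \<lambda>s. b s + b' s)"
  "vscale frak_T0 c (a, m, b) = (\<lambda>s. c * a s, \<lambda>s. c * m s, \<lambda>s. c * b s)"
  "vnorm frak_T0 (a, m, b) = ell1_norm a + ell1_norm m + ell1_norm b"
  "amult frak_T0 (a, m, b) (a', m', b') = (conv a a', \<lambda>s. conv a m' s + conv m b' s, conv b b')"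
  by (simp_all add: frak_T0_def)

interpretation T0: tri_space "T0 :: ('s::semigroup_mult tri, 's tri) modalg"
  by unfold_locales (auto simp: ell1_add ell1_scale)

interpretation frak_T0: tri_space "frak_T0 :: 's::semigroup_mult tri alg"
proof
  fix \<alpha> \<mu> \<beta> :: "nat \<Rightarrow> 's \<Rightarrow> complex" and a m b
  assume mem: "\<And>n. (\<alpha> n, \<mu> n, \<beta> n) \<in> carrier frak_T0"
    and e: "a \<in> ell1 UNIV" "m \<in> ell1 UNIV" "b \<in> ell1 UNIV"
    and l: "\<And>s. (\<lambda>n. \<alpha> n s) \<longlonglongrightarrow> a s" "\<And>s. (\<lambda>n. \<mu> n s) \<longlonglongrightarrow> m s" "\<And>s. (\<lambda>n. \<beta> n s) \<longlonglongrightarrow> b s"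
  have \<alpha>: "\<mu> n s = 0" "\<beta> n = \<alpha> n" "\<alpha> n \<in> ell1 idempotents" for n s
    using mem[of n] by (auto simp: carrier_frak_T0)
  have "m s = 0" for s using l(2)[of s] LIMSEQ_unique[OF _ tendsto_const] by (simp add: \<alpha>(1))
  moreover have "b s = a s" for s using l(1,3)[of s] by (simp add: \<alpha>(2) LIMSEQ_unique)
  moreover have "a s = 0" if "s \<notin> idempotents" for s
  proof -
    have "\<alpha> n s = 0" for n using \<alpha>(3)[of n] that by (simp add: ell1_def)
    then show ?thesis using l(1)[of s] LIMSEQ_unique[OF _ tendsto_const] by simp
  qed
  ultimately show "(a, m, b) \<in> carrier frak_T0"
    using e(1) by (auto simp: carrier_frak_T0 ell1_def fun_eq_iff)
qed (auto simp: carrier_frak_T0 ell1_add ell1_scale intro: ell1_subset)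

lemma conv_ell1_idempotents:
  fixes f :: "'s::ab_semigroup_mult \<Rightarrow> complex"
  assumes inv: "inverse_semigroup TYPE('s)" and f: "f \<in> ell1 idempotents" and g: "g \<in> ell1 idempotents"
  shows "conv f g \<in> ell1 idempotents"
proof -
  have "conv f g t = 0" if "t \<notin> idempotents" for t
  proof -
    have "(\<Sum>\<^sub>\<infinity>p\<in>{(r, s). r * s = t}. case p of (r, s) \<Rightarrow> f r * g s) = (\<Sum>\<^sub>\<infinity>p\<in>{(r, s). r * s = t}. 0)"
    proof (rule infsum_cong)
      fix p assume "p \<in> {(r, s). r * s = t}"
      then have "fst p \<notin> idempotents \<or> snd p \<notin> idempotents"
        using that idempotents_mult[OF inv, of "fst p" "snd p"] by auto
      then show "(case p of (r, s) \<Rightarrow> f r * g s) = 0"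
        using f g by (cases p) (auto simp: ell1_def)
    qed
    then show ?thesis by (simp add: conv_def)
  qed
  then show ?thesis
    using conv_ell1(1)[OF ell1_subset[OF f] ell1_subset[OF g]] by (auto simp: ell1_def)
qed

section \<open>The triangular algebra as a Banach module algebra\<close>

lemma bounded_bilinear_mapI:
  assumes "\<And>x y. \<lbrakk>x \<in> carrier X; y \<in> carrier Y\<rbrakk> \<Longrightarrow> b x y \<in> carrier Z"
    and "\<And>x y y'. \<lbrakk>x \<in> carrier X; y \<in> carrier Y; y' \<in> carrier Y\<rbrakk> \<Longrightarrow> b x (vadd Y y y') = vadd Z (b x y) (b x y')"
    and "\<And>x x' y. \<lbrakk>x \<in> carrier X; x' \<in> carrier X; y \<in> carrier Y\<rbrakk> \<Longrightarrow> b (vadd X x x') y = vadd Z (b x y) (b x' y)"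
    and "\<And>c x y. \<lbrakk>x \<in> carrier X; y \<in> carrier Y\<rbrakk> \<Longrightarrow> b x (vscale Y c y) = vscale Z c (b x y)"
    and "\<And>c x y. \<lbrakk>x \<in> carrier X; y \<in> carrier Y\<rbrakk> \<Longrightarrow> b (vscale X c x) y = vscale Z c (b x y)"
    and "\<And>x y. \<lbrakk>x \<in> carrier X; y \<in> carrier Y\<rbrakk> \<Longrightarrow> vnorm Z (b x y) \<le> M * vnorm X x * vnorm Y y"
  shows "bounded_bilinear_map X Y Z b"
  using assms(1-5) assms(6) unfolding bounded_bilinear_map_def linear_map_def
  by (intro conjI ballI allI exI[of _ M]) simp_all

lemma T0_norm_mult:
  fixes x y :: "'s::semigroup_mult tri"
  assumes "x \<in> carrier T0" "y \<in> carrier T0"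
  shows "vnorm T0 (amult T0 x y) \<le> vnorm T0 x * vnorm T0 y"
proof -
  obtain a m b a' m' b' where x: "x = (a, m, b)" and y: "y = (a', m', b')" by (cases x; cases y)
  have e: "a \<in> ell1 UNIV" "m \<in> ell1 UNIV" "b \<in> ell1 UNIV" "a' \<in> ell1 UNIV" "m' \<in> ell1 UNIV" "b' \<in> ell1 UNIV"
    using assms by (auto simp: x y)
  have "vnorm T0 (amult T0 x y) \<le> ell1_norm (conv a a') + (ell1_norm (conv a m') + ell1_norm (conv m b')) + ell1_norm (conv b b')"
    using ell1_add(2)[OF conv_ell1(1)[OF e(1,5)] conv_ell1(1)[OF e(2,6)]] by (simp add: x y)
  also have "\<dots> \<le> ell1_norm a * ell1_norm a' + (ell1_norm a * ell1_norm m' + ell1_norm m * ell1_norm b') + ell1_norm b * ell1_norm b'"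
    using conv_ell1(2)[OF e(1,4)] conv_ell1(2)[OF e(1,5)] conv_ell1(2)[OF e(2,6)] conv_ell1(2)[OF e(3,6)] by linarith
  also have "\<dots> \<le> vnorm T0 x * vnorm T0 y"
    unfolding x y T0_simps by (simp add: algebra_simps)
  finally show ?thesis .
qed

lemma T0_bilinear: "bounded_bilinear_map T0 T0 T0 (amult (T0 :: ('s::ab_semigroup_mult tri, 's tri) modalg))"
  by (rule bounded_bilinear_mapI[where M = 1])
    (auto simp: conv_ell1 ell1_add conv_add_left conv_add_right conv_scale_left conv_scale_right fun_eq_iff algebra_simps
      simp del: T0_simps(5) intro: order_trans[OF T0_norm_mult])

lemma T0_assoc:
  fixes x y z :: "'s::ab_semigroup_mult tri"
  assumes "x \<in> carrier T0" "y \<in> carrier T0" "z \<in> carrier T0"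
  shows "amult T0 (amult T0 x y) z = amult T0 x (amult T0 y z)"
  using assms by (cases x; cases y; cases z)
    (simp add: conv_ell1 ell1_add conv_add_left conv_add_right conv_assoc add.assoc)

lemma banach_algebra_T0: "banach_algebra (T0 :: ('s::ab_semigroup_mult tri, 's tri) modalg)"
  by (intro banach_algebra.intro banach_algebra_axioms.intro T0.banach T0_bilinear T0_assoc T0_norm_mult)

lemma frak_T0_subset: "x \<in> carrier (frak_T0 :: 's::semigroup_mult tri alg) \<Longrightarrow> x \<in> carrier (T0 :: ('s tri, 's tri) modalg)"
  by (auto elim: frak_T0_cases)

lemma frak_T0_ops:
  fixes x y :: "'s::semigroup_mult tri"
  shows "vadd frak_T0 x y = vadd T0 x y" "vscale frak_T0 c x = vscale T0 c x" "amult frak_T0 x y = amult T0 x y"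
    "vnorm frak_T0 x = vnorm T0 x"
  by (cases x; cases y; simp)+

text \<open>The scalars act by multiplication with central matrices, so every compatibility axiom
  reduces to associativity in \<open>T0\<close>.\<close>

lemma frak_T0_acts:
  fixes t :: "'s::ab_semigroup_mult tri"
  assumes "x \<in> carrier frak_T0"
  shows "aleft T0 x t = amult T0 x t" "aright T0 t x = amult T0 t x" "amult T0 t x = amult T0 x t"
  using assms by (cases t; auto elim!: frak_T0_cases simp: conv_commute)+

lemma frak_T0_mult_closed:
  fixes x y :: "'s::ab_semigroup_mult tri"
  assumes "inverse_semigroup TYPE('s)" "x \<in> carrier frak_T0" "y \<in> carrier frak_T0"
  shows "amult frak_T0 x y \<in> carrier frak_T0"
  by (rule frak_T0_cases[OF assms(2)], rule frak_T0_cases[OF assms(3)])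
    (auto simp: carrier_frak_T0 conv_ell1_idempotents[OF assms(1)])

lemma banach_algebra_frak_T0:
  assumes inv: "inverse_semigroup TYPE('s::ab_semigroup_mult)"
  shows "banach_algebra (frak_T0 :: 's tri alg)"
proof (intro banach_algebra.intro banach_algebra_axioms.intro frak_T0.banach)
  note T = bounded_bilinear_mapD[OF T0_bilinear]
  show "bounded_bilinear_map frak_T0 frak_T0 frak_T0 (amult (frak_T0 :: 's tri alg))"
    by (rule bounded_bilinear_mapI[where M = 1])
      (simp_all add: frak_T0_mult_closed[OF inv, unfolded frak_T0_ops] frak_T0_ops frak_T0_subset T0_norm_mult
        linear_mapD(2,3)[OF T(1)] linear_mapD(2,3)[OF T(2)] del: T0_simps)
  show "amult frak_T0 (amult frak_T0 a b) c = amult frak_T0 a (amult frak_T0 b c)"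
    if "a \<in> carrier frak_T0" "b \<in> carrier frak_T0" "c \<in> carrier frak_T0" for a b c :: "'s tri"
    using that by (simp add: frak_T0_ops frak_T0_subset T0_assoc del: T0_simps)
  show "vnorm frak_T0 (amult frak_T0 a b) \<le> vnorm frak_T0 a * vnorm frak_T0 b"
    if "a \<in> carrier frak_T0" "b \<in> carrier frak_T0" for a b :: "'s tri"
    using that by (simp add: frak_T0_ops frak_T0_subset T0_norm_mult del: T0_simps)
qed

lemma banach_bimodule_frak_T0:
  assumes inv: "inverse_semigroup TYPE('s::ab_semigroup_mult)"
  shows "banach_bimodule (frak_T0 :: 's tri alg) T0 (aleft T0) (aright T0)"
  unfolding banach_bimodule_def
proof (intro conjI ballI)
  note T = bounded_bilinear_mapD[OF T0_bilinear]
  note L = linear_mapD(2,3)[OF T(1)] linear_mapD(2,3)[OF T(2)]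
  show "bounded_bilinear_map (frak_T0 :: 's tri alg) T0 T0 (aleft T0)"
    by (rule bounded_bilinear_mapI[where M = 1])
      (simp_all add: frak_T0_acts(1) frak_T0.add_mem[unfolded frak_T0_ops] frak_T0.scale_mem[unfolded frak_T0_ops]
        frak_T0_ops frak_T0_subset T0_norm_mult L T(3) del: T0_simps)
  show "bounded_bilinear_map T0 (frak_T0 :: 's tri alg) T0 (aright T0)"
    by (rule bounded_bilinear_mapI[where M = 1])
      (simp_all add: frak_T0_acts(2) frak_T0.add_mem[unfolded frak_T0_ops] frak_T0.scale_mem[unfolded frak_T0_ops]
        frak_T0_ops frak_T0_subset T0_norm_mult L T(3) del: T0_simps)
  fix a b x :: "'s tri"
  assume "a \<in> carrier frak_T0" "b \<in> carrier frak_T0" "x \<in> carrier T0"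
  then show "aleft T0 (amult frak_T0 a b) x = aleft T0 a (aleft T0 b x)"
    "aright T0 x (amult frak_T0 a b) = aright T0 (aright T0 x a) b"
    "aright T0 (aleft T0 a x) b = aleft T0 a (aright T0 x b)"
    using frak_T0_mult_closed[OF inv, of a b]
    by (simp_all add: frak_T0_acts(1,2) frak_T0_ops frak_T0_subset T0_assoc del: T0_simps)
qed (rule banach_algebra_frak_T0[OF inv] T0.banach)+

lemma banach_module_algebra_T0:
  assumes inv: "inverse_semigroup TYPE('s::ab_semigroup_mult)"
  shows "banach_module_algebra (frak_T0 :: 's tri alg) (T0 :: ('s tri, 's tri) modalg)"
  unfolding banach_module_algebra_def
  by (intro conjI ballI banach_algebra_T0 banach_bimodule_frak_T0[OF inv])
    (simp_all add: frak_T0_acts(1,2) frak_T0_subset T0_assoc del: T0_simps)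

text \<open>A generator compares two bracketings of a product in \<open>T0\<close>, so associativity
  makes it zero and the zero ideal takes part in the intersection.\<close>

lemma module_ideal_T0:
  "module_ideal frak_T0 (T0 :: ('s::ab_semigroup_mult tri, 's tri) modalg) = {vzero T0}"
proof -
  interpret N: normed_vspace "T0 :: ('s tri, 's tri) modalg" by (rule T0.normed)
  have gen: "vsub T0 (amult T0 (aright T0 a \<alpha>) b) (amult T0 a (aleft T0 \<alpha> b)) = vzero T0"
    if "\<alpha> \<in> carrier frak_T0" "a \<in> carrier T0" "b \<in> carrier T0" for \<alpha> a b :: "'s tri"
    using that N.sub_self[of "amult T0 (amult T0 a \<alpha>) b"]
    by (simp add: frak_T0_acts(1,2) frak_T0_subset T0_assoc bounded_bilinear_mapD(3)[OF T0_bilinear] del: T0_simps)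
  have mult0: "amult T0 a (vzero T0) = vzero T0" "amult T0 (vzero T0) a = vzero T0" for a :: "'s tri"
    by (cases a; simp)+
  have "closed_ideal T0 {vzero T0 :: 's tri}"
    unfolding closed_ideal_def using N.zero_closed N.closedin_zero
    by (simp add: mult0 N.add_zero)
  with gen have "module_ideal frak_T0 T0 \<subseteq> {vzero T0 :: 's tri}"
    unfolding module_ideal_def by (intro Inter_lower CollectI conjI ballI) simp_all
  moreover have "{vzero T0 :: 's tri} \<subseteq> module_ideal frak_T0 T0"
    unfolding module_ideal_def by (intro Inter_greatest) (simp add: closed_ideal_def)
  ultimately show ?thesis by blast
qed

text \<open>The algebra as a bimodule record over itself. It replaces the quotient by the zero
  ideal, whose elements are singleton cosets, as the start of the dual sequence.\<close>

definition regular_module :: "('a, 'r, 'm) modalg_scheme \<Rightarrow> ('a, 'a, 'r) bimod" where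
  "regular_module A = \<lparr>carrier = carrier A, vzero = vzero A, vadd = vadd A, vscale = vscale A, vnorm = vnorm A,
     lact = amult A, ract = amult A, lscal = aleft A, rscal = aright A\<rparr>"

lemma regular_module_simps [simp]:
  "carrier (regular_module A) = carrier A" "vzero (regular_module A) = vzero A"
  "vadd (regular_module A) = vadd A" "vscale (regular_module A) = vscale A" "vnorm (regular_module A) = vnorm A"
  "lact (regular_module A) = amult A" "ract (regular_module A) = amult A"
  "lscal (regular_module A) = aleft A" "rscal (regular_module A) = aright A"
  by (simp_all add: regular_module_def)

interpretation R: tri_space "regular_module (T0 :: ('s::semigroup_mult tri, 's tri) modalg)"
  by unfold_locales (auto simp: ell1_add ell1_scale)

lemma commutative_banach_module_T0:
  assumes inv: "inverse_semigroup TYPE('s::ab_semigroup_mult)"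
  shows "commutative_banach_module (frak_T0 :: 's tri alg) T0 (regular_module (T0 :: ('s tri, 's tri) modalg))"
proof -
  have b: "bounded_bilinear_map B (regular_module (T0 :: ('s tri, 's tri) modalg)) (regular_module T0) f
      \<longleftrightarrow> bounded_bilinear_map B (T0 :: ('s tri, 's tri) modalg) T0 f"
    "bounded_bilinear_map (regular_module (T0 :: ('s tri, 's tri) modalg)) B (regular_module T0) g
      \<longleftrightarrow> bounded_bilinear_map (T0 :: ('s tri, 's tri) modalg) B T0 g"
    for B :: "('b, 'c) vspace_scheme" and f g
    by (simp_all add: bounded_bilinear_map_def linear_map_def)
  have bm: "banach_bimodule B (regular_module (T0 :: ('s tri, 's tri) modalg)) l r"
    if "banach_bimodule B (T0 :: ('s tri, 's tri) modalg) l r" for B :: "('b, 'c) alg_scheme" and l r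
    using that R.banach unfolding banach_bimodule_def b by simp
  have "banach_bimodule T0 T0 (amult T0) (amult (T0 :: ('s tri, 's tri) modalg))"
    unfolding banach_bimodule_def
    by (intro conjI ballI banach_algebra_T0 T0.banach T0_bilinear) (simp_all add: T0_assoc del: T0_simps)
  note 1 = bm[OF this] bm[OF banach_bimodule_frak_T0[OF inv]]
  show ?thesis
    unfolding commutative_banach_module_def banach_module_def using 1
    by (simp add: frak_T0_acts(1,2) frak_T0_subset T0_assoc del: T0_simps) (simp add: frak_T0_acts(3))
qed

lemma quotient_zero_isometry:
  "module_isometry frak_T0 T0 (regular_module T0)
     (quotient_module T0 {vzero T0 :: 's::semigroup_mult tri}) (\<lambda>x. {x})"
proof -
  have c: "coset T0 {vzero T0} x = {x}" for x :: "'s tri"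
    by (cases x) (simp add: coset_def)
  show ?thesis
    unfolding module_isometry_def linear_map_def quotient_module_def
    by (auto simp: c bij_betw_def inj_on_def simp del: T0_simps)
qed

section \<open>Matrix coordinates on the iterated duals\<close>

text \<open>Embeds the convolution algebra of all of \<open>S\<close>, not just of the idempotents;
  through it every iterated dual becomes a module over that algebra.\<close>

definition diag :: "('s \<Rightarrow> complex) \<Rightarrow> 's tri" where
  "diag a = (a, \<lambda>s. 0, a)"

text \<open>The general shape of a one-sided action on three coordinates: the upper left entry acts
  on coordinate 0, the lower right one on coordinate 2, \<open>p\<close> decides which of the two
  acts on coordinate 1, and the corner entry carries coordinate \<open>k\<close> to coordinate
  \<open>j\<close>.\<close>

definition tri_act :: "('u, 's tri, 's tri) bimod \<Rightarrow> (nat \<Rightarrow> nat \<Rightarrow> 'u \<Rightarrow> 'u) \<Rightarrow> bool \<Rightarrow> nat \<Rightarrow> nat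
    \<Rightarrow> 's tri \<Rightarrow> 'u \<Rightarrow> 'u" where
  "tri_act Z \<epsilon> p j k = (\<lambda>(a, m, b) z.
     vadd Z (vadd Z (lact Z (diag a) (\<epsilon> 0 0 z)) (lact Z (diag (if p then a else b)) (\<epsilon> 1 1 z)))
       (vadd Z (lact Z (diag b) (\<epsilon> 2 2 z)) (lact Z (diag m) (\<epsilon> j k z))))"

text \<open>As an \<open>\<ell>\<^sup>1(S)\<close>-module, each iterated dual is a threefold sum of the corresponding dual of
  \<open>\<ell>\<^sup>1(S)\<close>; \<open>\<epsilon> i l\<close> are the matrix units of this decomposition. The parameters record the shape of
  the two actions: dualising transposes the matrix units and exchanges left and right.\<close>

locale matrix_coords =
  fixes Z :: "('u, 's::ab_semigroup_mult tri, 's tri) bimod" and \<epsilon> :: "nat \<Rightarrow> nat \<Rightarrow> 'u \<Rightarrow> 'u"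
    and p :: bool and j k :: nat and q :: bool and j' k' :: nat
  assumes idx: "j < 3" "k < 3" "j' < 3" "k' < 3"
    and lin: "\<lbrakk>i < 3; l < 3\<rbrakk> \<Longrightarrow> linear_map Z Z (\<epsilon> i l)"
    and bound: "\<lbrakk>i < 3; l < 3\<rbrakk> \<Longrightarrow> \<exists>M. \<forall>z\<in>carrier Z. vnorm Z (\<epsilon> i l z) \<le> M * vnorm Z z"
    and mult: "\<lbrakk>i < 3; l < 3; i' < 3; l' < 3; z \<in> carrier Z\<rbrakk>
      \<Longrightarrow> \<epsilon> i l (\<epsilon> i' l' z) = (if l = i' then \<epsilon> i l' z else vzero Z)"
    and unit: "z \<in> carrier Z \<Longrightarrow> vadd Z (vadd Z (\<epsilon> 0 0 z) (\<epsilon> 1 1 z)) (\<epsilon> 2 2 z) = z"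
    and comm: "\<lbrakk>i < 3; l < 3; a \<in> ell1 UNIV; z \<in> carrier Z\<rbrakk>
      \<Longrightarrow> \<epsilon> i l (lact Z (diag a) z) = lact Z (diag a) (\<epsilon> i l z)"
    and sym: "\<lbrakk>a \<in> ell1 UNIV; z \<in> carrier Z\<rbrakk> \<Longrightarrow> ract Z z (diag a) = lact Z (diag a) z"
    and left: "\<lbrakk>t \<in> carrier T0; z \<in> carrier Z\<rbrakk> \<Longrightarrow> lact Z t z = tri_act Z \<epsilon> p j k t z"
    and right: "\<lbrakk>t \<in> carrier T0; z \<in> carrier Z\<rbrakk> \<Longrightarrow> ract Z z t = tri_act Z \<epsilon> q j' k' t z"

lemma diag_mem: "a \<in> ell1 UNIV \<Longrightarrow> diag a \<in> carrier T0"
  by (simp add: diag_def)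

text \<open>The matrix units are conjugated by \<open>h\<close>. The inverse is taken relative to
  the carrier, since \<open>h\<close> need be injective only there.\<close>

lemma matrix_coords_isometry:
  fixes Z :: "('z, 's::ab_semigroup_mult tri, 's tri) bimod" and Y :: "('y, 's tri, 's tri) bimod"
  assumes mc: "matrix_coords Z \<epsilon> p j k q j' k'"
    and iso: "module_isometry frak_T0 T0 Z Y h"
    and Z: "banach_module frak_T0 T0 Z"
  shows "matrix_coords Y (\<lambda>i l y. h (\<epsilon> i l (inv_into (carrier Z) h y))) p j k q j' k'"
proof -
  interpret matrix_coords Z \<epsilon> p j k q j' k' by (rule mc)
  interpret Z: normed_bimod Z using Z by (rule normed_bimod_if_banach_module)
  note I = module_isometryD[OF iso]
  note L = linear_mapD[OF I(2)]
  have im: "carrier Y = h ` carrier Z" using I(1) by (simp add: bij_betw_def)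
  have inv: "inv_into (carrier Z) h (h z) = z" if "z \<in> carrier Z" for z
    using I(1) that by (simp add: bij_betw_def)
  note el = linear_mapD[OF lin]
  note cl = banach_module_closed(1)[OF Z _ diag_mem]
  have tri: "tri_act Y (\<lambda>i l y. h (\<epsilon> i l (inv_into (carrier Z) h y))) p j k t (h z) = h (tri_act Z \<epsilon> p j k t z)"
    if "t \<in> carrier T0" "z \<in> carrier Z" "j < 3" "k < 3" for t z p j k
    using that by (cases t)
      (auto simp: tri_act_def inv I(5)[OF diag_mem, symmetric] L(2)[symmetric] Z.add_closed el(1) cl)
  show ?thesis
  proof
    fix i l :: nat assume il: "i < 3" "l < 3"
    show "linear_map Y Y (\<lambda>y. h (\<epsilon> i l (inv_into (carrier Z) h y)))"
      unfolding linear_map_def im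
      by (simp add: inv L(2,3)[symmetric] Z.add_closed Z.scale_closed el il)
    show "\<exists>M. \<forall>z\<in>carrier Y. vnorm Y (h (\<epsilon> i l (inv_into (carrier Z) h z))) \<le> M * vnorm Y z"
      using bound[OF il] unfolding im by (simp add: inv I(4) el il)
    fix a :: "'s \<Rightarrow> complex" and y assume "a \<in> ell1 UNIV" "y \<in> carrier Y"
    then show "h (\<epsilon> i l (inv_into (carrier Z) h (lact Y (diag a) y))) =
        lact Y (diag a) (h (\<epsilon> i l (inv_into (carrier Z) h y)))"
      unfolding im by (auto simp: inv I(5)[OF diag_mem, symmetric] cl comm il el)
  next
    fix i l i' l' :: nat and y
    assume "i < 3" "l < 3" "i' < 3" "l' < 3" "y \<in> carrier Y"
    then show "h (\<epsilon> i l (inv_into (carrier Z) h (h (\<epsilon> i' l' (inv_into (carrier Z) h y)))))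
        = (if l = i' then h (\<epsilon> i l' (inv_into (carrier Z) h y)) else vzero Y)"
      unfolding im by (auto simp: inv el(1) mult I(3))
  next
    fix y assume "y \<in> carrier Y"
    then show "vadd Y (vadd Y (h (\<epsilon> 0 0 (inv_into (carrier Z) h y))) (h (\<epsilon> 1 1 (inv_into (carrier Z) h y))))
        (h (\<epsilon> 2 2 (inv_into (carrier Z) h y))) = y"
      unfolding im by (auto simp: inv L(2)[symmetric] Z.add_closed el(1) unit[simplified])
  next
    fix a :: "'s \<Rightarrow> complex" and y assume "a \<in> ell1 UNIV" "y \<in> carrier Y"
    then show "ract Y y (diag a) = lact Y (diag a) y"
      unfolding im by (auto simp: I(5,6)[OF diag_mem, symmetric] sym)
  next
    fix t :: "'s tri" and y assume t: "t \<in> carrier T0" "y \<in> carrier Y"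
    then obtain z where z: "z \<in> carrier Z" "y = h z" unfolding im by blast
    show "lact Y t y = tri_act Y (\<lambda>i l y. h (\<epsilon> i l (inv_into (carrier Z) h y))) p j k t y"
      using tri[OF t(1) z(1) idx(1,2)] I(5)[OF t(1) z(1)] left[OF t(1) z(1)] z(2) by simp
    show "ract Y y t = tri_act Y (\<lambda>i l y. h (\<epsilon> i l (inv_into (carrier Z) h y))) q j' k' t y"
      using tri[OF t(1) z(1) idx(3,4)] I(6)[OF t(1) z(1)] right[OF t(1) z(1)] z(2) by simp
  qed (use idx in simp_all)
qed

lemma matrix_coords_dual:
  fixes Z :: "('z, 's::ab_semigroup_mult tri, 's tri) bimod"
  assumes mc: "matrix_coords Z \<epsilon> p j k q j' k'" and Z: "banach_module frak_T0 T0 Z"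
  shows "matrix_coords (dual_module Z) (\<lambda>i l f z. if z \<in> carrier Z then f (\<epsilon> l i z) else 0) q k' j' p k j"
proof -
  interpret matrix_coords Z \<epsilon> p j k q j' k' by (rule mc)
  interpret Z: normed_bimod Z using Z by (rule normed_bimod_if_banach_module)
  note el = linear_mapD[OF lin]
  note cl = banach_module_closed(1)[OF Z _ diag_mem]
  let ?t = "\<lambda>i l f z. if z \<in> carrier Z then f (\<epsilon> l i z) else 0"
  have add: "f (vadd Z x y) = f x + f y" if "f \<in> carrier (dual_module Z)" "x \<in> carrier Z" "y \<in> carrier Z" for f x y
    using that bounded_functionalD(1)[of Z f] by (simp add: mem_dual)
  have zero: "f (vzero Z) = 0" if "f \<in> carrier (dual_module Z)" for f
    using that Z.functional_zero by (simp add: mem_dual)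
  have out: "f z = 0" if "f \<in> carrier (dual_module Z)" "z \<notin> carrier Z" for f z
    using that by (simp add: mem_dual)
  \<comment> \<open>A sum of four terms is transposed term by term: \<open>comm\<close> moves the
    diagonal action past the matrix unit, and \<open>sym\<close> turns it into a right action, which
    the dual reads as a left one.\<close>
  have tri: "f (tri_act Z \<epsilon> p j k t z) = tri_act (dual_module Z) ?t p k j t f z"
    if "f \<in> carrier (dual_module Z)" "t \<in> carrier T0" "z \<in> carrier Z" "j < 3" "k < 3" for f t z p j k
    using that by (cases t) (auto simp: tri_act_def add Z.add_closed el(1) cl sym comm)
  have mem: "?t i l f \<in> carrier (dual_module Z)" if il: "i < 3" "l < 3" and f: "f \<in> carrier (dual_module Z)" for i l f
  proof -
    obtain M where M: "\<forall>z\<in>carrier Z. vnorm Z (\<epsilon> l i z) \<le> M * vnorm Z z" using bound[OF il(2,1)] by blast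
    have "bounded_functional Z (\<lambda>z. f (\<epsilon> l i z))"
      by (rule Z.bounded_functional_comp[where N = M]) (use il f lin M in \<open>auto simp: mem_dual\<close>)
    then show ?thesis by (rule Z.functional_restrict_mem)
  qed
  show ?thesis
  proof
    fix i l :: nat assume il: "i < 3" "l < 3"
    show "linear_map (dual_module Z) (dual_module Z) (?t i l)"
      unfolding linear_map_def using mem[OF il] by (auto simp: fun_eq_iff)
    obtain M where M: "\<forall>z\<in>carrier Z. vnorm Z (\<epsilon> l i z) \<le> M * vnorm Z z" using bound[OF il(2,1)] by blast
    have "vnorm (dual_module Z) (?t i l f) \<le> \<bar>M\<bar> * vnorm (dual_module Z) f" if f: "f \<in> carrier (dual_module Z)" for f
    proof (rule Z.dual_norm_le)
      fix z assume z: "z \<in> carrier Z"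
      have "cmod (f (\<epsilon> l i z)) \<le> vnorm (dual_module Z) f * vnorm Z (\<epsilon> l i z)"
        by (rule Z.dual_bound[OF f]) (use z il el in simp)
      also have "\<dots> \<le> vnorm (dual_module Z) f * (\<bar>M\<bar> * vnorm Z z)"
      proof (rule mult_left_mono[OF _ Z.dual_norm_nonneg[OF f]])
        have "M * vnorm Z z \<le> \<bar>M\<bar> * vnorm Z z" using Z.norm_nonneg[OF z] by (intro mult_right_mono) auto
        then show "vnorm Z (\<epsilon> l i z) \<le> \<bar>M\<bar> * vnorm Z z" using M z by fastforce
      qed
      finally show "cmod (?t i l f z) \<le> \<bar>M\<bar> * vnorm (dual_module Z) f * vnorm Z z"
        using z by (simp add: mult_ac)
    qed (simp add: Z.dual_norm_nonneg[OF f])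
    then show "\<exists>M. \<forall>f\<in>carrier (dual_module Z). vnorm (dual_module Z) (?t i l f) \<le> M * vnorm (dual_module Z) f"
      by blast
    fix a :: "'s \<Rightarrow> complex" and f assume "a \<in> ell1 UNIV" "f \<in> carrier (dual_module Z)"
    then show "?t i l (lact (dual_module Z) (diag a) f) = lact (dual_module Z) (diag a) (?t i l f)"
      by (auto simp: fun_eq_iff el il sym comm cl)
  next
    fix i l i' l' :: nat and f
    assume "i < 3" "l < 3" "i' < 3" "l' < 3" "f \<in> carrier (dual_module Z)"
    then show "?t i l (?t i' l' f) = (if l = i' then ?t i l' f else vzero (dual_module Z))"
      by (auto simp: fun_eq_iff el mult zero)
  next
    fix f assume f: "f \<in> carrier (dual_module Z)"
    have "f (\<epsilon> 0 0 z) + f (\<epsilon> 1 1 z) + f (\<epsilon> 2 2 z) = f z" if "z \<in> carrier Z" for z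
      using arg_cong[OF unit[OF that], of f] by (simp add: add f that el(1) Z.add_closed)
    then show "vadd (dual_module Z) (vadd (dual_module Z) (?t 0 0 f) (?t 1 1 f)) (?t 2 2 f) = f"
      using out[OF f] by (auto simp: fun_eq_iff)
  next
    fix a :: "'s \<Rightarrow> complex" and f assume "a \<in> ell1 UNIV" "f \<in> carrier (dual_module Z)"
    then show "ract (dual_module Z) f (diag a) = lact (dual_module Z) (diag a) f"
      by (auto simp: fun_eq_iff sym)
  next
    fix t :: "'s tri" and f assume t: "t \<in> carrier T0" "f \<in> carrier (dual_module Z)"
    have out': "tri_act (dual_module Z) ?t p k j t f z = 0" if "z \<notin> carrier Z" for z p k j
      using that by (cases t) (simp add: tri_act_def)
    show "lact (dual_module Z) t f = tri_act (dual_module Z) ?t q k' j' t f"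
      using tri[OF t(2,1) _ idx(3,4)] right[OF t(1)] out' by (auto simp: fun_eq_iff)
    show "ract (dual_module Z) f t = tri_act (dual_module Z) ?t p k j t f"
      using tri[OF t(2,1) _ idx(1,2)] left[OF t(1)] out' by (auto simp: fun_eq_iff)
  qed (use idx in simp_all)
qed

text \<open>Position 0 is the upper left entry, 1 the corner and 2 the lower right entry.\<close>

definition emb :: "nat \<Rightarrow> ('s \<Rightarrow> complex) \<Rightarrow> 's tri" where
  "emb i f = (if i = 0 then f else (\<lambda>s. 0), if i = 1 then f else (\<lambda>s. 0), if i = 2 then f else (\<lambda>s. 0))"

text \<open>The parameters are read off the matrix product. From the left the corner of the module
  element is multiplied by the upper left entry, from the right by the lower right one; a corner
  entry carries coordinate 2 to 1 from the left and coordinate 0 to 1 from the right.\<close>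

lemma matrix_coords_T0:
  "matrix_coords (regular_module (T0 :: ('s::ab_semigroup_mult tri, 's tri) modalg))
     (\<lambda>i l (a, m, b). emb i (if l = 0 then a else if l = 1 then m else b)) True 1 2 False 1 0"
proof
  fix i l :: nat assume il: "i < 3" "l < 3"
  then have c: "i = 0 \<or> i = 1 \<or> i = 2" "l = 0 \<or> l = 1 \<or> l = 2" by auto
  let ?e = "(\<lambda>(a, m, b). emb i (if l = 0 then a else if l = 1 then m else b)) :: 's tri \<Rightarrow> 's tri"
  show "linear_map (regular_module T0) (regular_module T0) ?e"
    using c by (auto simp: linear_map_def emb_def)
  have "vnorm T0 (?e z) \<le> 1 * vnorm T0 z" for z :: "'s tri"
    using c by (cases z) (auto simp: emb_def)
  then show "\<exists>M. \<forall>z\<in>carrier (regular_module T0). vnorm (regular_module T0) (?e z) \<le> M * vnorm (regular_module T0) z"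
    unfolding regular_module_simps by blast
  fix a :: "'s \<Rightarrow> complex" and z :: "'s tri"
  show "?e (lact (regular_module T0) (diag a) z) = lact (regular_module T0) (diag a) (?e z)"
    using c by (cases z) (auto simp: emb_def diag_def)
next
  fix i l i' l' :: nat and z :: "'s tri" assume "i < 3" "l < 3" "i' < 3" "l' < 3"
  then have "i = 0 \<or> i = 1 \<or> i = 2" "l = 0 \<or> l = 1 \<or> l = 2" "i' = 0 \<or> i' = 1 \<or> i' = 2" by auto
  then show "(\<lambda>(a, m, b). emb i (if l = 0 then a else if l = 1 then m else b))
      ((\<lambda>(a, m, b). emb i' (if l' = 0 then a else if l' = 1 then m else b)) z)
      = (if l = i' then (\<lambda>(a, m, b). emb i (if l' = 0 then a else if l' = 1 then m else b)) z
         else vzero (regular_module T0))"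
    by (cases z) (auto simp: emb_def)
qed (auto simp: emb_def diag_def tri_act_def conv_commute add.commute)

text \<open>The invariant of the induction over duals. One dualisation turns either parameter list
  into the other, so parity determines the shape.\<close>

lemma nth_dual_coords:
  fixes Y :: "('u, 's::ab_semigroup_mult tri, 's tri) bimod"
  assumes inv: "inverse_semigroup TYPE('s)"
    and Y: "nth_dual frak_T0 T0 (quotient_module T0 (module_ideal frak_T0 T0)) n Y"
  shows "commutative_banach_module frak_T0 T0 Y \<and>
    (\<exists>\<epsilon>. if even n then matrix_coords Y \<epsilon> True 1 2 False 1 0 else matrix_coords Y \<epsilon> False 0 1 True 2 1)"
  using Y
proof induction
  case (base Y h)
  note act = banach_bimodule_frak_T0[OF inv]
  have iso: "module_isometry frak_T0 T0 (regular_module T0) Y (h \<circ> (\<lambda>x. {x}))"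
    by (rule module_isometry_trans[OF quotient_zero_isometry base[unfolded module_ideal_T0]])
  note T = commutative_banach_module_T0[OF inv]
  show ?case
    using commutative_banach_module_isometry[OF iso T act]
      matrix_coords_isometry[OF matrix_coords_T0 iso] T
    by (auto simp: commutative_banach_module_def)
next
  case (step n Z Y h)
  note act = banach_bimodule_frak_T0[OF inv]
  have bZ: "commutative_banach_module frak_T0 T0 Z" using step.IH by simp
  note bD = commutative_banach_module_dual[OF bZ act]
  obtain \<epsilon> where e: "if even n then matrix_coords Z \<epsilon> True 1 2 False 1 0 else matrix_coords Z \<epsilon> False 0 1 True 2 1"
    using step.IH by blast
  have bZ': "banach_module frak_T0 T0 Z" and bD': "banach_module frak_T0 T0 (dual_module Z)"
    using bZ bD by (simp_all add: commutative_banach_module_def)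
  show ?case
  proof (cases "even n")
    case True
    then have "matrix_coords Z \<epsilon> True 1 2 False 1 0" using e by simp
    from matrix_coords_isometry[OF matrix_coords_dual[OF this bZ'] step.hyps(2) bD']
    show ?thesis using commutative_banach_module_isometry[OF step.hyps(2) bD act] True by auto
  next
    case False
    then have "matrix_coords Z \<epsilon> False 0 1 True 2 1" using e by simp
    from matrix_coords_isometry[OF matrix_coords_dual[OF this bZ'] step.hyps(2) bD']
    show ?thesis using commutative_banach_module_isometry[OF step.hyps(2) bD act] False by auto
  qed
qed

section \<open>Module derivations into the iterated duals\<close>

declare One_nat_def [simp del] T0_simps [simp del]

section \<open>Components of a derivation at the point masses\<close>

lemma emb_mem: "f \<in> ell1 UNIV \<Longrightarrow> emb i f \<in> carrier T0"
  by (simp add: emb_def T0_simps)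

lemma emb_norm: "i < 3 \<Longrightarrow> vnorm T0 (emb i f) = ell1_norm f"
  by (auto simp: emb_def T0_simps)

lemma emb_add: "emb i (\<lambda>s. f s + g s) = vadd T0 (emb i f) (emb i g)"
  by (simp add: emb_def T0_simps)

lemma emb_mult:
  "amult T0 (emb 0 f) (emb 0 g) = emb 0 (conv f g)" "amult T0 (emb 0 f) (emb 1 g) = emb 1 (conv f g)"
  "amult T0 (emb 0 f) (emb 2 g) = vzero T0" "amult T0 (emb 1 f) (emb 2 g) = emb 1 (conv f g)"
  "amult T0 (emb 2 f) (emb 0 g) = vzero T0" "amult T0 (emb 2 f) (emb 2 g) = emb 2 (conv f g)"
  by (simp_all add: emb_def T0_simps)

lemma diag_mult: "amult T0 (diag f) (diag g) = diag (conv f g)"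
  by (simp add: diag_def T0_simps)

lemma less_3_cases: "i < (3::nat) \<Longrightarrow> i = 0 \<or> i = 1 \<or> i = 2"
  by auto

text \<open>The values of \<open>dv\<close> are functionals on \<open>Z\<close>, so limits of them
  may be taken pointwise on \<open>Z\<close>; \<open>\<kappa>\<close> is the constant of condition
  \<open>D\<close>.\<close>

locale tri_derivation = matrix_coords Z \<epsilon> p j k q j' k'
  for Z :: "('u, 's::ab_semigroup_mult tri, 's tri) bimod" and \<epsilon> p j k q j' k' +
  fixes \<kappa> :: nat and dv :: "'s tri \<Rightarrow> 'u \<Rightarrow> complex"
  assumes inv: "inverse_semigroup TYPE('s)"
    and cond: "condition_D \<kappa> (idempotents :: 's set)"
    and module: "banach_module frak_T0 T0 Z"
    and der: "module_derivation frak_T0 T0 (dual_module Z) dv"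
begin

sublocale Z: normed_bimod Z
  using module by (rule normed_bimod_if_banach_module)

abbreviation act :: "'s \<Rightarrow> 'u \<Rightarrow> 'u" where "act s \<equiv> lact Z (diag (delta s))"

text \<open>The nine components: position \<open>i\<close> in the argument, coordinate
  \<open>l\<close> in the value. The map \<open>\<epsilon> l 0\<close> reads every coordinate
  through coordinate 0, which makes the components comparable with one another.\<close>

abbreviation F :: "nat \<Rightarrow> nat \<Rightarrow> 's \<Rightarrow> 'u \<Rightarrow> complex" where "F i l s z \<equiv> dv (emb i (delta s)) (\<epsilon> l 0 z)"

lemma lact_bilinear: "bounded_bilinear_map T0 Z Z (lact Z)"
  and ract_bilinear: "bounded_bilinear_map Z T0 Z (ract Z)"
  and rscal_bilinear: "bounded_bilinear_map Z frak_T0 Z (rscal Z)"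
  using module by (simp_all add: banach_module_def banach_bimodule_def)

lemmas lact_closed = banach_module_closed(1)[OF module]
  and ract_closed = banach_module_closed(2)[OF module]
  and eps_closed = linear_mapD(1)[OF lin]

lemma lact_vzero:
  "z \<in> carrier Z \<Longrightarrow> lact Z (vzero T0) z = vzero Z" "t \<in> carrier T0 \<Longrightarrow> lact Z t (vzero Z) = vzero Z"
  using linear_map_zero[OF bounded_bilinear_mapD(2)[OF lact_bilinear] T0.normed Z.normed_vspace_axioms]
    linear_map_zero[OF bounded_bilinear_mapD(1)[OF lact_bilinear] Z.normed_vspace_axioms Z.normed_vspace_axioms]
  by blast+

lemma diag_delta_mem: "diag (delta s) \<in> carrier T0"
  by (rule diag_mem[OF delta_ell1])

lemma act_closed: "z \<in> carrier Z \<Longrightarrow> act s z \<in> carrier Z"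
  by (rule lact_closed[OF _ diag_delta_mem])

lemma act_linear: "linear_map Z Z (act s)"
  by (rule bounded_bilinear_mapD(1)[OF lact_bilinear diag_delta_mem])

lemma act_act:
  assumes "z \<in> carrier Z" shows "act s (act t z) = act (s * t) z"
proof -
  have "act s (act t z) = lact Z (amult T0 (diag (delta s)) (diag (delta t))) z"
    using module assms diag_delta_mem unfolding banach_module_def banach_bimodule_def by metis
  then show ?thesis by (simp add: diag_mult conv_delta)
qed

lemma act_bound: obtains C where "C \<ge> 0" "\<And>s z. z \<in> carrier Z \<Longrightarrow> vnorm Z (act s z) \<le> C * vnorm Z z"
proof -
  obtain M where M: "M \<ge> 0"
    "\<And>x y. \<lbrakk>x \<in> carrier T0; y \<in> carrier Z\<rbrakk> \<Longrightarrow> vnorm Z (lact Z x y) \<le> M * vnorm T0 x * vnorm Z y"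
    using bounded_bilinear_map_bound[OF lact_bilinear T0.normed Z.normed_vspace_axioms] by blast
  have "vnorm Z (act s z) \<le> M * 2 * vnorm Z z" if "z \<in> carrier Z" for s z
    using M(2)[OF diag_delta_mem that, of s] by (simp add: diag_def delta_norm T0_simps)
  then show thesis using that[of "M * 2"] M(1) by simp
qed

lemma eps_act: "\<lbrakk>i < 3; l < 3; z \<in> carrier Z\<rbrakk> \<Longrightarrow> act s (\<epsilon> i l z) = \<epsilon> i l (act s z)"
  using comm[OF _ _ delta_ell1] by simp

text \<open>On a vector concentrated in one coordinate at most one term of \<open>tri_act\<close>
  survives. This table turns the Leibniz rule into identities between the components
  \<open>F\<close>.\<close>

lemma tri_act_column:
  assumes z: "z \<in> carrier Z" and l: "l < 3" and jk: "J < 3" "K < 3"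
  shows "tri_act Z \<epsilon> P J K (emb 0 (delta s)) (\<epsilon> l 0 z) = (if l = 0 \<or> l = 1 \<and> P then \<epsilon> l 0 (act s z) else vzero Z)"
    and "tri_act Z \<epsilon> P J K (emb 1 (delta s)) (\<epsilon> l 0 z) = (if l = K then \<epsilon> J 0 (act s z) else vzero Z)"
    and "tri_act Z \<epsilon> P J K (emb 2 (delta s)) (\<epsilon> l 0 z) = (if l = 2 \<or> l = 1 \<and> \<not> P then \<epsilon> l 0 (act s z) else vzero Z)"
proof -
  have d0: "diag (\<lambda>s. 0) = vzero (T0 :: ('s tri, 's tri) modalg)" by (simp add: diag_def T0_simps)
  note S = tri_act_def emb_def mult d0 lact_vzero eps_closed diag_delta_mem act_closed Z.zero_add Z.add_zero
    Z.zero_closed eps_act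
  show "tri_act Z \<epsilon> P J K (emb 0 (delta s)) (\<epsilon> l 0 z) = (if l = 0 \<or> l = 1 \<and> P then \<epsilon> l 0 (act s z) else vzero Z)"
    using less_3_cases[OF l] z jk by (auto simp: S)
  show "tri_act Z \<epsilon> P J K (emb 1 (delta s)) (\<epsilon> l 0 z) = (if l = K then \<epsilon> J 0 (act s z) else vzero Z)"
    using less_3_cases[OF l] z jk by (auto simp: S)
  show "tri_act Z \<epsilon> P J K (emb 2 (delta s)) (\<epsilon> l 0 z) = (if l = 2 \<or> l = 1 \<and> \<not> P then \<epsilon> l 0 (act s z) else vzero Z)"
    using less_3_cases[OF l] z jk by (auto simp: S)
qed

lemma column_acts:
  assumes "z \<in> carrier Z" "l < 3"
  shows "lact Z (emb 0 (delta s)) (\<epsilon> l 0 z) = (if l = 0 \<or> l = 1 \<and> p then \<epsilon> l 0 (act s z) else vzero Z)"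
    and "lact Z (emb 1 (delta s)) (\<epsilon> l 0 z) = (if l = k then \<epsilon> j 0 (act s z) else vzero Z)"
    and "lact Z (emb 2 (delta s)) (\<epsilon> l 0 z) = (if l = 2 \<or> l = 1 \<and> \<not> p then \<epsilon> l 0 (act s z) else vzero Z)"
    and "ract Z (\<epsilon> l 0 z) (emb 0 (delta s)) = (if l = 0 \<or> l = 1 \<and> q then \<epsilon> l 0 (act s z) else vzero Z)"
    and "ract Z (\<epsilon> l 0 z) (emb 1 (delta s)) = (if l = k' then \<epsilon> j' 0 (act s z) else vzero Z)"
    and "ract Z (\<epsilon> l 0 z) (emb 2 (delta s)) = (if l = 2 \<or> l = 1 \<and> \<not> q then \<epsilon> l 0 (act s z) else vzero Z)"
  using tri_act_column[OF assms idx(1,2)] tri_act_column[OF assms idx(3,4)] assms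
  by (simp_all add: left[OF emb_mem[OF delta_ell1]] right[OF emb_mem[OF delta_ell1]] eps_closed)

lemma dv_mem: "t \<in> carrier T0 \<Longrightarrow> dv t \<in> carrier (dual_module Z)"
  using der by (simp add: module_derivation_def)

lemma dv_functional: "t \<in> carrier T0 \<Longrightarrow> bounded_functional Z (dv t)"
  by (rule Z.dual_functional[OF dv_mem])

lemma dv_add: "\<lbrakk>x \<in> carrier T0; y \<in> carrier T0\<rbrakk> \<Longrightarrow> dv (vadd T0 x y) w = dv x w + dv y w"
  using der by (simp add: module_derivation_def)

lemma dv_mult:
  "\<lbrakk>x \<in> carrier T0; y \<in> carrier T0; w \<in> carrier Z\<rbrakk>
    \<Longrightarrow> dv (amult T0 x y) w = dv x (lact Z y w) + dv y (ract Z w x)"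
  using der unfolding module_derivation_def by simp

lemma dv_zero: "dv (vzero T0) w = 0"
  using dv_add[of "vzero T0" "vzero T0" w] by (simp add: T0_simps)

lemma dv_zero_right: "t \<in> carrier T0 \<Longrightarrow> dv t (vzero Z) = 0"
  using Z.functional_zero[OF dv_functional] .

lemma dv_bound:
  obtains M where "M \<ge> 0" "\<And>t w. \<lbrakk>t \<in> carrier T0; w \<in> carrier Z\<rbrakk> \<Longrightarrow> cmod (dv t w) \<le> M * vnorm T0 t * vnorm Z w"
proof -
  obtain M where M: "M > 0" "\<forall>t\<in>carrier T0. vnorm (dual_module Z) (dv t) \<le> M * vnorm T0 t"
    using der unfolding module_derivation_def by blast
  have "cmod (dv t w) \<le> M * vnorm T0 t * vnorm Z w" if "t \<in> carrier T0" "w \<in> carrier Z" for t w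
    using order_trans[OF Z.dual_bound[OF dv_mem[OF that(1)] that(2)] mult_right_mono[OF bspec[OF M(2) that(1)]]]
      Z.norm_nonneg[OF that(2)] by blast
  then show thesis using that[of M] M(1) by simp
qed

text \<open>Complex homogeneity is not assumed of \<open>dv\<close>; here it comes from
  \<open>c \<delta>\<^sub>s = (c \<delta>\<^sub>e) \<cdot> \<delta>\<^sub>s\<close> with the idempotent \<open>e = s s\<^sup>*\<close>.\<close>

lemma dv_scale_delta:
  assumes w: "w \<in> carrier Z"
  shows "dv (emb i (\<lambda>t. c * delta s t)) w = c * dv (emb i (delta s)) w"
proof -
  define e where "e = s * star s"
  have e: "e \<in> idempotents" "e * s = s"
    using mult_star_idempotent[OF inv] star_mult_self[OF inv] by (simp_all add: e_def)
  have de: "(\<lambda>t. c * delta e t) \<in> ell1 idempotents" for c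
    using delta_ell1[of e] e(1) ell1_scale[OF delta_ell1, of c e] by (auto simp: ell1_def delta_def)
  define \<alpha> :: "'s tri" where "\<alpha> = (delta e, \<lambda>s. 0, delta e)"
  have \<alpha>: "vscale frak_T0 c \<alpha> \<in> carrier frak_T0" "\<alpha> \<in> carrier frak_T0" for c
    using de[of c] de[of 1] by (simp_all add: \<alpha>_def frak_T0_memI)
  have eq: "emb i (\<lambda>t. c * delta s t) = aleft T0 (vscale frak_T0 c \<alpha>) (emb i (delta s))" for c
    by (simp add: \<alpha>_def emb_def conv_scale_left conv_delta e(2) T0_simps)
  have act: "dv (aleft T0 \<beta> t) w = dv t (rscal Z w \<beta>)" if "\<beta> \<in> carrier frak_T0" "t \<in> carrier T0" for \<beta> t
    using der that w unfolding module_derivation_def by simp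
  have m: "emb i (delta s) \<in> carrier T0" by (rule emb_mem[OF delta_ell1])
  have 1: "dv (emb i (\<lambda>t. c * delta s t)) w = c * dv (emb i (delta s)) (rscal Z w \<alpha>)" for c
    unfolding eq act[OF \<alpha>(1) m] linear_mapD(3)[OF bounded_bilinear_mapD(1)[OF rscal_bilinear w] \<alpha>(2)]
    by (rule bounded_functionalD(2)[OF dv_functional[OF m]]) (use bounded_bilinear_mapD(3)[OF rscal_bilinear w \<alpha>(2)] in simp)
  \<comment> \<open>The instance at 1 removes the action of \<open>\<alpha>\<close> from the
    right-hand side.\<close>
  show ?thesis using 1[of c] 1[of 1] by simp
qed

lemma F_functional: "l < 3 \<Longrightarrow> bounded_functional Z (F i l s)"
proof -
  assume l: "l < 3"
  obtain N where "\<forall>z\<in>carrier Z. vnorm Z (\<epsilon> l 0 z) \<le> N * vnorm Z z" using bound[OF l, of 0] by auto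
  then show ?thesis
    by (intro Z.bounded_functional_comp[OF dv_functional[OF emb_mem[OF delta_ell1]] lin[OF l], of 0 N]) auto
qed

text \<open>The bound is uniform in \<open>s\<close> because all \<open>emb i (delta s)\<close> have
  norm 1; the vanishing and the multiplier lemma both depend on this uniformity.\<close>

lemma F_bound:
  assumes "i < 3" "l < 3"
  obtains M where "M \<ge> 0" "\<And>s z. z \<in> carrier Z \<Longrightarrow> cmod (F i l s z) \<le> M * vnorm Z z"
proof -
  obtain N where N: "\<forall>z\<in>carrier Z. vnorm Z (\<epsilon> l 0 z) \<le> N * vnorm Z z" using bound[OF assms(2), of 0] by auto
  obtain M where M: "M \<ge> 0" "\<And>t w. \<lbrakk>t \<in> carrier T0; w \<in> carrier Z\<rbrakk> \<Longrightarrow> cmod (dv t w) \<le> M * vnorm T0 t * vnorm Z w"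
    using dv_bound by blast
  have "cmod (F i l s z) \<le> (M * \<bar>N\<bar>) * vnorm Z z" if z: "z \<in> carrier Z" for s z
  proof -
    have "cmod (F i l s z) \<le> M * vnorm Z (\<epsilon> l 0 z)"
      using M(2)[OF emb_mem[OF delta_ell1] eps_closed[OF assms(2) _ z], of 0 i s]
      by (simp add: emb_norm[OF assms(1)] delta_norm)
    also have "\<dots> \<le> M * (\<bar>N\<bar> * vnorm Z z)"
    proof (rule mult_left_mono[OF _ M(1)])
      have "N * vnorm Z z \<le> \<bar>N\<bar> * vnorm Z z" using Z.norm_nonneg[OF z] by (intro mult_right_mono) auto
      then show "vnorm Z (\<epsilon> l 0 z) \<le> \<bar>N\<bar> * vnorm Z z" using N z by fastforce
    qed
    finally show ?thesis by (simp add: mult.assoc)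
  qed
  then show thesis using that[of "M * \<bar>N\<bar>"] M(1) by simp
qed

lemma F_derivation_zero:
  assumes il: "i < 3" "l < 3"
    and rule: "\<And>s t z. z \<in> carrier Z \<Longrightarrow> F i l (s * t) z = F i l s (act t z) + F i l t (act s z)"
    and z: "z \<in> carrier Z"
  shows "F i l s z = 0"
proof -
  obtain M where M: "M \<ge> 0" "\<And>s z. z \<in> carrier Z \<Longrightarrow> cmod (F i l s z) \<le> M * vnorm Z z"
    using F_bound[OF il] by blast
  obtain C where C: "C \<ge> 0" "\<And>s z. z \<in> carrier Z \<Longrightarrow> vnorm Z (act s z) \<le> C * vnorm Z z"
    using act_bound by blast
  have "cmod (F i l s (act t z)) \<le> M * (C * vnorm Z z)" if "z \<in> carrier Z" for s t z
    using order_trans[OF M(2)[OF act_closed[OF that]] mult_left_mono[OF C(2)[OF that] M(1)]] .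
  from bounded_derivation_zero[where act = act and f = "F i l" and Z = "carrier Z" and K = "\<lambda>z. M * (C * vnorm Z z)",
      OF inv act_closed act_act rule this z]
  show ?thesis .
qed

text \<open>The third property, that on vectors \<open>act s z\<close> only coordinate 0 matters to
  \<open>x\<close>, is inherited from \<open>F\<close>, since \<open>\<epsilon> l 0\<close> ignores
  the other coordinates. It is what allows \<open>x\<close> to be placed into another coordinate
  later.\<close>

lemma F_multiplier:
  assumes il: "i < 3" "l < 3"
    and rule: "\<And>s t z. z \<in> carrier Z \<Longrightarrow> F i l (s * t) z = F i l t (act s z)"
  obtains x where "bounded_functional Z x" "\<And>s z. z \<in> carrier Z \<Longrightarrow> F i l s z = x (act s z)"
    "\<And>s z. z \<in> carrier Z \<Longrightarrow> x (\<epsilon> 0 0 (act s z)) = x (act s z)"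
proof -
  obtain M where M: "M \<ge> 0" "\<And>s z. z \<in> carrier Z \<Longrightarrow> cmod (F i l s z) \<le> M * vnorm Z z"
    using F_bound[OF il] by blast
  obtain C where C: "C \<ge> 0" "\<And>s z. z \<in> carrier Z \<Longrightarrow> vnorm Z (act s z) \<le> C * vnorm Z z"
    using act_bound by blast
  obtain x where x: "bounded_functional Z x" "\<And>s z. z \<in> carrier Z \<Longrightarrow> F i l s z = x (act s z)"
    using multiplier_inner[where act = act and f = "F i l",
      OF inv cond Z.normed_vspace_axioms act_linear act_act C(2) F_functional[OF il(2)] M(2) rule] by blast
  have "x (\<epsilon> 0 0 (act s z)) = x (act s z)" if z: "z \<in> carrier Z" for s z
  proof -
    have "x (\<epsilon> 0 0 (act s z)) = F i l s (\<epsilon> 0 0 z)"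
      using x(2)[OF eps_closed[OF _ _ z], of 0 0 s] z by (simp add: eps_act)
    also have "\<dots> = F i l s z" using z il by (simp add: mult)
    finally show ?thesis using x(2)[OF z] by simp
  qed
  with x show thesis using that by blast
qed

section \<open>The Leibniz identities and the implementing functional\<close>

lemma product_rule:
  assumes "l < 3" "z \<in> carrier Z"
  shows "dv (amult T0 (emb i (delta s)) (emb i' (delta t))) (\<epsilon> l 0 z)
    = dv (emb i (delta s)) (lact Z (emb i' (delta t)) (\<epsilon> l 0 z))
      + dv (emb i' (delta t)) (ract Z (\<epsilon> l 0 z) (emb i (delta s)))"
  by (rule dv_mult) (use assms in \<open>simp_all add: emb_mem delta_ell1 eps_closed\<close>)

text \<open>Nine identities at point masses suffice: \<open>unit\<close> splits a vector into its
  coordinates, and density reaches all entries.\<close>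

lemma inner_if_columns:
  assumes psi: "bounded_functional Z \<psi>"
    and eq: "\<And>i l s z. \<lbrakk>i < 3; l < 3; z \<in> carrier Z\<rbrakk> \<Longrightarrow>
      F i l s z = \<psi> (ract Z (\<epsilon> l 0 z) (emb i (delta s))) - \<psi> (lact Z (emb i (delta s)) (\<epsilon> l 0 z))"
  shows "inner_derivation T0 (dual_module Z) dv"
proof -
  \<comment> \<open>The inner derivation given by \<open>\<psi>\<close>, evaluated at
    \<open>w\<close>; dual actions change sides, so the left action of \<open>t\<close> appears as
    right multiplication of \<open>w\<close>.\<close>
  define inn where "inn t w = \<psi> (ract Z w t) - \<psi> (lact Z t w)" for t w
  define x where "x z = (if z \<in> carrier Z then \<psi> z else 0)" for z
  have x: "x \<in> carrier (dual_module Z)"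
    unfolding x_def using psi by (rule Z.functional_restrict_mem)
  note P = bounded_functionalD[OF psi]
  note lB = linear_mapD(2,3)[OF bounded_bilinear_mapD(1)[OF lact_bilinear]]
    linear_mapD(2,3)[OF bounded_bilinear_mapD(2)[OF lact_bilinear]]
  note rB = linear_mapD(2,3)[OF bounded_bilinear_mapD(1)[OF ract_bilinear]]
    linear_mapD(2,3)[OF bounded_bilinear_mapD(2)[OF ract_bilinear]]
  have inn_add: "inn (vadd T0 t t') w = inn t w + inn t' w"
    if "t \<in> carrier T0" "t' \<in> carrier T0" "w \<in> carrier Z" for t t' w
    using that by (simp add: inn_def lB rB P lact_closed ract_closed)
  have inn_scale: "inn (vscale T0 c t) w = c * inn t w" if "t \<in> carrier T0" "w \<in> carrier Z" for c t w
    using that by (simp add: inn_def lB rB P lact_closed ract_closed algebra_simps)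
  have inn_add_w: "inn t (vadd Z w w') = inn t w + inn t w'"
    if "t \<in> carrier T0" "w \<in> carrier Z" "w' \<in> carrier Z" for t w w'
    using that by (simp add: inn_def lB rB P lact_closed ract_closed)
  have basis: "dv (emb i (delta s)) w = inn (emb i (delta s)) w" if i: "i < 3" and w: "w \<in> carrier Z" for i s w
  proof -
    \<comment> \<open>Here \<open>\<epsilon> l l w\<close> is rewritten as
      \<open>\<epsilon> l 0\<close> applied to \<open>\<epsilon> 0 l w\<close>.\<close>
    have col: "dv (emb i (delta s)) (\<epsilon> l l w) = inn (emb i (delta s)) (\<epsilon> l l w)" if l: "l < 3" for l
      using eq[OF i l eps_closed[of 0 l w], of s] l w by (simp add: inn_def mult)
    have m: "emb i (delta s) \<in> carrier T0" by (rule emb_mem[OF delta_ell1])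
    have "dv (emb i (delta s)) (vadd Z (vadd Z (\<epsilon> 0 0 w) (\<epsilon> 1 1 w)) (\<epsilon> 2 2 w))
        = inn (emb i (delta s)) (vadd Z (vadd Z (\<epsilon> 0 0 w) (\<epsilon> 1 1 w)) (\<epsilon> 2 2 w))"
      using w by (simp add: bounded_functionalD(1)[OF dv_functional[OF m]] inn_add_w[OF m] eps_closed Z.add_closed col
         )
    then show ?thesis by (simp add: unit[OF w])
  qed
  obtain M where M: "M \<ge> 0" "\<And>t w. \<lbrakk>t \<in> carrier T0; w \<in> carrier Z\<rbrakk> \<Longrightarrow> cmod (dv t w) \<le> M * vnorm T0 t * vnorm Z w"
    using dv_bound by blast
  obtain A where A: "A \<ge> 0"
    "\<And>t w. \<lbrakk>t \<in> carrier T0; w \<in> carrier Z\<rbrakk> \<Longrightarrow> vnorm Z (lact Z t w) \<le> A * vnorm T0 t * vnorm Z w"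
    using bounded_bilinear_map_bound[OF lact_bilinear T0.normed Z.normed_vspace_axioms] by blast
  obtain B where B: "B \<ge> 0"
    "\<And>w t. \<lbrakk>w \<in> carrier Z; t \<in> carrier T0\<rbrakk> \<Longrightarrow> vnorm Z (ract Z w t) \<le> B * vnorm Z w * vnorm T0 t"
    using bounded_bilinear_map_bound[OF ract_bilinear Z.normed_vspace_axioms T0.normed] by blast
  obtain L where L: "L \<ge> 0" "\<And>w. w \<in> carrier Z \<Longrightarrow> cmod (\<psi> w) \<le> L * vnorm Z w"
    using Z.functional_bound[OF psi] by blast
  have part: "dv (emb i f) w - inn (emb i f) w = 0" if i: "i < 3" and f: "f \<in> ell1 UNIV" and w: "w \<in> carrier Z" for i f w
  proof (rule additive_zero_on_ell1[where f = f and G = "\<lambda>f. dv (emb i f) w - inn (emb i f) w"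
        and K = "(M + L * B + L * A) * vnorm Z w", OF _ _ _ f])
    fix f g :: "'s \<Rightarrow> complex" assume "f \<in> ell1 UNIV" "g \<in> ell1 UNIV"
    then show "dv (emb i (\<lambda>s. f s + g s)) w - inn (emb i (\<lambda>s. f s + g s)) w
        = dv (emb i f) w - inn (emb i f) w + (dv (emb i g) w - inn (emb i g) w)"
      using w by (simp add: emb_add dv_add inn_add emb_mem)
  next
    fix f :: "'s \<Rightarrow> complex" assume f: "f \<in> ell1 UNIV"
    note m = emb_mem[OF f, of i]
    have 1: "cmod (dv (emb i f) w) \<le> M * ell1_norm f * vnorm Z w"
      using M(2)[OF m w] by (simp add: emb_norm[OF i])
    have 2: "cmod (\<psi> (ract Z w (emb i f))) \<le> L * (B * vnorm Z w * ell1_norm f)"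
      using order_trans[OF L(2)[OF ract_closed[OF w m]] mult_left_mono[OF B(2)[OF w m] L(1)]]
      by (simp add: emb_norm[OF i])
    have 3: "cmod (\<psi> (lact Z (emb i f) w)) \<le> L * (A * ell1_norm f * vnorm Z w)"
      using order_trans[OF L(2)[OF lact_closed[OF w m]] mult_left_mono[OF A(2)[OF m w] L(1)]]
      by (simp add: emb_norm[OF i])
    have "cmod (dv (emb i f) w - inn (emb i f) w)
        \<le> cmod (dv (emb i f) w) + (cmod (\<psi> (ract Z w (emb i f))) + cmod (\<psi> (lact Z (emb i f) w)))"
      unfolding inn_def using norm_triangle_ineq4 order_trans add_left_mono by meson
    also have "\<dots> \<le> (M + L * B + L * A) * vnorm Z w * ell1_norm f"
      using 1 2 3 by (simp add: algebra_simps)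
    finally show "cmod (dv (emb i f) w - inn (emb i f) w) \<le> (M + L * B + L * A) * vnorm Z w * ell1_norm f" .
  next
    fix c and s :: 's
    have "emb i (\<lambda>t. c * delta s t) = vscale T0 c (emb i (delta s))" by (simp add: emb_def T0_simps fun_eq_iff)
    then show "dv (emb i (\<lambda>t. c * delta s t)) w - inn (emb i (\<lambda>t. c * delta s t)) w = 0"
      using dv_scale_delta[OF w, of i c s] basis[OF i w, of s] inn_scale[OF emb_mem[OF delta_ell1] w, of c i s]
      by (simp)
  qed
  have all: "dv t w = inn t w" if t: "t \<in> carrier T0" and w: "w \<in> carrier Z" for t w
  proof -
    obtain a m b where abm: "t = (a, m, b)" by (cases t)
    have e: "a \<in> ell1 UNIV" "m \<in> ell1 UNIV" "b \<in> ell1 UNIV" using t abm by (auto simp: T0_simps)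
    have dec: "t = vadd T0 (vadd T0 (emb 0 a) (emb 1 m)) (emb 2 b)" by (simp add: abm emb_def T0_simps)
    have m2: "vadd T0 (emb 0 a) (emb 1 m) \<in> carrier T0"
      by (rule T0.add_mem) (simp_all add: emb_mem e)
    show ?thesis
      unfolding dec using part[OF _ e(1) w, of 0] part[OF _ e(2) w, of 1] part[OF _ e(3) w, of 2] w m2
      by (simp add: dv_add inn_add emb_mem e)
  qed
  have "dv t = vsub (dual_module Z) (lact (dual_module Z) t x) (ract (dual_module Z) x t)" if t: "t \<in> carrier T0" for t
  proof
    fix w
    show "dv t w = vsub (dual_module Z) (lact (dual_module Z) t x) (ract (dual_module Z) x t) w"
    proof (cases "w \<in> carrier Z")
      case True
      then show ?thesis using all[OF t True] t by (simp add: inn_def x_def lact_closed ract_closed)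
    next
      case False
      then show ?thesis using dv_mem[OF t] by (simp add: mem_dual)
    qed
  qed
  with x show ?thesis unfolding inner_derivation_def by blast
qed

lemmas product_simps = emb_mult conv_delta column_acts dv_zero dv_zero_right emb_mem delta_ell1

lemmas unit_idempotent = star_mult_self(1,2)[OF inv]

text \<open>Coordinates 0 and 2 are symmetric for the diagonal entries, but on coordinate 1
  \<open>emb 0\<close> acts only from the left and \<open>emb 2\<close> only from the right. So
  \<open>F 0 1\<close> loses one Leibniz term and is a multiplier, while \<open>F 0 0\<close> and
  \<open>F 2 2\<close> are derivations. The remaining components vanish or are, up to sign, copies
  of \<open>F 0 1\<close>, so a single functional \<open>x\<close> suffices.\<close>

lemma inner_even:
  assumes shape: "p = True" "j = 1" "k = 2" "q = False" "j' = 1" "k' = 0"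
  shows "inner_derivation T0 (dual_module Z) dv"
proof -
  note S = product_simps shape
  note R = product_rule
  have F00: "F 0 0 s z = 0" if "z \<in> carrier Z" for s z
    by (rule F_derivation_zero[OF _ _ _ that]) (use R[of 0 _ 0 _ 0] in \<open>simp_all add: S\<close>)
  have F22: "F 2 2 s z = 0" if "z \<in> carrier Z" for s z
    by (rule F_derivation_zero[OF _ _ _ that]) (use R[of 2 _ 2 _ 2] in \<open>simp_all add: S\<close>)
  have m01: "F 0 1 (s * t) z = F 0 1 t (act s z)" if "z \<in> carrier Z" for s t z
    using R[of 1 z 0 t 0 s] that by (simp add: S mult.commute)
  obtain x where x: "bounded_functional Z x" "\<And>s z. z \<in> carrier Z \<Longrightarrow> F 0 1 s z = x (act s z)"
    "\<And>s z. z \<in> carrier Z \<Longrightarrow> x (\<epsilon> 0 0 (act s z)) = x (act s z)"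
    by (rule F_multiplier[of 0 1, OF _ _ m01]) simp_all
  have F02: "F 0 2 s z = 0" if "z \<in> carrier Z" for s z
    using R[of 2 z 0 "s * star s" 0 s] that unit_idempotent by (simp add: S)
  have F20: "F 2 0 s z = 0" if "z \<in> carrier Z" for s z
    using R[of 0 z 2 "s * star s" 2 s] that unit_idempotent by (simp add: S)
  \<comment> \<open>The product of \<open>emb 2\<close> and \<open>emb 0\<close> is zero, and its
    Leibniz identity ties \<open>F 2 1\<close> to \<open>F 0 1\<close>. It speaks only of arguments
    \<open>act (s * star s) z\<close>, so the local unit is inserted first.\<close>
  have F21: "F 2 1 s z = - x (act s z)" if z: "z \<in> carrier Z" for s z
  proof -
    have "F 2 1 s z = F 2 1 s (act (s * star s) z)"
      using R[of 1 z 2 "s * star s" 2 s] z unit_idempotent by (simp add: S)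
    also have "\<dots> = - F 0 1 (s * star s) (act s z)"
      using R[of 1 z 2 s 0 "s * star s"] z by (simp add: S add_eq_0_iff)
    also have "\<dots> = - x (act s z)"
      using x(2)[OF act_closed[OF z]] z by (simp add: act_act unit_idempotent)
    finally show ?thesis .
  qed
  have F11: "F 1 1 s z = 0" if "z \<in> carrier Z" for s z
    using R[of 1 z 0 "s * star s" 1 s] that unit_idempotent by (simp add: S)
  have F12: "F 1 2 s z = x (act s z)" if z: "z \<in> carrier Z" for s z
    using R[of 2 z 0 "s * star s" 1 s] x(2)[OF act_closed[OF z]] z unit_idempotent
    by (simp add: S act_act)
  have F10: "F 1 0 s z = - x (act s z)" if z: "z \<in> carrier Z" for s z
    using R[of 0 z 1 s 2 "s * star s"] F21[OF act_closed[OF z]] z unit_idempotent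
    by (simp add: S act_act)
  \<comment> \<open>The sign comes from \<open>F 0 1\<close>, which is produced by the left action,
    the subtracted term of an inner derivation.\<close>
  define \<psi> where "\<psi> w = - x (\<epsilon> 0 1 w)" for w
  obtain N where N: "\<forall>z\<in>carrier Z. vnorm Z (\<epsilon> 0 1 z) \<le> N * vnorm Z z" using bound[of 0 1] by auto
  have "bounded_functional Z \<psi>"
    using Z.bounded_functional_scale[OF Z.bounded_functional_comp[OF x(1) lin[of 0 1], of N], of "-1"] N
    by (simp add: \<psi>_def[abs_def])
  moreover have col: "\<psi> (\<epsilon> l 0 (act s z)) = (if l = 1 then - x (act s z) else 0)" if "l < 3" "z \<in> carrier Z" for l s z
    using less_3_cases[OF that(1)] that act_closed[OF that(2)]
    by (auto simp: \<psi>_def mult x(3) Z.functional_zero[OF x(1)])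
  moreover have psi0: "\<psi> (vzero Z) = 0"
    using Z.functional_zero calculation(1) by blast
  ultimately show ?thesis
  proof (intro inner_if_columns)
    fix i l s z assume il: "i < (3::nat)" "l < (3::nat)" and z: "z \<in> carrier Z"
    then show "F i l s z = \<psi> (ract Z (\<epsilon> l 0 z) (emb i (delta s))) - \<psi> (lact Z (emb i (delta s)) (\<epsilon> l 0 z))"
      using less_3_cases[OF il(1)] less_3_cases[OF il(2)]
      by (elim disjE) (simp_all add: column_acts shape col psi0 F00 F22 x(2) F02 F20 F21 F11 F12 F10)
  qed
qed

text \<open>Left and right have changed roles on coordinate 1, and the corner entry now starts from
  coordinate 1 on both sides. Hence \<open>F 1 1\<close> is no longer forced to vanish and
  contributes a second, independent functional \<open>y\<close>.\<close>

lemma inner_odd: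
  assumes shape: "p = False" "j = 0" "k = 1" "q = True" "j' = 2" "k' = 1"
  shows "inner_derivation T0 (dual_module Z) dv"
proof -
  note S = product_simps shape
  note R = product_rule
  have F00: "F 0 0 s z = 0" if "z \<in> carrier Z" for s z
    by (rule F_derivation_zero[OF _ _ _ that]) (use R[of 0 _ 0 _ 0] in \<open>simp_all add: S\<close>)
  have F22: "F 2 2 s z = 0" if "z \<in> carrier Z" for s z
    by (rule F_derivation_zero[OF _ _ _ that]) (use R[of 2 _ 2 _ 2] in \<open>simp_all add: S\<close>)
  have m01: "F 0 1 (s * t) z = F 0 1 t (act s z)" if "z \<in> carrier Z" for s t z
    using R[of 1 z 0 s 0 t] that by (simp add: S)
  obtain x where x: "bounded_functional Z x" "\<And>s z. z \<in> carrier Z \<Longrightarrow> F 0 1 s z = x (act s z)"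
    "\<And>s z. z \<in> carrier Z \<Longrightarrow> x (\<epsilon> 0 0 (act s z)) = x (act s z)"
    by (rule F_multiplier[of 0 1, OF _ _ m01]) simp_all
  \<comment> \<open>The other Leibniz term is \<open>F 0 0\<close> at \<open>act t z\<close>, so the
    vanishing of \<open>F 0 0\<close> has to come first.\<close>
  have m11: "F 1 1 (s * t) z = F 1 1 t (act s z)" if "z \<in> carrier Z" for s t z
    using R[of 1 z 0 s 1 t] that F00[OF act_closed[OF that]] by (simp add: S)
  obtain y where y: "bounded_functional Z y" "\<And>s z. z \<in> carrier Z \<Longrightarrow> F 1 1 s z = y (act s z)"
    "\<And>s z. z \<in> carrier Z \<Longrightarrow> y (\<epsilon> 0 0 (act s z)) = y (act s z)"
    by (rule F_multiplier[of 1 1, OF _ _ m11]) simp_all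
  have F02: "F 0 2 s z = 0" if "z \<in> carrier Z" for s z
    using R[of 2 z 0 "s * star s" 0 s] that unit_idempotent by (simp add: S)
  have F20: "F 2 0 s z = 0" if "z \<in> carrier Z" for s z
    using R[of 0 z 2 "s * star s" 2 s] that unit_idempotent by (simp add: S)
  have F21: "F 2 1 s z = - x (act s z)" if z: "z \<in> carrier Z" for s z
  proof -
    have "F 2 1 s z = F 2 1 s (act (s * star s) z)"
      using R[of 1 z 2 s 2 "s * star s"] z unit_idempotent by (simp add: S)
    also have "\<dots> = - F 0 1 (s * star s) (act s z)"
      using R[of 1 z 0 "s * star s" 2 s] z by (simp add: S add_eq_0_iff)
    also have "\<dots> = - x (act s z)"
      using x(2)[OF act_closed[OF z]] z by (simp add: act_act unit_idempotent)
    finally show ?thesis .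
  qed
  have F12: "F 1 2 s z = 0" if "z \<in> carrier Z" for s z
    using R[of 2 z 0 "s * star s" 1 s] that unit_idempotent by (simp add: S)
  have F10: "F 1 0 s z = 0" if "z \<in> carrier Z" for s z
    using R[of 0 z 1 s 2 "s * star s"] that unit_idempotent by (simp add: S)
  \<comment> \<open>The right action of \<open>emb 0\<close> keeps coordinate 1, so \<open>x\<close>
    goes there with positive sign; that of \<open>emb 1\<close> carries coordinate 1 to coordinate
    2, so \<open>y\<close> placed there yields \<open>F 1 1\<close>.\<close>
  define \<psi> where "\<psi> w = x (\<epsilon> 0 1 w) + y (\<epsilon> 0 2 w)" for w
  obtain N where N: "\<forall>z\<in>carrier Z. vnorm Z (\<epsilon> 0 1 z) \<le> N * vnorm Z z" using bound[of 0 1] by auto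
  obtain N' where N': "\<forall>z\<in>carrier Z. vnorm Z (\<epsilon> 0 2 z) \<le> N' * vnorm Z z" using bound[of 0 2] by auto
  have "bounded_functional Z \<psi>"
    using Z.bounded_functional_add[OF Z.bounded_functional_comp[OF x(1) lin[of 0 1], of N]
        Z.bounded_functional_comp[OF y(1) lin[of 0 2], of N']] N N'
    by (simp add: \<psi>_def[abs_def])
  moreover have col: "\<psi> (\<epsilon> l 0 (act s z)) = (if l = 1 then x (act s z) else if l = 2 then y (act s z) else 0)"
    if "l < 3" "z \<in> carrier Z" for l s z
    using less_3_cases[OF that(1)] that act_closed[OF that(2)]
    by (auto simp: \<psi>_def mult x(3) y(3) Z.functional_zero[OF x(1)] Z.functional_zero[OF y(1)])
  moreover have psi0: "\<psi> (vzero Z) = 0"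
    using Z.functional_zero calculation(1) by blast
  ultimately show ?thesis
  proof (intro inner_if_columns)
    fix i l s z assume il: "i < (3::nat)" "l < (3::nat)" and z: "z \<in> carrier Z"
    then show "F i l s z = \<psi> (ract Z (\<epsilon> l 0 z) (emb i (delta s))) - \<psi> (lact Z (emb i (delta s)) (\<epsilon> l 0 z))"
      using less_3_cases[OF il(1)] less_3_cases[OF il(2)]
      by (elim disjE) (simp_all add: column_acts shape col psi0 F00 F22 x(2) y(2) F02 F20 F21 F12 F10)
  qed
qed

end

declare One_nat_def [simp] T0_simps [simp]

text \<open>The derivation is pulled back along \<open>h\<close>, and the element that implements it
  there is pushed forward.\<close>

lemma inner_derivation_isometry:
  assumes iso: "module_isometry R A X Y h" and X: "banach_module R A X"
    and act: "banach_bimodule R A (aleft A) (aright A)"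
    and inner: "\<And>D. module_derivation R A X D \<Longrightarrow> inner_derivation A X D"
    and D: "module_derivation R A Y D"
  shows "inner_derivation A Y D"
proof -
  note I = module_isometryD[OF iso]
  note L = linear_mapD[OF I(2)]
  interpret X: normed_bimod X using X by (rule normed_bimod_if_banach_module)
  note cl = banach_module_closed[OF X]
  define g where "g = inv_into (carrier X) h"
  have g: "g (h x) = x" if "x \<in> carrier X" for x
    using I(1) that by (simp add: g_def bij_betw_def)
  have hg: "h (g y) = y" and gm: "g y \<in> carrier X" if "y \<in> carrier Y" for y
    using I(1) that by (auto simp: g_def bij_betw_def f_inv_into_f inv_into_into)
  have eq: "x = g y" if "h x = y" "x \<in> carrier X" for x y using g that by auto
  have Dm: "D a \<in> carrier Y" if "a \<in> carrier A" for a using D that by (simp add: module_derivation_def)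
  have "module_derivation R A X (\<lambda>a. g (D a))"
    unfolding module_derivation_def
  proof (intro conjI ballI)
    fix a assume a: "a \<in> carrier A"
    show "g (D a) \<in> carrier X" using gm Dm a by blast
    fix b assume b: "b \<in> carrier A"
    show "g (D (vadd A a b)) = vadd X (g (D a)) (g (D b))"
      by (rule eq[symmetric]) (use D a b in \<open>simp_all add: L(2) gm hg Dm X.add_closed module_derivation_def\<close>)
    show "g (D (amult A a b)) = vadd X (ract X (g (D a)) b) (lact X a (g (D b)))"
      by (rule eq[symmetric])
        (use D a b in \<open>simp_all add: L(2) gm hg Dm X.add_closed cl I(5,6) module_derivation_def\<close>)
  next
    fix \<alpha> a assume a: "\<alpha> \<in> carrier R" "a \<in> carrier A"
    show "g (D (aleft A \<alpha> a)) = lscal X \<alpha> (g (D a))"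
      by (rule eq[symmetric]) (use D a in \<open>simp_all add: gm hg Dm cl I(7) module_derivation_def\<close>)
    show "g (D (aright A a \<alpha>)) = rscal X (g (D a)) \<alpha>"
      by (rule eq[symmetric]) (use D a in \<open>simp_all add: gm hg Dm cl I(8) module_derivation_def\<close>)
  next
    obtain M where M: "M > 0" "\<forall>a\<in>carrier A. vnorm Y (D a) \<le> M * vnorm A a"
      using D by (auto simp: module_derivation_def)
    have "vnorm X (g (D a)) = vnorm Y (D a)" if "a \<in> carrier A" for a
      using I(4)[OF gm[OF Dm[OF that]]] hg[OF Dm[OF that]] by simp
    then show "\<exists>M>0. \<forall>a\<in>carrier A. vnorm X (g (D a)) \<le> M * vnorm A a" using M by auto
  qed
  from inner[OF this] obtain x where x: "x \<in> carrier X"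
    "\<And>a. a \<in> carrier A \<Longrightarrow> g (D a) = vsub X (lact X a x) (ract X x a)"
    by (auto simp: inner_derivation_def)
  have "D a = vsub Y (lact Y a (h x)) (ract Y (h x) a)" if a: "a \<in> carrier A" for a
  proof -
    have "D a = h (vsub X (lact X a x) (ract X x a))" using x(2)[OF a] hg[OF Dm[OF a]] by metis
    then show ?thesis using a x(1) by (simp add: vsub_def L(2,3) cl X.scale_closed I(5,6))
  qed
  then show ?thesis unfolding inner_derivation_def using L(1)[OF x(1)] by blast
qed

theorem mainTheorem7:
  fixes k :: nat
  assumes "inverse_semigroup TYPE('s::ab_semigroup_mult)"
    and "k \<ge> 1"
    and "condition_D k (idempotents :: 's set)"
  shows "permanently_weakly_module_amenable TYPE('u)
           (frak_T0 :: 's tri alg) (T0 :: ('s tri, 's tri) modalg)"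
  unfolding permanently_weakly_module_amenable_def n_weakly_module_amenable_def
proof (intro allI impI conjI)
  show "banach_module_algebra (frak_T0 :: 's tri alg) (T0 :: ('s tri, 's tri) modalg)"
    by (rule banach_module_algebra_T0[OF assms(1)])
  fix n :: nat and Y :: "('u, 's tri, 's tri) bimod"
  assume n: "1 \<le> n" and Y: "nth_dual frak_T0 T0 (quotient_module T0 (module_ideal frak_T0 T0)) n Y"
  show "commutative_banach_module frak_T0 T0 Y"
    using nth_dual_coords[OF assms(1) Y] by blast
  fix D assume D: "module_derivation frak_T0 T0 Y D"
  note act = banach_bimodule_frak_T0[OF assms(1)]
  from Y show "inner_derivation T0 Y D"
  \<comment> \<open>As n >= 1, the module \<open>Y\<close> is a copy of the dual of some
    \<open>Z\<close>, and the functionals live on this \<open>Z\<close>.\<close>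
  proof cases
    case base
    with n show ?thesis by simp
  next
    case (step m Z h)
    have bZ: "banach_module frak_T0 T0 Z"
      using nth_dual_coords[OF assms(1) step(2)] by (simp add: commutative_banach_module_def)
    have inner: "inner_derivation T0 (dual_module Z) d"
      if d: "module_derivation frak_T0 T0 (dual_module Z) d" for d
    \<comment> \<open>The parity that matters is that of \<open>Z\<close>, one level below
      \<open>Y\<close>.\<close>
    proof (cases "even m")
      case True
      then obtain \<epsilon> where "matrix_coords Z \<epsilon> True 1 2 False 1 0"
        using nth_dual_coords[OF assms(1) step(2)] by auto
      then interpret tri_derivation Z \<epsilon> True 1 2 False 1 0 k d
        using assms bZ d by (simp add: tri_derivation_def tri_derivation_axioms_def)
      show ?thesis by (rule inner_even) simp_all
    next
      case False
      then obtain \<epsilon> where "matrix_coords Z \<epsilon> False 0 1 True 2 1"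
        using nth_dual_coords[OF assms(1) step(2)] by auto
      then interpret tri_derivation Z \<epsilon> False 0 1 True 2 1 k d
        using assms bZ d by (simp add: tri_derivation_def tri_derivation_axioms_def)
      show ?thesis by (rule inner_odd) simp_all
    qed
    show ?thesis
      by (rule inner_derivation_isometry[OF step(3) banach_module_dual[OF bZ act] act inner D])
  qed
qed

end
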